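(* Let $\{P_\theta\}_{\theta\in\Theta}$ be a family as described in the context, which is differentiable in quadratic mean, satisfies: for every compact $K\subset\Theta$ and every $h\in\mathbb{R}^m$, $\sup_{\theta\in K}\mathrm{E}_\theta e^{h^T\ell_\theta}<\infty$, and has $J_\theta$ nonsingular. Let $(\Omega',\mathcal{X}'):=(\mathbb{R}^m\times[0,1],\mathcal{B}(\mathbb{R}^m\times[0,1]))$ and fix $\theta\in\Theta$. Then there exist probability measures $\tilde P^n_{\theta'}$ on $(\Omega^n\times\Omega',\mathcal{X}^{\otimes n}\otimes\mathcal{X}')$ whose marginal on $\Omega^n$ is $P^n_{\theta'}$, and Markov kernels $x\mapsto R^n_\theta(\cdot|x)$ from $\mathbb{R}^m$ to $\Omega^n\times\Omega'$ (depending on $\theta,n$ but not on $h$), such that, with $\lambda^n_h$ of law $\mathrm{N}(h,J_\theta^{-1})$ and $Q^n_{\theta,h}(A):=\mathrm{E}^{\lambda^n_h}R^n_\theta(A|\lambda^n_h)=\int R^n_\theta(A|x)\,\mathrm{N}(h,J_\theta^{-1})(dx)$, for every compact $K'\subset\mathbb{R}^m$, \[ \lim_{n\to\infty}\sup_{h\in K'}\left\Vert\tilde P^n_{\theta+hn^{-1/2}}-Q^n_{\theta,h}\right\Vert_1=0 . \]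
   Context: $\Theta$ is an open subset of $\mathbb{R}^m$, $(\Omega,\mathcal{X})$ is a Polish space with its Borel $\sigma$-algebra, each $P_\theta$ has density $p_\theta$ with respect to a fixed measure $\mu$, and $P^n_\theta:=P_\theta^{\otimes n}$; $\mathrm{E}_\theta$ is expectation under $P_\theta$. Differentiability in quadratic mean: there is a measurable $\ell_\theta:\Omega\to\mathbb{R}^m$ with $\lim_{h\to0}\Vert h\Vert^{-2}\int\big(\sqrt{p_{\theta+h}}-\sqrt{p_\theta}-\tfrac12 h^T\ell_\theta\sqrt{p_\theta}\big)^2d\mu=0$ for all $\theta$. $J_\theta:=[\mathrm{E}_\theta\ell_{\theta,i}\ell_{\theta,j}]_{i,j}$. $\mathrm{N}(\mu,\Sigma)$ is the Gaussian law; $\Vert\cdot\Vert_1$ is the total variation ($L^1$) norm. *)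

theory Defs
  imports "HOL-Probability.Probability"
begin

text \<open>Multivariate Gaussian law N(h, Sigma) on real^'m (Sigma assumed positive definite),
  given by its Lebesgue density.\<close>
definition mvnormal_density :: "real^'m \<Rightarrow> real^'m^'m \<Rightarrow> real^'m \<Rightarrow> real" where
  "mvnormal_density h S x =
     exp (- (1/2) * ((x - h) \<bullet> (matrix_inv S *v (x - h)))) / sqrt ((2 * pi) ^ CARD('m) * det S)"

definition mvnormal :: "real^'m \<Rightarrow> real^'m^'m \<Rightarrow> (real^'m) measure" where
  "mvnormal h S = density lborel (\<lambda>x. ennreal (mvnormal_density h S x))"

definition fisher_info :: "(real^'m \<Rightarrow> 'a measure) \<Rightarrow> (real^'m \<Rightarrow> 'a \<Rightarrow> real^'m) \<Rightarrow> real^'m \<Rightarrow> real^'m^'m" where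
  "fisher_info P l \<theta> = (\<chi> i j. \<integral>x. (l \<theta> x $ i) * (l \<theta> x $ j) \<partial>P \<theta>)"

text \<open>Total variation (L1) distance of two probability measures:
  ||P - Q||_1 = 2 sup_A |P(A) - Q(A)|.\<close>
definition tv_dist :: "'a measure \<Rightarrow> 'a measure \<Rightarrow> ennreal" where
  "tv_dist M N = 2 * (SUP A \<in> sets M. ennreal \<bar>measure M A - measure N A\<bar>)"

definition sample_space :: "nat \<Rightarrow> (nat \<Rightarrow> 'a::topological_space) measure" where
  "sample_space n = PiM {..<n} (\<lambda>_. borel)"

definition Omega' :: "((real^'m) \<times> real) measure" where
  "Omega' = restrict_space borel (UNIV \<times> {0..1})"

definition ext_space :: "nat \<Rightarrow> ((nat \<Rightarrow> 'a::topological_space) \<times> ((real^'m) \<times> real)) measure" where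
  "ext_space n = sample_space n \<Otimes>\<^sub>M Omega'"

end

theory Submission
  imports Defs "HOL-Library.Landau_Symbols"
begin

text \<open>
  Whitening the score by \<open>B\<close> with \<open>B\<^sup>T J B = 1\<close> reduces to unit Fisher information. By
  differentiability in quadratic mean and the exponential moments, the squared Hellinger distance
  between the law at the local parameter \<open>h\<close> and the exponentially tilted law with density proportional
  to \<open>exp (h \<bullet> s / \<surd>n)\<close> is \<open>o(1/n)\<close>, so the \<open>n\<close>-fold products merge in total variation, and the likelihood
  ratio of the tilted products is exactly \<open>exp (h \<bullet> Y\<^sub>n - \<kappa>\<^sub>n)\<close> with the normalised score sum \<open>Y\<^sub>n\<close>.

  For \<open>a\<^sup>2 + e\<^sup>2 = 1\<close> the smoothed statistic \<open>a Y\<^sub>n + e Z\<close> with an independent Gaussian \<open>Z\<close> has a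
  density which, by Fourier inversion and the central limit theorem, converges pointwise to the standard
  Gaussian density. The kernel is the conditional law of the sample given the value of this statistic, at
  the base parameter. The Hellinger affinity between the tilted joint law of sample and statistic and the
  law generated by the kernel from a shifted Gaussian is an integral whose integrand converges pointwise;
  Fatou's lemma bounds its lower limit below by \<open>exp (- (1 - a) |h|\<^sup>2 / 4)\<close>, which tends to \<open>1\<close> as \<open>a\<close>
  tends to \<open>1\<close>. Letting \<open>a\<close> tend to \<open>1\<close> slowly with \<open>n\<close> serves all compact sets of \<open>h\<close> at once. The auxiliary
  coordinate in \<open>Omega'\<close> is a point mass at \<open>0\<close>.
\<close>

subsection \<open>Total variation\<close>

lemma tv_dist_upper: "A \<in> sets M \<Longrightarrow> 2 * ennreal \<bar>measure M A - measure N A\<bar> \<le> tv_dist M N"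
  unfolding tv_dist_def by (intro mult_left_mono SUP_upper) auto

lemma tv_dist_least:
  assumes "\<And>A. A \<in> sets M \<Longrightarrow> 2 * ennreal \<bar>measure M A - measure N A\<bar> \<le> c"
  shows "tv_dist M N \<le> c"
  unfolding tv_dist_def SUP_mult_left_ennreal by (rule SUP_least) (rule assms)

lemma tv_dist_triangle:
  assumes "sets M = sets N"
  shows "tv_dist M K \<le> tv_dist M N + tv_dist N K"
proof (rule tv_dist_least)
  fix A assume A_in: "A \<in> sets M"
  have "ennreal \<bar>measure M A - measure K A\<bar>
      \<le> ennreal \<bar>measure M A - measure N A\<bar> + ennreal \<bar>measure N A - measure K A\<bar>"
    by (simp add: ennreal_leI flip: ennreal_plus)
  then have "2 * ennreal \<bar>measure M A - measure K A\<bar>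
      \<le> 2 * ennreal \<bar>measure M A - measure N A\<bar> + 2 * ennreal \<bar>measure N A - measure K A\<bar>"
    unfolding distrib_left[symmetric] by (rule mult_left_mono) simp
  also have "\<dots> \<le> tv_dist M N + tv_dist N K"
    using A_in assms by (intro add_mono tv_dist_upper) auto
  finally show "2 * ennreal \<bar>measure M A - measure K A\<bar> \<le> tv_dist M N + tv_dist N K" .
qed

lemma tv_dist_distr_le:
  assumes f_measurable: "f \<in> M \<rightarrow>\<^sub>M T" and sets_eq: "sets M = sets N"
  shows "tv_dist (distr M T f) (distr N T f) \<le> tv_dist M N"
proof (rule tv_dist_least)
  fix A assume "A \<in> sets (distr M T f)"
  then have A_in: "A \<in> sets T" by simp
  have f_measurable_N: "f \<in> N \<rightarrow>\<^sub>M T" using f_measurable sets_eq by (simp cong: measurable_cong_sets)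
  show "2 * ennreal \<bar>measure (distr M T f) A - measure (distr N T f) A\<bar> \<le> tv_dist M N"
    using tv_dist_upper[OF measurable_sets[OF f_measurable A_in], of N] sets_eq_imp_space_eq[OF sets_eq]
    by (simp add: measure_distr f_measurable f_measurable_N A_in)
qed

subsection \<open>Probability densities and the Hellinger distance\<close>

lemma integrable_mult_of_square_integrable:
  fixes f g :: "'a \<Rightarrow> real"
  assumes [measurable]: "f \<in> borel_measurable M" "g \<in> borel_measurable M"
    and squares: "integrable M (\<lambda>x. (f x)\<^sup>2)" "integrable M (\<lambda>x. (g x)\<^sup>2)"
  shows "integrable M (\<lambda>x. f x * g x)"
proof (rule Bochner_Integration.integrable_bound[OF Bochner_Integration.integrable_add[OF squares]])
  have "\<bar>f x * g x\<bar> \<le> (f x)\<^sup>2 + (g x)\<^sup>2" for x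
    using sum_squares_bound[of "f x" "g x"] sum_squares_bound[of "f x" "- g x"] by (simp add: abs_if)
  then show "AE x in M. norm (f x * g x) \<le> norm ((f x)\<^sup>2 + (g x)\<^sup>2)" by simp
qed measurable

lemma Cauchy_Schwarz_integral:
  fixes f g :: "'a \<Rightarrow> real"
  assumes [measurable]: "f \<in> borel_measurable M" "g \<in> borel_measurable M"
    and squares: "integrable M (\<lambda>x. (f x)\<^sup>2)" "integrable M (\<lambda>x. (g x)\<^sup>2)"
  shows "(\<integral>x. \<bar>f x * g x\<bar> \<partial>M) \<le> sqrt (\<integral>x. (f x)\<^sup>2 \<partial>M) * sqrt (\<integral>x. (g x)\<^sup>2 \<partial>M)"
proof -
  have nn_integral_square: "(\<integral>\<^sup>+x. ennreal \<bar>u x\<bar> ^ 2 \<partial>M) = ennreal (\<integral>x. (u x)\<^sup>2 \<partial>M)"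
    if "integrable M (\<lambda>x. (u x)\<^sup>2)" for u :: "'a \<Rightarrow> real"
    by (subst nn_integral_eq_integral[symmetric, OF that]) (auto simp: ennreal_power)
  have "ennreal (\<integral>x. \<bar>f x * g x\<bar> \<partial>M) = (\<integral>\<^sup>+x. ennreal \<bar>f x\<bar> * ennreal \<bar>g x\<bar> \<partial>M)"
    using integrable_mult_of_square_integrable[OF assms]
    by (subst nn_integral_eq_integral[symmetric])
       (auto simp: ennreal_mult[symmetric] abs_mult[symmetric])
  then have "(ennreal (\<integral>x. \<bar>f x * g x\<bar> \<partial>M))\<^sup>2 \<le> ennreal (\<integral>x. (f x)\<^sup>2 \<partial>M) * ennreal (\<integral>x. (g x)\<^sup>2 \<partial>M)"
    using Cauchy_Schwarz_nn_integral[of "\<lambda>x. ennreal \<bar>f x\<bar>" M "\<lambda>x. ennreal \<bar>g x\<bar>"] squares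
    by (simp add: nn_integral_square)
  then have "(\<integral>x. \<bar>f x * g x\<bar> \<partial>M)\<^sup>2 \<le> (\<integral>x. (f x)\<^sup>2 \<partial>M) * (\<integral>x. (g x)\<^sup>2 \<partial>M)"
    by (simp add: ennreal_power ennreal_mult[symmetric])
  then show ?thesis
    unfolding real_sqrt_mult[symmetric] by (rule real_le_rsqrt)
qed

abbreviation real_density :: "'a measure \<Rightarrow> ('a \<Rightarrow> real) \<Rightarrow> 'a measure" where
  "real_density M f \<equiv> density M (\<lambda>x. ennreal (f x))"

definition prob_density :: "'a measure \<Rightarrow> ('a \<Rightarrow> real) \<Rightarrow> bool" where
  "prob_density M f \<longleftrightarrow> f \<in> borel_measurable M \<and> (\<forall>x\<in>space M. 0 \<le> f x)
    \<and> prob_space (real_density M f)"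

lemma prob_densityD:
  assumes "prob_density M f"
  shows prob_density_measurable: "f \<in> borel_measurable M"
    and prob_density_nonneg: "x \<in> space M \<Longrightarrow> 0 \<le> f x"
    and prob_density_AE_nonneg: "AE x in M. 0 \<le> f x"
    and prob_space_prob_density: "prob_space (real_density M f)"
  using assms by (auto simp: prob_density_def)

lemma prob_density_nn_integral:
  assumes density: "prob_density M f"
  shows "(\<integral>\<^sup>+x. ennreal (f x) \<partial>M) = 1"
  using prob_space.emeasure_space_1[OF prob_space_prob_density[OF density]]
      prob_density_measurable[OF density]
  by (simp add: emeasure_density cong: nn_integral_cong)

lemma prob_densityI:
  assumes [measurable]: "f \<in> borel_measurable M" and "\<And>x. x \<in> space M \<Longrightarrow> 0 \<le> f x"
    and "(\<integral>\<^sup>+x. ennreal (f x) \<partial>M) = 1"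
  shows "prob_density M f"
  using assms unfolding prob_density_def
  by (auto intro!: prob_spaceI simp: emeasure_density cong: nn_integral_cong)

lemma prob_density_integral:
  assumes density: "prob_density M f"
  shows integrable_prob_density: "integrable M f" and integral_prob_density: "integral\<^sup>L M f = 1"
  using prob_density_nn_integral[OF density] prob_densityD(1,3)[OF density]
  by (auto intro!: integrableI_nonneg integral_eq_nn_integral[THEN trans])

lemma prob_density_sqrt:
  assumes density: "prob_density M f"
  shows integrable_sqrt_prob_density: "integrable M (\<lambda>x. (sqrt (f x))\<^sup>2)"
    and integral_sqrt_prob_density: "(\<integral>x. (sqrt (f x))\<^sup>2 \<partial>M) = 1"
proof -
  have sqrt_square: "(sqrt (f x))\<^sup>2 = f x" if "x \<in> space M" for x
    using prob_density_nonneg[OF density that] by simp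
  show "integrable M (\<lambda>x. (sqrt (f x))\<^sup>2)" "(\<integral>x. (sqrt (f x))\<^sup>2 \<partial>M) = 1"
    using prob_density_integral[OF density]
    by (simp_all only: sqrt_square
        cong: Bochner_Integration.integrable_cong Bochner_Integration.integral_cong)
qed

lemma tv_dist_density_le_L1:
  assumes f_density: "prob_density M f" and g_density: "prob_density M g"
  shows "tv_dist (real_density M f) (real_density M g) \<le> ennreal (\<integral>x. \<bar>f x - g x\<bar> \<partial>M)"
proof (rule tv_dist_least)
  fix A assume "A \<in> sets (real_density M f)"
  then have A_in[measurable]: "A \<in> sets M" by simp
  have measure_density: "measure (real_density M u) A = (\<integral>x. u x * indicator A x \<partial>M)"
    and integrable_indicator: "integrable M (\<lambda>x. u x * indicator A x)"
        if u_density: "prob_density M u" for u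
  proof -
    note [measurable] = prob_density_measurable[OF u_density]
    have "measure (real_density M u) A = (\<integral>x. indicator A x \<partial>real_density M u)"
      by simp
    also have "\<dots> = (\<integral>x. u x * indicator A x \<partial>M)"
      by (rule integral_real_density) (use prob_density_AE_nonneg[OF u_density] in auto)
    finally show "measure (real_density M u) A = (\<integral>x. u x * indicator A x \<partial>M)" .
    show "integrable M (\<lambda>x. u x * indicator A x)"
      by (rule integrable_real_mult_indicator[OF A_in integrable_prob_density[OF u_density]])
  qed
  note integrable_facts = prob_density_integral[OF f_density] prob_density_integral[OF g_density]
      integrable_indicator[OF f_density] integrable_indicator[OF g_density]
  have "2 * (measure (real_density M f) A - measure (real_density M g) A)
      = (\<integral>x. 2 * (f x * indicator A x - g x * indicator A x) - (f x - g x) \<partial>M)"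
    using integrable_facts by (simp add: measure_density f_density g_density)
  also have "\<bar>\<dots>\<bar> \<le> (\<integral>x. \<bar>2 * (f x * indicator A x - g x * indicator A x) - (f x - g x)\<bar> \<partial>M)"
    by (rule integral_abs_bound)
  also have "\<dots> = (\<integral>x. \<bar>f x - g x\<bar> \<partial>M)"
    by (rule Bochner_Integration.integral_cong) (auto simp: indicator_def)
  finally have "2 * \<bar>measure (real_density M f) A - measure (real_density M g) A\<bar>
      \<le> (\<integral>x. \<bar>f x - g x\<bar> \<partial>M)" unfolding abs_mult by simp
  from ennreal_leI[OF this]
  show "2 * ennreal \<bar>measure (real_density M f) A - measure (real_density M g) A\<bar>
      \<le> ennreal (\<integral>x. \<bar>f x - g x\<bar> \<partial>M)"
    by (simp add: ennreal_mult')
qed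

definition hellinger_affinity :: "'a measure \<Rightarrow> ('a \<Rightarrow> real) \<Rightarrow> ('a \<Rightarrow> real) \<Rightarrow> real" where
  "hellinger_affinity M f g = (\<integral>x. sqrt (f x) * sqrt (g x) \<partial>M)"

definition hellinger_sqdist :: "'a measure \<Rightarrow> ('a \<Rightarrow> real) \<Rightarrow> ('a \<Rightarrow> real) \<Rightarrow> real" where
  "hellinger_sqdist M f g = (\<integral>x. (sqrt (f x) - sqrt (g x))\<^sup>2 \<partial>M)"

context
  fixes M :: "'a measure" and f g :: "'a \<Rightarrow> real"
  assumes f_density: "prob_density M f" and g_density: "prob_density M g"
begin

lemma integrable_hellinger_affinity: "integrable M (\<lambda>x. sqrt (f x) * sqrt (g x))"
proof -
  note [measurable] = prob_density_measurable[OF f_density] prob_density_measurable[OF g_density]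
  show ?thesis
    by (intro integrable_mult_of_square_integrable integrable_sqrt_prob_density f_density
        g_density) measurable
qed

lemma hellinger_sqdist_eq_affinity: "hellinger_sqdist M f g = 2 - 2 * hellinger_affinity M f g"
  using integrable_hellinger_affinity
  by (simp add: hellinger_sqdist_def hellinger_affinity_def power2_diff
      prob_density_sqrt[OF f_density] prob_density_sqrt[OF g_density]
      mult.assoc)

lemma hellinger_affinity_nonneg: "0 \<le> hellinger_affinity M f g"
  unfolding hellinger_affinity_def
  using prob_density_nonneg[OF f_density] prob_density_nonneg[OF g_density]
  by (intro Bochner_Integration.integral_nonneg) simp

lemma hellinger_affinity_le_1: "hellinger_affinity M f g \<le> 1"
proof -
  have "0 \<le> hellinger_sqdist M f g"
    unfolding hellinger_sqdist_def by simp
  then show ?thesis by (simp add: hellinger_sqdist_eq_affinity)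
qed

lemma tv_dist_density_le_hellinger:
  "tv_dist (real_density M f) (real_density M g)
    \<le> ennreal (2 * sqrt (hellinger_sqdist M f g))"
proof -
  note [measurable] = prob_density_measurable[OF f_density] prob_density_measurable[OF g_density]
  note integrable_facts = prob_density_sqrt[OF f_density]
      prob_density_sqrt[OF g_density] integrable_hellinger_affinity
  have "f x - g x = (sqrt (f x) - sqrt (g x)) * (sqrt (f x) + sqrt (g x))" if "x \<in> space M" for x
    using prob_density_nonneg[OF f_density that] prob_density_nonneg[OF g_density that]
    by (simp add: algebra_simps)
  then have "(\<integral>x. \<bar>f x - g x\<bar> \<partial>M) = (\<integral>x. \<bar>(sqrt (f x) - sqrt (g x)) * (sqrt (f x) + sqrt (g x))\<bar> \<partial>M)"
    by (intro Bochner_Integration.integral_cong) simp_all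
  also have "\<dots> \<le> sqrt (hellinger_sqdist M f g) * sqrt (\<integral>x. (sqrt (f x) + sqrt (g x))\<^sup>2 \<partial>M)"
    unfolding hellinger_sqdist_def
    by (rule Cauchy_Schwarz_integral; (measurable; fail)?)
       (use integrable_facts in \<open>simp_all add: power2_diff power2_sum mult.assoc\<close>)
  also have "(\<integral>x. (sqrt (f x) + sqrt (g x))\<^sup>2 \<partial>M) = 2 + 2 * hellinger_affinity M f g"
    using integrable_facts by (simp add: power2_sum mult.assoc hellinger_affinity_def)
  also have "sqrt (hellinger_sqdist M f g) * sqrt (2 + 2 * hellinger_affinity M f g)
      \<le> sqrt (hellinger_sqdist M f g) * sqrt 4"
    using hellinger_affinity_le_1
    by (intro mult_left_mono real_sqrt_le_mono) (auto simp: hellinger_sqdist_eq_affinity)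
  finally show ?thesis
    using tv_dist_density_le_L1[OF f_density g_density]
    by (auto intro: order_trans ennreal_leI simp: mult.commute)
qed

end

subsection \<open>Product measures\<close>

abbreviation iid :: "nat \<Rightarrow> 'a measure \<Rightarrow> (nat \<Rightarrow> 'a) measure" where
  "iid n M \<equiv> PiM {..<n} (\<lambda>_. M)"

lemma PiM_density:
  assumes sigma_finite: "\<And>i. sigma_finite_measure (M i)"
    and sigma_finite_density: "\<And>i. sigma_finite_measure (density (M i) (f i))"
    and [measurable]: "\<And>i. f i \<in> borel_measurable (M i)" and finite_I: "finite I"
  shows "PiM I (\<lambda>i. density (M i) (f i)) = density (PiM I M) (\<lambda>x. \<Prod>i\<in>I. f i (x i))"
proof -
  interpret M: product_sigma_finite M using sigma_finite by (simp add: product_sigma_finite_def)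
  interpret D: product_sigma_finite "\<lambda>i. density (M i) (f i)" using sigma_finite_density
    by (simp add: product_sigma_finite_def)
  show ?thesis
  proof (rule D.PiM_eqI[symmetric])
    fix A assume "\<And>i. i \<in> I \<Longrightarrow> A i \<in> sets (density (M i) (f i))"
    then have A_sets[measurable]: "\<And>i. i \<in> I \<Longrightarrow> A i \<in> sets (M i)" by simp
    have [measurable]: "Pi\<^sub>E I A \<in> sets (PiM I M)"
      using A_sets by (intro sets_PiM_I_finite finite_I) auto
    have "emeasure (density (PiM I M) (\<lambda>x. \<Prod>i\<in>I. f i (x i))) (Pi\<^sub>E I A)
       = (\<integral>\<^sup>+x. (\<Prod>i\<in>I. f i (x i)) * indicator (Pi\<^sub>E I A) x \<partial>PiM I M)"
      by (subst emeasure_density) (use finite_I in auto)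
    also have "\<dots> = (\<integral>\<^sup>+x. (\<Prod>i\<in>I. f i (x i) * indicator (A i) (x i)) \<partial>PiM I M)"
    proof (intro nn_integral_cong)
      fix x assume "x \<in> space (PiM I M)"
      then have "indicator (Pi\<^sub>E I A) x = (\<Prod>i\<in>I. indicator (A i) (x i) :: ennreal)"
        using finite_I by (auto simp: indicator_def PiE_iff space_PiM extensional_def)
      then show "(\<Prod>i\<in>I. f i (x i)) * indicator (Pi\<^sub>E I A) x = (\<Prod>i\<in>I. f i (x i) * indicator (A i) (x i))"
        by (simp add: prod.distrib)
    qed
    also have "\<dots> = (\<Prod>i\<in>I. \<integral>\<^sup>+x. f i x * indicator (A i) x \<partial>M i)"
      by (rule M.product_nn_integral_prod) (use finite_I A_sets in auto)
    also have "\<dots> = (\<Prod>i\<in>I. emeasure (density (M i) (f i)) (A i))"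
      by (intro prod.cong refl) (simp add: emeasure_density A_sets)
    finally show "emeasure (density (PiM I M) (\<lambda>x. \<Prod>i\<in>I. f i (x i))) (Pi\<^sub>E I A)
      = (\<Prod>i\<in>I. emeasure (density (M i) (f i)) (A i))" .
  qed (use finite_I in \<open>auto intro!: sets_PiM_cong\<close>)
qed

lemma PiM_prob_density:
  assumes sigma_finite: "\<And>i. sigma_finite_measure (M i)"
    and f_density: "\<And>i. prob_density (M i) (f i)" and finite_I: "finite I"
  shows "PiM I (\<lambda>i. real_density (M i) (f i)) = real_density (PiM I M) (\<lambda>x. \<Prod>i\<in>I. f i (x i))"
proof -
  note [measurable] = prob_density_measurable[OF f_density]
  have "PiM I (\<lambda>i. real_density (M i) (f i)) = density (PiM I M) (\<lambda>x. \<Prod>i\<in>I. ennreal (f i (x i)))"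
    by (rule PiM_density)
       (use sigma_finite finite_I in
         \<open>auto intro!: prob_space_imp_sigma_finite prob_space_prob_density f_density\<close>)
  also have "\<dots> = real_density (PiM I M) (\<lambda>x. \<Prod>i\<in>I. f i (x i))"
    by (intro density_cong AE_I2 prod_ennreal; (measurable; fail)?)
       (auto simp: space_PiM PiE_iff prob_density_nonneg[OF f_density])
  finally show ?thesis .
qed

lemma prob_density_PiM:
  assumes sigma_finite: "\<And>i. sigma_finite_measure (M i)"
    and f_density: "\<And>i. prob_density (M i) (f i)" and finite_I: "finite I"
  shows "prob_density (PiM I M) (\<lambda>x. \<Prod>i\<in>I. f i (x i))"
  unfolding prob_density_def
proof (intro conjI ballI)
  note [measurable] = prob_density_measurable[OF f_density]
  show "(\<lambda>x. \<Prod>i\<in>I. f i (x i)) \<in> borel_measurable (PiM I M)" by measurable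
  show "0 \<le> (\<Prod>i\<in>I. f i (x i))" if "x \<in> space (PiM I M)" for x
    using that by (intro prod_nonneg) (auto simp: space_PiM PiE_iff prob_density_nonneg[OF f_density])
  show "prob_space (real_density (PiM I M) (\<lambda>x. \<Prod>i\<in>I. f i (x i)))"
    unfolding PiM_prob_density[OF sigma_finite f_density finite_I, symmetric]
    by (rule prob_space_PiM) (rule prob_space_prob_density[OF f_density])
qed

lemma hellinger_affinity_PiM:
  assumes sigma_finite: "\<And>i. sigma_finite_measure (M i)" and finite_I: "finite I"
    and f_density: "\<And>i. prob_density (M i) (f i)" and g_density: "\<And>i. prob_density (M i) (g i)"
  shows "hellinger_affinity (PiM I M) (\<lambda>x. \<Prod>i\<in>I. f i (x i)) (\<lambda>x. \<Prod>i\<in>I. g i (x i))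
    = (\<Prod>i\<in>I. hellinger_affinity (M i) (f i) (g i))"
proof -
  interpret product_sigma_finite M using sigma_finite by (simp add: product_sigma_finite_def)
  have sqrt_prod: "sqrt (\<Prod>i\<in>I. u i) = (\<Prod>i\<in>I. sqrt (u i))" for u :: "'a \<Rightarrow> real"
    by (induction I rule: infinite_finite_induct) (auto simp: real_sqrt_mult)
  have "hellinger_affinity (PiM I M) (\<lambda>x. \<Prod>i\<in>I. f i (x i)) (\<lambda>x. \<Prod>i\<in>I. g i (x i))
      = (\<integral>x. (\<Prod>i\<in>I. sqrt (f i (x i)) * sqrt (g i (x i))) \<partial>PiM I M)"
    unfolding hellinger_affinity_def by (simp add: sqrt_prod prod.distrib)
  also have "\<dots> = (\<Prod>i\<in>I. hellinger_affinity (M i) (f i) (g i))"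
    unfolding hellinger_affinity_def
    by (intro product_integral_prod finite_I integrable_hellinger_affinity f_density g_density)
  finally show ?thesis .
qed

lemma hellinger_sqdist_PiM_le:
  assumes sigma_finite: "\<And>i. sigma_finite_measure (M i)" and finite_I: "finite I"
    and f_density: "\<And>i. prob_density (M i) (f i)" and g_density: "\<And>i. prob_density (M i) (g i)"
  shows "hellinger_sqdist (PiM I M) (\<lambda>x. \<Prod>i\<in>I. f i (x i)) (\<lambda>x. \<Prod>i\<in>I. g i (x i))
    \<le> (\<Sum>i\<in>I. hellinger_sqdist (M i) (f i) (g i))"
proof -
  let ?\<rho> = "\<lambda>i. hellinger_affinity (M i) (f i) (g i)"
  have "norm ((\<Prod>i\<in>I. 1) - (\<Prod>i\<in>I. ?\<rho> i)) \<le> (\<Sum>i\<in>I. norm (1 - ?\<rho> i))"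
    using hellinger_affinity_nonneg[OF f_density g_density]
        hellinger_affinity_le_1[OF f_density g_density] by (intro norm_prod_diff) auto
  then have "1 - (\<Prod>i\<in>I. ?\<rho> i) \<le> (\<Sum>i\<in>I. 1 - ?\<rho> i)"
    using hellinger_affinity_le_1[OF f_density g_density] by simp
  then show ?thesis
    by (simp add: hellinger_sqdist_eq_affinity f_density g_density prob_density_PiM
        sigma_finite finite_I hellinger_affinity_PiM[OF sigma_finite finite_I f_density g_density]
        sum_subtractf sum_distrib_left[symmetric])
qed

lemma hellinger_sqdist_density_divide:
  assumes [measurable]: "T \<in> borel_measurable M" "f \<in> borel_measurable M" "g \<in> borel_measurable M"
    and T_nonneg: "\<And>x. x \<in> space M \<Longrightarrow> 0 \<le> T x"
    and zero: "\<And>x. x \<in> space M \<Longrightarrow> T x = 0 \<Longrightarrow> f x = 0 \<and> g x = 0"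
  shows "hellinger_sqdist (real_density M T) (\<lambda>x. f x / T x) (\<lambda>x. g x / T x) = hellinger_sqdist M f g"
proof -
  have "hellinger_sqdist (real_density M T) (\<lambda>x. f x / T x) (\<lambda>x. g x / T x)
      = (\<integral>x. T x * (sqrt (f x / T x) - sqrt (g x / T x))\<^sup>2 \<partial>M)"
    unfolding hellinger_sqdist_def by (rule integral_real_density) (use T_nonneg in auto)
  also have "\<dots> = hellinger_sqdist M f g"
    unfolding hellinger_sqdist_def
  proof (rule Bochner_Integration.integral_cong[OF refl])
    fix x assume x_in: "x \<in> space M"
    show "T x * (sqrt (f x / T x) - sqrt (g x / T x))\<^sup>2 = (sqrt (f x) - sqrt (g x))\<^sup>2"
      using T_nonneg[OF x_in] zero[OF x_in]
      by (cases "T x = 0") (auto simp: real_sqrt_divide diff_divide_distrib[symmetric] power_divide)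
  qed
  finally show ?thesis .
qed

lemma prob_density_density_divide:
  assumes density: "prob_density M u" and [measurable]: "T \<in> borel_measurable M"
    and T_nonneg: "\<And>x. x \<in> space M \<Longrightarrow> 0 \<le> T x" and zero: "\<And>x. x \<in> space M \<Longrightarrow> T x = 0 \<Longrightarrow> u x = 0"
  shows real_density_density_divide: "real_density (real_density M T) (\<lambda>x. u x / T x) = real_density M u"
    and "prob_density (real_density M T) (\<lambda>x. u x / T x)"
proof -
  note [measurable] = prob_density_measurable[OF density]
  show density_eq: "real_density (real_density M T) (\<lambda>x. u x / T x) = real_density M u"
    by (rule density_density_divide)
       (use prob_density_AE_nonneg[OF density] T_nonneg zero in \<open>auto intro!: AE_I2\<close>)
  show "prob_density (real_density M T) (\<lambda>x. u x / T x)"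
    unfolding prob_density_def density_eq using density T_nonneg by (auto simp: prob_density_def)
qed

lemma tv_dist_PiM_density_le_of_sigma_finite:
  assumes sigma_finite: "\<And>i. sigma_finite_measure (M i)" and finite_I: "finite I"
    and f_density: "\<And>i. prob_density (M i) (f i)" and g_density: "\<And>i. prob_density (M i) (g i)"
  shows "tv_dist (PiM I (\<lambda>i. real_density (M i) (f i))) (PiM I (\<lambda>i. real_density (M i) (g i)))
    \<le> ennreal (2 * sqrt (\<Sum>i\<in>I. hellinger_sqdist (M i) (f i) (g i)))"
proof -
  have "tv_dist (PiM I (\<lambda>i. real_density (M i) (f i))) (PiM I (\<lambda>i. real_density (M i) (g i)))
    \<le> ennreal (2 * sqrt (hellinger_sqdist (PiM I M) (\<lambda>x. \<Prod>i\<in>I. f i (x i)) (\<lambda>x. \<Prod>i\<in>I. g i (x i))))"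
    unfolding PiM_prob_density[OF sigma_finite f_density finite_I]
      PiM_prob_density[OF sigma_finite g_density finite_I]
    by (intro tv_dist_density_le_hellinger prob_density_PiM sigma_finite f_density g_density finite_I)
  also have "\<dots> \<le> ennreal (2 * sqrt (\<Sum>i\<in>I. hellinger_sqdist (M i) (f i) (g i)))"
    using hellinger_sqdist_PiM_le[OF sigma_finite finite_I f_density g_density]
    by (intro ennreal_leI) simp
  finally show ?thesis .
qed

text \<open>The factors need not be sigma-finite: they are dominated by the finite measures with
  densities \<^term>\<open>f i + g i\<close>.\<close>

lemma tv_dist_PiM_density_le:
  fixes M :: "'i \<Rightarrow> 'a measure"
  assumes finite_I: "finite I" and f_density: "\<And>i. prob_density (M i) (f i)"
    and g_density: "\<And>i. prob_density (M i) (g i)"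
  shows "tv_dist (PiM I (\<lambda>i. real_density (M i) (f i))) (PiM I (\<lambda>i. real_density (M i) (g i)))
    \<le> ennreal (2 * sqrt (\<Sum>i\<in>I. hellinger_sqdist (M i) (f i) (g i)))"
proof -
  note [measurable] = prob_density_measurable[OF f_density] prob_density_measurable[OF g_density]
  note nonneg = prob_density_nonneg[OF f_density] prob_density_nonneg[OF g_density]
  define T where "T i x = f i x + g i x" for i x
  have [measurable]: "T i \<in> borel_measurable (M i)" for i unfolding T_def[abs_def] by measurable
  have dominating: "0 \<le> T i x" "T i x = 0 \<Longrightarrow> f i x = 0 \<and> g i x = 0" if "x \<in> space (M i)" for i x
    using nonneg that by (auto simp: T_def add_nonneg_eq_0_iff)
  define N where "N i = real_density (M i) (T i)" for i
  have sigma_finite_N: "sigma_finite_measure (N i)" for i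
  proof -
    have "(\<integral>\<^sup>+x. ennreal (T i x) \<partial>M i) = 1 + 1"
      using nonneg by (simp add: T_def ennreal_plus nn_integral_add
          prob_density_nn_integral[OF f_density]
          prob_density_nn_integral[OF g_density] cong: nn_integral_cong)
    then have "finite_measure (N i)"
      by (intro finite_measureI) (simp add: N_def emeasure_density cong: nn_integral_cong)
    then show ?thesis by (simp add: finite_measure_def)
  qed
  have f_dominated: "real_density (N i) (\<lambda>x. f i x / T i x) = real_density (M i) (f i)"
      "prob_density (N i) (\<lambda>x. f i x / T i x)"
    and g_dominated: "real_density (N i) (\<lambda>x. g i x / T i x) = real_density (M i) (g i)"
        "prob_density (N i) (\<lambda>x. g i x / T i x)" for i
    using prob_density_density_divide[OF f_density]
        prob_density_density_divide[OF g_density] dominating by (simp_all add: N_def)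
  have "tv_dist (PiM I (\<lambda>i. real_density (N i) (\<lambda>x. f i x / T i x)))
      (PiM I (\<lambda>i. real_density (N i) (\<lambda>x. g i x / T i x)))
    \<le> ennreal (2 * sqrt (\<Sum>i\<in>I. hellinger_sqdist (N i) (\<lambda>x. f i x / T i x) (\<lambda>x. g i x / T i x)))"
    by (intro tv_dist_PiM_density_le_of_sigma_finite sigma_finite_N finite_I f_dominated g_dominated)
  also have "(\<Sum>i\<in>I. hellinger_sqdist (N i) (\<lambda>x. f i x / T i x) (\<lambda>x. g i x / T i x))
      = (\<Sum>i\<in>I. hellinger_sqdist (M i) (f i) (g i))"
    unfolding N_def by (intro sum.cong refl hellinger_sqdist_density_divide) (use dominating in auto)
  finally show ?thesis by (simp only: f_dominated(1) g_dominated(1))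
qed

subsection \<open>Lebesgue measure under linear maps\<close>

lemma prod_Basis_vec: "(\<Prod>b\<in>(Basis :: (real^'n) set). f b) = (\<Prod>i\<in>UNIV. f (axis i 1))"
  by (simp add: Basis_vec_def prod.UNION_disjoint inj_on_def axis_eq_axis prod.reindex cong: prod.cong)

lemma lborel_distr_permute:
  fixes p :: "'n::finite \<Rightarrow> 'n"
  assumes bij_p: "bij p"
  shows "distr lborel borel (\<lambda>x::real^'n. \<chi> i. x $ p i) = lborel"
proof (rule lborel_eqI[symmetric])
  let ?T = "\<lambda>x::real^'n. \<chi> i. x $ p i"
  let ?T' = "\<lambda>x::real^'n. \<chi> i. x $ inv p i"
  have [measurable]: "?T \<in> borel_measurable borel"
    by (intro borel_measurable_continuous_onI continuous_intros)
  fix l u :: "real^'n" assume le_Basis: "\<And>b. b \<in> Basis \<Longrightarrow> l \<bullet> b \<le> u \<bullet> b"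
  have le_component: "l $ i \<le> u $ i" for i using le_Basis[of "axis i 1"]
    by (simp add: inner_axis axis_in_Basis_iff)
  have reindex: "(\<forall>i. Q i (p i)) \<longleftrightarrow> (\<forall>j. Q (inv p j) j)" for Q
    by (metis bij_p bij_inv_eq_iff)
  have "emeasure (distr lborel borel ?T) (box l u) = emeasure lborel (?T -` box l u)"
    by (simp add: emeasure_distr)
  also have "?T -` box l u = box (?T' l) (?T' u)"
    using reindex[of "\<lambda>i j. l $ i < x $ j \<and> x $ j < u $ i" for x] by (simp add: mem_box_cart set_eq_iff)
  also have "emeasure lborel (box (?T' l) (?T' u)) = ennreal (\<Prod>b\<in>Basis. (?T' u - ?T' l) \<bullet> b)"
    by (rule emeasure_lborel_box) (use le_component in \<open>auto simp: Basis_vec_def inner_axis\<close>)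
  also have "(\<Prod>b\<in>Basis. (?T' u - ?T' l) \<bullet> b) = (\<Prod>b\<in>Basis. (u - l) \<bullet> b)"
    using prod.reindex_bij_betw[OF bij_imp_bij_inv[OF bij_p], of "\<lambda>i. u $ i - l $ i"]
    by (simp add: prod_Basis_vec inner_axis)
  finally show "emeasure (distr lborel borel ?T) (box l u) = ennreal (\<Prod>b\<in>Basis. (u - l) \<bullet> b)" .
qed simp

lemma nn_integral_lborel_split_coordinate:
  fixes G :: "'v::euclidean_space \<Rightarrow> ennreal"
  assumes [measurable]: "G \<in> borel_measurable borel" and b_Basis: "b \<in> Basis"
  shows "(\<integral>\<^sup>+x. G x \<partial>lborel) =
    (\<integral>\<^sup>+f. \<integral>\<^sup>+y. G ((\<Sum>d\<in>Basis - {b}. f d *\<^sub>R d) + y *\<^sub>R b) \<partial>lborel \<partial>PiM (Basis - {b}) (\<lambda>_. lborel))"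
proof -
  interpret product_sigma_finite "\<lambda>_::'v. lborel :: real measure"
    by (simp add: product_sigma_finite_def sigma_finite_lborel)
  let ?S = "\<lambda>f::'v \<Rightarrow> real. \<Sum>d\<in>Basis. f d *\<^sub>R d"
  have insert_Basis: "insert b (Basis - {b}) = Basis" using b_Basis by auto
  have sum_update: "?S (f(b := y)) = (\<Sum>d\<in>Basis - {b}. f d *\<^sub>R d) + y *\<^sub>R b" for f y
    using b_Basis by (subst sum.remove[of _ b]) (auto intro!: sum.cong)
  have "(\<integral>\<^sup>+x. G x \<partial>lborel) = (\<integral>\<^sup>+f. G (?S f) \<partial>PiM (insert b (Basis - {b})) (\<lambda>_. lborel))"
    unfolding insert_Basis by (subst lborel_eq) (simp add: nn_integral_distr)
  also have "\<dots> = (\<integral>\<^sup>+f. (\<integral>\<^sup>+y. G (?S (f(b := y))) \<partial>lborel) \<partial>PiM (Basis - {b}) (\<lambda>_. lborel))"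
  proof (rule product_nn_integral_insert)
    show "(\<lambda>f. G (?S f)) \<in> borel_measurable (PiM (insert b (Basis - {b})) (\<lambda>_. lborel))"
      unfolding insert_Basis by measurable
  qed auto
  finally show ?thesis by (simp only: sum_update)
qed

lemma lborel_distr_shear:
  fixes b c :: "'v::euclidean_space"
  assumes b_Basis: "b \<in> Basis" and c_Basis: "c \<in> Basis" and distinct: "b \<noteq> c"
  shows "distr lborel borel (\<lambda>x. x + (x \<bullet> c) *\<^sub>R b) = lborel"
proof (rule measure_eqI)
  let ?T = "\<lambda>x. x + (x \<bullet> c) *\<^sub>R b"
  let ?S = "\<lambda>f. \<Sum>d\<in>Basis - {b}. f d *\<^sub>R d"
  fix A assume "A \<in> sets (distr lborel borel ?T)"
  then have [measurable]: "A \<in> sets borel" by simp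
  have inner_c: "(?S f + y *\<^sub>R b) \<bullet> c = f c" for f y
    using b_Basis c_Basis distinct
    by (simp add: inner_add_left inner_sum_left inner_Basis if_distrib[of "\<lambda>t. _ * t"] sum.delta
        cong: if_cong)
  have shear: "?T (?S f + y *\<^sub>R b) = ?S f + (f c + 1 * y) *\<^sub>R b" for f y
    unfolding inner_c by (simp add: algebra_simps)
  have "(\<integral>\<^sup>+y. indicator A (?T (?S f + y *\<^sub>R b)) \<partial>lborel)
      = (\<integral>\<^sup>+y. indicator A (?S f + y *\<^sub>R b) \<partial>lborel)" for f
    unfolding shear using nn_integral_real_affine[of "\<lambda>y. indicator A (?S f + y *\<^sub>R b)" 1 "f c"] by simp
  then have "(\<integral>\<^sup>+x. indicator A (?T x) \<partial>lborel) = (\<integral>\<^sup>+x. indicator A x \<partial>lborel)"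
    by (subst (1 2) nn_integral_lborel_split_coordinate[OF _ b_Basis]) simp_all
  moreover have "(\<integral>\<^sup>+x. indicator A (?T x) \<partial>lborel) = (\<integral>\<^sup>+x. indicator A x \<partial>distr lborel borel ?T)"
    by (rule nn_integral_distr[symmetric]) simp_all
  ultimately show "emeasure (distr lborel borel ?T) A = emeasure lborel A" by simp
qed simp

lemma lborel_diagonal:
  fixes c :: "'n::finite \<Rightarrow> real"
  assumes "\<And>i. c i \<noteq> 0"
  shows "lborel = density (distr lborel borel (\<lambda>x::real^'n. \<chi> i. c i * x $ i))
      (\<lambda>_. ennreal \<bar>\<Prod>i\<in>UNIV. c i\<bar>)"
proof -
  have "(\<chi> i. c i * x $ i) = 0 + (\<Sum>b\<in>Basis. (c (axis_index b) * (x \<bullet> b)) *\<^sub>R b)" for x :: "real^'n"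
    by (rule euclidean_eqI, simp only: add_0 inner_sum_left_Basis) (auto simp: Basis_vec_def inner_axis)
  then have "lborel = density (distr lborel borel (\<lambda>x::real^'n. \<chi> i. c i * x $ i))
      (\<lambda>_. \<Prod>b\<in>(Basis :: (real^'n) set). \<bar>c (axis_index b)\<bar>)"
    using lborel_affine_euclidean[of "\<lambda>b::real^'n. c (axis_index b)" 0] assms by simp
  then show ?thesis by (simp add: prod_Basis_vec abs_prod)
qed

lemma lborel_linear_comp:
  fixes f g :: "real^'n \<Rightarrow> real^'n"
  assumes "linear f" "linear g"
    and f_scaling: "lborel = density (distr lborel borel f) (\<lambda>_. ennreal \<bar>det (matrix f)\<bar>)"
    and g_scaling: "lborel = density (distr lborel borel g) (\<lambda>_. ennreal \<bar>det (matrix g)\<bar>)"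
  shows "lborel = density (distr lborel borel (f \<circ> g)) (\<lambda>_. ennreal \<bar>det (matrix (f \<circ> g))\<bar>)"
proof -
  have [measurable]: "f \<in> borel_measurable borel" "g \<in> borel_measurable borel"
    using assms(1,2) linear_conv_bounded_linear
    by (blast intro: borel_measurable_continuous_onI linear_continuous_on)+
  have det_comp: "det (matrix (f \<circ> g)) = det (matrix f) * det (matrix g)"
    using assms(1,2) by (simp add: matrix_compose det_mul)
  have "density (distr lborel borel (f \<circ> g)) (\<lambda>_. ennreal \<bar>det (matrix (f \<circ> g))\<bar>)
      = density (density (distr (distr lborel borel g) borel f) (\<lambda>_. ennreal \<bar>det (matrix g)\<bar>))
          (\<lambda>_. ennreal \<bar>det (matrix f)\<bar>)"
    by (simp add: density_density_eq distr_distr det_comp abs_mult ennreal_mult[symmetric] mult.commute)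
  also have "density (distr (distr lborel borel g) borel f) (\<lambda>_. ennreal \<bar>det (matrix g)\<bar>)
      = distr lborel borel f"
    by (subst density_distr) (simp_all flip: g_scaling)
  also have "density (distr lborel borel f) (\<lambda>_. ennreal \<bar>det (matrix f)\<bar>) = lborel"
    by (rule f_scaling[symmetric])
  finally show ?thesis ..
qed

lemma det_matrix_diagonal: "det (matrix (\<lambda>x::real^'n. \<chi> i. c i * x $ i)) = (\<Prod>i\<in>UNIV. c i)"
proof -
  have "matrix (\<lambda>x::real^'n. \<chi> i. c i * x $ i) $ i $ j = (if i = j then c i else 0)" for i j
    by (simp add: matrix_def axis_def)
  then show ?thesis by (subst det_diagonal) auto
qed

lemma abs_det_matrix_transpose:
  assumes "k \<noteq> l"
  shows "\<bar>det (matrix (\<lambda>x::real^'n. \<chi> i. x $ Transposition.transpose k l i))\<bar> = 1"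
proof -
  have "matrix (\<lambda>x. \<chi> i. x $ Transposition.transpose k l i)
      = (\<chi> i. (mat 1 :: real^'n^'n) $ Transposition.transpose k l i)"
    by (auto simp: matrix_def mat_def axis_def vec_eq_iff)
  then show ?thesis using assms by (simp add: det_permute_rows permutes_swap_id sign_swap_id)
qed

lemma det_matrix_shear:
  assumes "k \<noteq> l"
  shows "det (matrix (\<lambda>x::real^'n. \<chi> i. if i = k then x $ k + x $ l else x $ i)) = 1"
proof -
  have "matrix (\<lambda>x. \<chi> i. if i = k then x $ k + x $ l else x $ i)
      = (\<chi> i. if i = k then row k (mat 1 :: real^'n^'n) + 1 *s row l (mat 1) else row i (mat 1))"
    by (auto simp: matrix_def mat_def axis_def vec_eq_iff row_def)
  then show ?thesis using det_row_operation[OF assms, of "mat 1 :: real^'n^'n" 1] by simp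
qed

lemma lborel_linear:
  fixes f :: "real^'n \<Rightarrow> real^'n"
  assumes "linear f" "det (matrix f) \<noteq> 0"
  shows "lborel = density (distr lborel borel f) (\<lambda>_. ennreal \<bar>det (matrix f)\<bar>)"
proof -
  define Q :: "(real^'n \<Rightarrow> real^'n) \<Rightarrow> bool" where
    "Q f \<longleftrightarrow> (det (matrix f) \<noteq> 0
        \<longrightarrow> lborel = density (distr lborel borel f) (\<lambda>_. ennreal \<bar>det (matrix f)\<bar>))" for f
  have "Q f"
  proof (rule induct_linear_elementary[OF assms(1)])
    fix f g :: "real^'n \<Rightarrow> real^'n" assume "linear f" "linear g" "Q f" "Q g"
    then show "Q (f \<circ> g)"
      unfolding Q_def using lborel_linear_comp[of f g] by (auto simp: matrix_compose det_mul)
  next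
    fix f :: "real^'n \<Rightarrow> real^'n" and i assume "linear f" "\<And>x. f x $ i = 0"
    then have "row i (matrix f) = 0" by (simp add: row_def matrix_def vec_eq_iff)
    then show "Q f" unfolding Q_def using det_zero_row(2) by blast
  next
    show "Q (\<lambda>x. \<chi> i. c i * x $ i)" for c
      unfolding Q_def det_matrix_diagonal using lborel_diagonal[of c] by simp
  next
    show "Q (\<lambda>x. \<chi> i. x $ Transposition.transpose k l i)" if "k \<noteq> l" for k l
      unfolding Q_def by (simp add: abs_det_matrix_transpose[OF that] lborel_distr_permute density_1)
  next
    fix k l :: 'n assume kl: "k \<noteq> l"
    have "(\<chi> i. if i = k then x $ k + x $ l else x $ i) = x + (x \<bullet> axis l 1) *\<^sub>R axis k 1"
        for x :: "real^'n"
      unfolding inner_axis by (simp add: vec_eq_iff axis_def)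
    then show "Q (\<lambda>x. \<chi> i. if i = k then x $ k + x $ l else x $ i)"
      unfolding Q_def det_matrix_shear[OF kl]
      using kl lborel_distr_shear[of "axis k 1 :: real^'n" "axis l 1"]
      by (simp add: axis_in_Basis_iff axis_eq_axis density_1)
  qed
  then show ?thesis using assms(2) unfolding Q_def by blast
qed

subsection \<open>Isotropic Gaussian densities\<close>

definition gauss_density :: "real \<Rightarrow> 'v::euclidean_space \<Rightarrow> real" where
  "gauss_density \<sigma> x = exp (- (norm x)\<^sup>2 / (2 * \<sigma>\<^sup>2)) / sqrt (2 * pi * \<sigma>\<^sup>2) ^ DIM('v)"

definition gauss_law :: "'v::euclidean_space \<Rightarrow> 'v measure" where
  "gauss_law m = real_density lborel (\<lambda>x. gauss_density 1 (x - m))"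

lemma gauss_density_measurable [measurable]: "gauss_density \<sigma> \<in> borel_measurable borel"
  unfolding gauss_density_def by measurable

lemma gauss_density_nonneg [simp]: "0 \<le> gauss_density \<sigma> x"
  by (simp add: gauss_density_def)

lemma gauss_density_pos: "0 < \<sigma> \<Longrightarrow> 0 < gauss_density \<sigma> x"
  by (simp add: gauss_density_def)

lemma gauss_density_le_zero: "gauss_density \<sigma> (x::'v::euclidean_space) \<le> gauss_density \<sigma> (0::'v)"
  by (auto simp: gauss_density_def intro!: divide_right_mono)

lemma gauss_density_eq_prod:
  "gauss_density \<sigma> (x::'v::euclidean_space) = (\<Prod>b\<in>Basis. normal_density 0 \<sigma> (x \<bullet> b))"
proof -
  have "(norm x)\<^sup>2 = (\<Sum>b\<in>Basis. (x \<bullet> b)\<^sup>2)"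
    unfolding power2_norm_eq_inner euclidean_inner[of x x] by (simp add: power2_eq_square)
  then have "exp (- (norm x)\<^sup>2 / (2 * \<sigma>\<^sup>2)) = (\<Prod>b\<in>Basis. exp (- (x \<bullet> b)\<^sup>2 / (2 * \<sigma>\<^sup>2)))"
    by (simp add: exp_sum[symmetric] sum_negf sum_divide_distrib)
  then show ?thesis
    by (simp add: gauss_density_def normal_density_def prod_dividef)
qed

lemma gauss_density_diff:
  assumes "0 < \<sigma>"
  shows "gauss_density \<sigma> (x - v) = gauss_density \<sigma> x * exp ((x \<bullet> v - (norm v)\<^sup>2 / 2) / \<sigma>\<^sup>2)"
proof -
  have exponent: "- (norm (x - v))\<^sup>2 / (2 * \<sigma>\<^sup>2) = - (norm x)\<^sup>2 / (2 * \<sigma>\<^sup>2)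
      + (x \<bullet> v - (norm v)\<^sup>2 / 2) / \<sigma>\<^sup>2"
    using assms by (simp add: power2_norm_eq_inner inner_diff inner_commute field_simps)
  show ?thesis unfolding gauss_density_def exponent exp_add by simp
qed

lemma gauss_density_mult_swap:
  fixes x z :: "'v::euclidean_space"
  assumes weights: "a\<^sup>2 + e\<^sup>2 = 1" and "0 < e"
  shows "gauss_density 1 z * gauss_density e (x - a *\<^sub>R z)
      = gauss_density 1 x * gauss_density e (z - a *\<^sub>R x)"
proof -
  have e_square: "e\<^sup>2 = 1 - a\<^sup>2" using weights by simp
  have "(norm (x - a *\<^sub>R z))\<^sup>2 + e\<^sup>2 * (norm z)\<^sup>2 = (norm (z - a *\<^sub>R x))\<^sup>2 + e\<^sup>2 * (norm x)\<^sup>2"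
    unfolding e_square by (simp add: power2_norm_eq_inner inner_diff inner_commute algebra_simps
        power2_eq_square[of a])
  then have "- (norm z)\<^sup>2 / 2 + - (norm (x - a *\<^sub>R z))\<^sup>2 / (2 * e\<^sup>2)
    = - (norm x)\<^sup>2 / 2 + - (norm (z - a *\<^sub>R x))\<^sup>2 / (2 * e\<^sup>2)"
    using \<open>0 < e\<close> by (simp add: field_simps)
  from arg_cong[OF this, of exp, unfolded exp_add] show ?thesis
    by (simp add: gauss_density_def)
qed

lemma density_gauss_density_eq_distr_PiM:
  assumes "0 < \<sigma>"
  shows "real_density lborel (gauss_density \<sigma> :: 'v::euclidean_space \<Rightarrow> real)
    = distr (PiM Basis (\<lambda>_. real_density lborel (normal_density 0 \<sigma>))) borel (\<lambda>f. \<Sum>b\<in>Basis. f b *\<^sub>R b)"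
proof -
  have normal: "prob_density lborel (normal_density 0 \<sigma>)"
    using assms by (simp add: prob_density_def prob_space_normal_density)
  have "PiM (Basis::'v set) (\<lambda>_. real_density lborel (normal_density 0 \<sigma>))
      = real_density (PiM Basis (\<lambda>_. lborel)) (\<lambda>f. \<Prod>b\<in>Basis. normal_density 0 \<sigma> (f b))"
    by (rule PiM_prob_density[OF sigma_finite_lborel normal]) simp
  also have "\<dots> = real_density (PiM Basis (\<lambda>_. lborel)) (\<lambda>f. gauss_density \<sigma> (\<Sum>b\<in>Basis. f b *\<^sub>R b :: 'v))"
    by (intro density_cong) (auto simp: gauss_density_eq_prod)
  finally show ?thesis
    by (subst lborel_eq, subst density_distr) auto
qed

lemma prob_density_gauss_density:
  fixes m :: "'v::euclidean_space"
  assumes "0 < \<sigma>"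
  shows "prob_density lborel (\<lambda>x. gauss_density \<sigma> (x - m))"
proof (rule prob_densityI)
  interpret prob_space "PiM (Basis::'v set) (\<lambda>_. real_density lborel (normal_density 0 \<sigma>))"
    by (rule prob_space_PiM) (rule prob_space_normal_density[OF assms])
  have "prob_density lborel (gauss_density \<sigma> :: 'v \<Rightarrow> real)"
    by (auto simp: prob_density_def density_gauss_density_eq_distr_PiM[OF assms]
        intro!: prob_space_distr)
  then have "(\<integral>\<^sup>+x. ennreal (gauss_density \<sigma> (x::'v)) \<partial>lborel) = 1"
    by (rule prob_density_nn_integral)
  moreover have "(\<integral>\<^sup>+x. ennreal (gauss_density \<sigma> (x - m)) \<partial>lborel)
      = (\<integral>\<^sup>+x. ennreal (gauss_density \<sigma> x) \<partial>distr lborel borel ((+) (- m)))"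
    by (subst nn_integral_distr) simp_all
  ultimately show "(\<integral>\<^sup>+x. ennreal (gauss_density \<sigma> (x - m)) \<partial>lborel) = 1"
    by (simp only: lborel_distr_plus)
qed simp_all

lemma nn_integral_gauss_density: "0 < \<sigma> \<Longrightarrow> (\<integral>\<^sup>+x. ennreal (gauss_density \<sigma> (x - m)) \<partial>lborel) = 1"
  by (rule prob_density_nn_integral[OF prob_density_gauss_density])

lemma prob_space_gauss_law: "prob_space (gauss_law m)"
  unfolding gauss_law_def by (rule prob_space_prob_density[OF prob_density_gauss_density]) simp

lemma sets_gauss_law [simp, measurable_cong]: "sets (gauss_law m) = sets borel"
  by (simp add: gauss_law_def)

lemma space_gauss_law [simp]: "space (gauss_law m) = UNIV"
  by (simp add: gauss_law_def)

lemma char_gauss_law: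
  fixes t :: "'v::euclidean_space"
  shows "(\<integral>z. iexp (t \<bullet> z) \<partial>gauss_law 0) = complex_of_real (exp (- (norm t)\<^sup>2 / 2))"
proof -
  interpret N: prob_space std_normal_distribution using prob_space_normal_density[of 1 0] by simp
  interpret product_sigma_finite "\<lambda>_::'v. std_normal_distribution"
    by (simp add: product_sigma_finite_def N.sigma_finite_measure_axioms)
  have "(\<integral>z. iexp (t \<bullet> z) \<partial>gauss_law 0)
      = (\<integral>f. iexp (t \<bullet> (\<Sum>b\<in>Basis. f b *\<^sub>R b)) \<partial>PiM Basis (\<lambda>_. std_normal_distribution))"
    by (simp add: gauss_law_def density_gauss_density_eq_distr_PiM integral_distr)
  also have "\<dots> = (\<integral>f. (\<Prod>b\<in>Basis. iexp ((t \<bullet> b) * f b)) \<partial>PiM Basis (\<lambda>_. std_normal_distribution))"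
    by (simp add: inner_sum_right exp_sum[symmetric] sum_distrib_left mult_ac)
  also have "\<dots> = (\<Prod>b\<in>Basis. \<integral>x. iexp ((t \<bullet> b) * x) \<partial>std_normal_distribution)"
    by (rule product_integral_prod) (auto intro!: N.integrable_iexp)
  also have "\<dots> = (\<Prod>b\<in>Basis. complex_of_real (exp (- (t \<bullet> b)\<^sup>2 / 2)))"
    using char_std_normal_distribution by (simp add: char_def fun_eq_iff)
  also have "\<dots> = complex_of_real (exp (\<Sum>b\<in>Basis. - (t \<bullet> b)\<^sup>2 / 2))"
    by (simp add: exp_sum)
  also have "(\<Sum>b\<in>Basis. - (t \<bullet> b)\<^sup>2 / 2) = - (norm t)\<^sup>2 / 2"
    unfolding power2_norm_eq_inner euclidean_inner[of t t]
    by (simp add: power2_eq_square sum_negf sum_divide_distrib)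
  finally show ?thesis .
qed

lemma gauss_density_fourier:
  fixes x :: "'v::euclidean_space"
  shows "complex_of_real (gauss_density e x)
    = of_real (gauss_density e (0::'v)) * (\<integral>t. iexp (t \<bullet> (x /\<^sub>R e)) \<partial>gauss_law 0)"
  using char_gauss_law[of "x /\<^sub>R e"]
  by (simp add: gauss_density_def inner_commute power_mult_distrib field_simps)

lemma integral_gauss_density_gauss_law:
  fixes x :: "'v::euclidean_space"
  assumes "a\<^sup>2 + e\<^sup>2 = 1" "0 < e"
  shows "(\<integral>z. gauss_density e (x - a *\<^sub>R z) \<partial>gauss_law 0) = gauss_density 1 x"
proof -
  have "(\<integral>z. gauss_density e (x - a *\<^sub>R z) \<partial>gauss_law 0)
      = (\<integral>z. gauss_density 1 z * gauss_density e (x - a *\<^sub>R z) \<partial>lborel)"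
    unfolding gauss_law_def by (subst integral_real_density) auto
  also have "\<dots> = gauss_density 1 x * (\<integral>z. gauss_density e (z - a *\<^sub>R x) \<partial>lborel)"
    unfolding gauss_density_mult_swap[OF assms, of _ x] by (rule integral_mult_right_zero)
  also have "\<dots> = gauss_density 1 x"
    using integral_prob_density[OF prob_density_gauss_density[OF assms(2), of "a *\<^sub>R x"]] by simp
  finally show ?thesis .
qed

subsection \<open>Conditioning on a Gaussian perturbation of a statistic\<close>

lemma distr_fst_density_pair:
  assumes sigma_finite_N: "sigma_finite_measure N" and [measurable]: "f \<in> borel_measurable (M \<Otimes>\<^sub>M N)"
  shows "distr (density (M \<Otimes>\<^sub>M N) f) M fst = density M (\<lambda>x. \<integral>\<^sup>+y. f (x, y) \<partial>N)"
proof (rule measure_eqI)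
  interpret N: sigma_finite_measure N by (rule sigma_finite_N)
  fix A assume "A \<in> sets (distr (density (M \<Otimes>\<^sub>M N) f) M fst)"
  then have [measurable]: "A \<in> sets M" by simp
  have "emeasure (distr (density (M \<Otimes>\<^sub>M N) f) M fst) A
      = (\<integral>\<^sup>+z. indicator A (fst z) \<partial>density (M \<Otimes>\<^sub>M N) f)"
    by (subst nn_integral_indicator[symmetric], simp, subst nn_integral_distr) simp_all
  also have "\<dots> = (\<integral>\<^sup>+x. \<integral>\<^sup>+y. f (x, y) * indicator A x \<partial>N \<partial>M)"
    by (simp add: nn_integral_density N.nn_integral_fst[symmetric])
  also have "\<dots> = emeasure (density M (\<lambda>x. \<integral>\<^sup>+y. f (x, y) \<partial>N)) A"
    by (auto simp: emeasure_density intro!: nn_integral_cong nn_integral_multc)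
  finally show "emeasure (distr (density (M \<Otimes>\<^sub>M N) f) M fst) A
      = emeasure (density M (\<lambda>x. \<integral>\<^sup>+y. f (x, y) \<partial>N)) A" .
qed simp

lemma bind_density:
  assumes sigma_finite_M: "sigma_finite_measure M" and N_measure: "sigma_finite_measure N" "space N \<noteq> {}"
    and [measurable]: "case_prod f \<in> borel_measurable (M \<Otimes>\<^sub>M N)"
    and kernel: "(\<lambda>y. density M (\<lambda>x. f x y)) \<in> N \<rightarrow>\<^sub>M subprob_algebra M"
  shows "N \<bind> (\<lambda>y. density M (\<lambda>x. f x y)) = density M (\<lambda>x. \<integral>\<^sup>+y. f x y \<partial>N)"
proof (rule measure_eqI)
  interpret pair_sigma_finite M N using sigma_finite_M N_measure(1) by (simp add: pair_sigma_finite_def)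
  show sets_bind_eq: "sets (N \<bind> (\<lambda>y. density M (\<lambda>x. f x y))) = sets (density M (\<lambda>x. \<integral>\<^sup>+y. f x y \<partial>N))"
    using sets_bind[of N _ M] N_measure(2) by simp
  fix A assume "A \<in> sets (N \<bind> (\<lambda>y. density M (\<lambda>x. f x y)))"
  then have [measurable]: "A \<in> sets M" unfolding sets_bind_eq by simp
  have "emeasure (N \<bind> (\<lambda>y. density M (\<lambda>x. f x y))) A = (\<integral>\<^sup>+y. emeasure (density M (\<lambda>x. f x y)) A \<partial>N)"
    by (rule emeasure_bind[OF N_measure(2) kernel]) simp
  also have "\<dots> = (\<integral>\<^sup>+y. \<integral>\<^sup>+x. f x y * indicator A x \<partial>M \<partial>N)"
    by (intro nn_integral_cong emeasure_density) measurable
  also have "\<dots> = (\<integral>\<^sup>+x. \<integral>\<^sup>+y. f x y * indicator A x \<partial>N \<partial>M)"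
    by (rule Fubini') measurable
  also have "\<dots> = emeasure (density M (\<lambda>x. \<integral>\<^sup>+y. f x y \<partial>N)) A"
    by (auto simp: emeasure_density intro!: nn_integral_cong nn_integral_multc)
  finally show "emeasure (N \<bind> (\<lambda>y. density M (\<lambda>x. f x y))) A
      = emeasure (density M (\<lambda>x. \<integral>\<^sup>+y. f x y \<partial>N)) A" .
qed

text \<open>The density of \<^term>\<open>a *\<^sub>R Y + e *\<^sub>R Z\<close> with \<^term>\<open>Z\<close> standard Gaussian and independent of \<^term>\<open>Y\<close>, and
  the conditional law on \<^term>\<open>M\<close> given that this sum equals \<^term>\<open>y\<close>.\<close>

definition smoothed_density :: "real \<Rightarrow> real \<Rightarrow> 'a measure \<Rightarrow> ('a \<Rightarrow> 'v::euclidean_space) \<Rightarrow> 'v \<Rightarrow> real" where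
  "smoothed_density a e M Y y = (\<integral>\<omega>. gauss_density e (y - a *\<^sub>R Y \<omega>) \<partial>M)"

definition lift_kernel :: "real \<Rightarrow> real \<Rightarrow> 'a measure \<Rightarrow> ('a \<Rightarrow> 'v::euclidean_space) \<Rightarrow> 'v \<Rightarrow> 'a measure" where
  "lift_kernel a e M Y y = real_density M
      (\<lambda>\<omega>. gauss_density e (y - a *\<^sub>R Y \<omega>) / smoothed_density a e M Y y)"

lemma smoothed_density_fourier:
  fixes Y :: "'a \<Rightarrow> 'v::euclidean_space"
  assumes prob_space_M: "prob_space M" and [measurable]: "Y \<in> borel_measurable M"
  shows "complex_of_real (smoothed_density a e M Y y) = of_real (gauss_density e (0::'v)) *
    (\<integral>t. iexp (t \<bullet> (y /\<^sub>R e)) * (\<integral>\<omega>. iexp ((- (a / e) *\<^sub>R t) \<bullet> Y \<omega>) \<partial>M) \<partial>gauss_law 0)"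
proof -
  interpret M: prob_space M by (rule prob_space_M)
  interpret G: prob_space "gauss_law (0::'v)" by (rule prob_space_gauss_law)
  interpret pair_prob_space M "gauss_law (0::'v)" ..
  let ?F = "\<lambda>\<omega> t. iexp (t \<bullet> ((y - a *\<^sub>R Y \<omega>) /\<^sub>R e))"
  have integrable_F: "integrable (M \<Otimes>\<^sub>M gauss_law 0) (\<lambda>(\<omega>, t). ?F \<omega> t)"
    by (rule P.integrable_const_bound[where B=1]) (auto simp: split_beta)
  have "complex_of_real (smoothed_density a e M Y y)
      = (\<integral>\<omega>. complex_of_real (gauss_density e (y - a *\<^sub>R Y \<omega>)) \<partial>M)"
    by (simp add: smoothed_density_def)
  also have "\<dots> = of_real (gauss_density e (0::'v)) * (\<integral>\<omega>. (\<integral>t. ?F \<omega> t \<partial>gauss_law 0) \<partial>M)"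
    by (subst gauss_density_fourier) simp
  also have "(\<integral>\<omega>. (\<integral>t. ?F \<omega> t \<partial>gauss_law 0) \<partial>M) = (\<integral>t. (\<integral>\<omega>. ?F \<omega> t \<partial>M) \<partial>gauss_law 0)"
    by (rule Fubini_integral[OF integrable_F, symmetric])
  also have "\<dots> = (\<integral>t. (\<integral>\<omega>. iexp (t \<bullet> (y /\<^sub>R e)) * iexp ((- (a / e) *\<^sub>R t) \<bullet> Y \<omega>) \<partial>M) \<partial>gauss_law 0)"
    by (intro Bochner_Integration.integral_cong refl)
       (simp add: exp_add[symmetric] inner_diff_right algebra_simps divide_inverse)
  finally show ?thesis by simp
qed

lemma smoothed_density_tendsto:
  fixes Y :: "nat \<Rightarrow> 'a \<Rightarrow> 'v::euclidean_space"
  assumes prob_spaces: "\<And>n. prob_space (M n)"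
    and Y_measurable[measurable]: "\<And>n. Y n \<in> borel_measurable (M n)"
    and char_tendsto: "\<And>t. (\<lambda>n. \<integral>\<omega>. iexp (t \<bullet> Y n \<omega>) \<partial>M n) \<longlonglongrightarrow> complex_of_real (exp (- (norm t)\<^sup>2 / 2))"
    and weights: "a\<^sup>2 + e\<^sup>2 = 1" "0 < e" and y_tendsto: "y \<longlonglongrightarrow> y0"
  shows "(\<lambda>n. smoothed_density a e (M n) (Y n) (y n)) \<longlonglongrightarrow> gauss_density 1 y0"
proof -
  interpret G: prob_space "gauss_law (0::'v)" by (rule prob_space_gauss_law)
  let ?\<phi> = "\<lambda>n t. (\<integral>\<omega>. iexp ((- (a / e) *\<^sub>R t) \<bullet> Y n \<omega>) \<partial>M n)"
  let ?H = "\<lambda>n t. iexp (t \<bullet> (y n /\<^sub>R e)) * ?\<phi> n t"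
  let ?L = "\<lambda>t. iexp (t \<bullet> (y0 /\<^sub>R e)) * (\<integral>z. iexp ((- (a / e) *\<^sub>R t) \<bullet> z) \<partial>gauss_law 0)"
  have "(\<lambda>n. \<integral>t. ?H n t \<partial>gauss_law 0) \<longlonglongrightarrow> (\<integral>t. ?L t \<partial>gauss_law 0)"
  proof (rule integral_dominated_convergence[where w="\<lambda>_. 1"])
    show "AE t in gauss_law 0. (\<lambda>n. ?H n t) \<longlonglongrightarrow> ?L t"
      unfolding char_gauss_law by (intro AE_I2 tendsto_intros y_tendsto char_tendsto)
    fix n
    interpret M: prob_space "M n" by (rule prob_spaces)
    have "norm (?\<phi> n t) \<le> 1" for t
      using integral_norm_bound[of "M n" "\<lambda>\<omega>. iexp ((- (a / e) *\<^sub>R t) \<bullet> Y n \<omega>)"]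
      by (simp add: M.prob_space)
    then show "AE t in gauss_law 0. norm (?H n t) \<le> 1" by (simp add: norm_mult)
    show "?H n \<in> borel_measurable (gauss_law 0)" by measurable
  qed (unfold char_gauss_law, simp_all)
  then have "(\<lambda>n. complex_of_real (smoothed_density a e (M n) (Y n) (y n)))
     \<longlonglongrightarrow> complex_of_real (smoothed_density a e (gauss_law 0) (\<lambda>z. z) y0)"
    unfolding smoothed_density_fourier[OF prob_spaces Y_measurable]
    by (subst smoothed_density_fourier[OF prob_space_gauss_law]) (auto intro!: tendsto_intros)
  then show ?thesis
    unfolding smoothed_density_def integral_gauss_density_gauss_law[OF weights] tendsto_of_real_iff .
qed

locale smoothed_statistic = prob_space M for M :: "'a measure" +
  fixes Y :: "'a \<Rightarrow> 'v::euclidean_space" and a e :: real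
  assumes Y_measurable [measurable]: "Y \<in> borel_measurable M"
    and a_pos: "0 < a" and e_pos: "0 < e" and sum_squares: "a\<^sup>2 + e\<^sup>2 = 1"
begin

abbreviation smoothed :: "'v \<Rightarrow> real" where
  "smoothed \<equiv> smoothed_density a e M Y"

lemma integrable_gauss_density: "integrable M (\<lambda>\<omega>. gauss_density e (y - a *\<^sub>R Y \<omega>))"
  by (rule integrable_const_bound[where B="gauss_density e (0::'v)"]) (auto simp: gauss_density_le_zero)

lemma smoothed_density_pos: "0 < smoothed y"
proof -
  have "0 \<le> smoothed y"
    unfolding smoothed_density_def by (rule Bochner_Integration.integral_nonneg) simp
  moreover have "smoothed y \<noteq> 0"
  proof
    assume "smoothed y = 0"
    then have "AE \<omega> in M. gauss_density e (y - a *\<^sub>R Y \<omega>) = 0"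
      unfolding smoothed_density_def
      by (subst (asm) integral_nonneg_eq_0_iff_AE[OF integrable_gauss_density]) auto
    then have "AE \<omega> in M. False"
      by eventually_elim (use gauss_density_pos[OF e_pos] in \<open>metis less_irrefl\<close>)
    then show False by (simp add: AE_False)
  qed
  ultimately show ?thesis by simp
qed

lemma smoothed_density_nonneg [simp]: "0 \<le> smoothed y"
  by (rule less_imp_le[OF smoothed_density_pos])

lemma smoothed_density_measurable [measurable]: "smoothed \<in> borel_measurable borel"
  unfolding smoothed_density_def by measurable

lemma nn_integral_smoothed_density:
  "(\<integral>\<^sup>+\<omega>. ennreal (gauss_density e (y - a *\<^sub>R Y \<omega>)) \<partial>M) = ennreal (smoothed y)"
  unfolding smoothed_density_def by (rule nn_integral_eq_integral[OF integrable_gauss_density]) simp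

lemma prob_space_lift_kernel: "prob_space (lift_kernel a e M Y y)"
  unfolding lift_kernel_def
proof (rule prob_space_prob_density[OF prob_densityI])
  have "(\<integral>\<^sup>+\<omega>. ennreal (gauss_density e (y - a *\<^sub>R Y \<omega>) / smoothed y) \<partial>M)
      = (\<integral>\<^sup>+\<omega>. ennreal (gauss_density e (y - a *\<^sub>R Y \<omega>)) / ennreal (smoothed y) \<partial>M)"
    by (simp add: divide_ennreal smoothed_density_pos)
  also have "\<dots> = 1"
    using smoothed_density_pos[of y]
    by (simp add: nn_integral_divide nn_integral_smoothed_density ennreal_divide_self)
  finally show "(\<integral>\<^sup>+\<omega>. ennreal (gauss_density e (y - a *\<^sub>R Y \<omega>) / smoothed y) \<partial>M) = 1" .
qed simp_all

lemma lift_kernel_measurable: "lift_kernel a e M Y \<in> borel \<rightarrow>\<^sub>M prob_algebra M"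
proof (rule measurable_prob_algebraI[OF prob_space_lift_kernel measurable_subprob_algebra])
  fix A assume [measurable]: "A \<in> sets M"
  show "(\<lambda>y. emeasure (lift_kernel a e M Y y) A) \<in> borel_measurable borel"
    unfolding lift_kernel_def by (subst emeasure_density) measurable
qed (simp_all add: prob_space_imp_subprob_space prob_space_lift_kernel, simp add: lift_kernel_def)

end

text \<open>On the joint space of sample and smoothed statistic, \<^term>\<open>tilted_joint\<close> is the law under the
  exponentially tilted measure and \<^term>\<open>kernel_joint\<close> the law generated by the kernel from a shifted Gaussian.\<close>

context smoothed_statistic
begin

definition tilted_joint :: "'v \<Rightarrow> real \<Rightarrow> 'a \<times> 'v \<Rightarrow> real" where
  "tilted_joint h \<kappa> = (\<lambda>(\<omega>, y). gauss_density e (y - a *\<^sub>R Y \<omega>) * exp (h \<bullet> Y \<omega> - \<kappa>))"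

definition kernel_joint :: "'v \<Rightarrow> 'a \<times> 'v \<Rightarrow> real" where
  "kernel_joint h = (\<lambda>(\<omega>, y). gauss_density e (y - a *\<^sub>R Y \<omega>) * (gauss_density 1 (y - h) / smoothed y))"

definition affinity_weight :: "'v \<Rightarrow> real \<Rightarrow> 'v \<Rightarrow> real" where
  "affinity_weight h \<kappa> y = exp (- \<kappa> / 2) * sqrt (gauss_density 1 (y - h) / smoothed y)
    * exp (h \<bullet> y / (2 * a) + e\<^sup>2 * (norm h)\<^sup>2 / (8 * a\<^sup>2))"

definition affinity_density :: "'v \<Rightarrow> real \<Rightarrow> 'v \<Rightarrow> real" where
  "affinity_density h \<kappa> y = affinity_weight h \<kappa> y * smoothed (y + (e\<^sup>2 / (2 * a)) *\<^sub>R h)"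

lemma joint_measurable [measurable]:
  "tilted_joint h \<kappa> \<in> borel_measurable (M \<Otimes>\<^sub>M lborel)" "kernel_joint h \<in> borel_measurable (M \<Otimes>\<^sub>M lborel)"
  unfolding tilted_joint_def kernel_joint_def by measurable

lemma affinity_density_measurable [measurable]: "affinity_density h \<kappa> \<in> borel_measurable borel"
  unfolding affinity_density_def affinity_weight_def by measurable

lemma joint_nonneg: "0 \<le> tilted_joint h \<kappa> z" "0 \<le> kernel_joint h z"
  by (auto simp: tilted_joint_def kernel_joint_def split_beta)

lemma distr_fst_tilted_joint:
  "distr (real_density (M \<Otimes>\<^sub>M lborel) (tilted_joint h \<kappa>)) M fst
    = real_density M (\<lambda>\<omega>. exp (h \<bullet> Y \<omega> - \<kappa>))"
proof -
  have "(\<integral>\<^sup>+y. ennreal (tilted_joint h \<kappa> (\<omega>, y)) \<partial>lborel) = ennreal (exp (h \<bullet> Y \<omega> - \<kappa>))" for \<omega>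
    by (simp add: tilted_joint_def ennreal_mult nn_integral_multc nn_integral_gauss_density e_pos)
  then show ?thesis
    by (subst distr_fst_density_pair) (simp_all add: sigma_finite_lborel)
qed

lemma distr_fst_kernel_joint:
  "distr (real_density (M \<Otimes>\<^sub>M lborel) (kernel_joint h)) M fst = gauss_law h \<bind> lift_kernel a e M Y"
proof -
  interpret G: prob_space "gauss_law h" by (rule prob_space_gauss_law)
  have joint: "ennreal (kernel_joint h (\<omega>, y))
      = ennreal (gauss_density 1 (y - h)) * ennreal (gauss_density e (y - a *\<^sub>R Y \<omega>) / smoothed y)"
    for \<omega> y
    by (simp add: kernel_joint_def ennreal_mult[symmetric] mult.commute)
  have "gauss_law h \<bind> lift_kernel a e M Y
      = density M (\<lambda>\<omega>. \<integral>\<^sup>+y. ennreal (gauss_density e (y - a *\<^sub>R Y \<omega>) / smoothed y) \<partial>gauss_law h)"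
    unfolding lift_kernel_def
    by (rule bind_density[OF sigma_finite_measure_axioms G.sigma_finite_measure_axioms])
       (use measurable_prob_algebraD[OF lift_kernel_measurable] in
         \<open>simp_all add: lift_kernel_def[abs_def]\<close>)
  also have "\<dots> = density M (\<lambda>\<omega>. \<integral>\<^sup>+y. ennreal (kernel_joint h (\<omega>, y)) \<partial>lborel)"
    unfolding joint gauss_law_def
    by (intro density_cong AE_I2) (simp_all add: nn_integral_density)
  also have "\<dots> = distr (real_density (M \<Otimes>\<^sub>M lborel) (kernel_joint h)) M fst"
    by (rule distr_fst_density_pair[symmetric]) (simp_all add: sigma_finite_lborel)
  finally show ?thesis ..
qed

lemma prob_density_tilted_joint:
  assumes "prob_density M (\<lambda>\<omega>. exp (h \<bullet> Y \<omega> - \<kappa>))"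
  shows "prob_density (M \<Otimes>\<^sub>M lborel) (tilted_joint h \<kappa>)"
  unfolding prob_density_def
proof (intro conjI ballI)
  show "prob_space (real_density (M \<Otimes>\<^sub>M lborel) (tilted_joint h \<kappa>))"
    by (rule prob_space_distrD[where f=fst and N=M])
       (simp_all add: distr_fst_tilted_joint prob_space_prob_density[OF assms])
qed (simp_all add: joint_nonneg)

lemma prob_density_kernel_joint: "prob_density (M \<Otimes>\<^sub>M lborel) (kernel_joint h)"
  unfolding prob_density_def
proof (intro conjI ballI)
  have "lift_kernel a e M Y \<in> gauss_law h \<rightarrow>\<^sub>M subprob_algebra M"
    using measurable_prob_algebraD[OF lift_kernel_measurable] by simp
  then have "prob_space (gauss_law h \<bind> lift_kernel a e M Y)"
    by (intro prob_space.prob_space_bind[OF prob_space_gauss_law]) (auto simp: prob_space_lift_kernel)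
  then show "prob_space (real_density (M \<Otimes>\<^sub>M lborel) (kernel_joint h))"
    by (intro prob_space_distrD[where f=fst and N=M]) (simp_all add: distr_fst_kernel_joint)
qed (simp_all add: joint_nonneg)

lemma gauss_density_tilt:
  "gauss_density e (y - a *\<^sub>R w) * exp (h \<bullet> w / 2)
    = exp (h \<bullet> y / (2 * a) + e\<^sup>2 * (norm h)\<^sup>2 / (8 * a\<^sup>2))
      * gauss_density e (y + (e\<^sup>2 / (2 * a)) *\<^sub>R h - a *\<^sub>R w)"
proof -
  define v where "v = (- (e\<^sup>2 / (2 * a))) *\<^sub>R h"
  have "y + (e\<^sup>2 / (2 * a)) *\<^sub>R h - a *\<^sub>R w = (y - a *\<^sub>R w) - v" by (simp add: v_def)
  moreover have "((y - a *\<^sub>R w) \<bullet> v - (norm v)\<^sup>2 / 2) / e\<^sup>2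
      = h \<bullet> w / 2 - (h \<bullet> y / (2 * a) + e\<^sup>2 * (norm h)\<^sup>2 / (8 * a\<^sup>2))"
    using a_pos e_pos
    by (simp add: v_def power_mult_distrib inner_diff inner_commute field_simps power2_eq_square)
  ultimately show ?thesis
    by (simp only: gauss_density_diff[OF e_pos]) (simp add: exp_diff)
qed

lemma sqrt_joint:
  "sqrt (tilted_joint h \<kappa> (\<omega>, y)) * sqrt (kernel_joint h (\<omega>, y))
    = affinity_weight h \<kappa> y * gauss_density e (y + (e\<^sup>2 / (2 * a)) *\<^sub>R h - a *\<^sub>R Y \<omega>)"
proof -
  let ?\<psi> = "gauss_density e (y - a *\<^sub>R Y \<omega>)"
  have "exp (h \<bullet> Y \<omega> - \<kappa>) = (exp (h \<bullet> Y \<omega> / 2) * exp (- \<kappa> / 2))\<^sup>2"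
    by (simp add: power_mult_distrib exp_double[symmetric] exp_add[symmetric])
  then have "sqrt (exp (h \<bullet> Y \<omega> - \<kappa>)) = exp (h \<bullet> Y \<omega> / 2) * exp (- \<kappa> / 2)" by simp
  then have "sqrt (tilted_joint h \<kappa> (\<omega>, y)) * sqrt (kernel_joint h (\<omega>, y))
      = (sqrt ?\<psi> * sqrt ?\<psi>) * (exp (h \<bullet> Y \<omega> / 2) * exp (- \<kappa> / 2))
        * sqrt (gauss_density 1 (y - h) / smoothed y)"
    by (simp only: tilted_joint_def kernel_joint_def prod.case real_sqrt_mult mult_ac)
  also have "sqrt ?\<psi> * sqrt ?\<psi> = ?\<psi>" by simp
  also have "?\<psi> * (exp (h \<bullet> Y \<omega> / 2) * exp (- \<kappa> / 2)) = (?\<psi> * exp (h \<bullet> Y \<omega> / 2)) * exp (- \<kappa> / 2)"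
    by (simp only: mult_ac)
  finally show ?thesis unfolding gauss_density_tilt affinity_weight_def by (simp only: mult_ac)
qed

lemma hellinger_affinity_joint:
  assumes "prob_density M (\<lambda>\<omega>. exp (h \<bullet> Y \<omega> - \<kappa>))"
  shows "ennreal (hellinger_affinity (M \<Otimes>\<^sub>M lborel) (tilted_joint h \<kappa>) (kernel_joint h))
    = (\<integral>\<^sup>+y. ennreal (affinity_density h \<kappa> y) \<partial>lborel)"
proof -
  interpret pair_sigma_finite M lborel ..
  let ?f = "\<lambda>z. sqrt (tilted_joint h \<kappa> z) * sqrt (kernel_joint h z)"
  have "ennreal (hellinger_affinity (M \<Otimes>\<^sub>M lborel) (tilted_joint h \<kappa>) (kernel_joint h))
      = (\<integral>\<^sup>+z. ennreal (?f z) \<partial>(M \<Otimes>\<^sub>M lborel))"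
    unfolding hellinger_affinity_def
    by (rule nn_integral_eq_integral[symmetric, OF integrable_hellinger_affinity])
       (simp_all add: prob_density_tilted_joint prob_density_kernel_joint assms joint_nonneg)
  also have "\<dots> = (\<integral>\<^sup>+y. \<integral>\<^sup>+\<omega>. ennreal (?f (\<omega>, y)) \<partial>M \<partial>lborel)"
    by (rule nn_integral_snd[symmetric]) measurable
  also have "\<dots> = (\<integral>\<^sup>+y. ennreal (affinity_density h \<kappa> y) \<partial>lborel)"
    unfolding sqrt_joint affinity_density_def
    by (simp add: ennreal_mult nn_integral_cmult nn_integral_smoothed_density affinity_weight_def)
  finally show ?thesis .
qed

lemma tv_dist_lift_kernel_le:
  assumes "prob_density M (\<lambda>\<omega>. exp (h \<bullet> Y \<omega> - \<kappa>))"
  shows "tv_dist (real_density M (\<lambda>\<omega>. exp (h \<bullet> Y \<omega> - \<kappa>))) (gauss_law h \<bind> lift_kernel a e M Y)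
    \<le> ennreal (2 * sqrt (2 - 2 * hellinger_affinity (M \<Otimes>\<^sub>M lborel) (tilted_joint h \<kappa>) (kernel_joint h)))"
proof -
  note densities = prob_density_tilted_joint[OF assms] prob_density_kernel_joint
  have "tv_dist (real_density M (\<lambda>\<omega>. exp (h \<bullet> Y \<omega> - \<kappa>))) (gauss_law h \<bind> lift_kernel a e M Y)
      \<le> tv_dist (real_density (M \<Otimes>\<^sub>M lborel) (tilted_joint h \<kappa>))
          (real_density (M \<Otimes>\<^sub>M lborel) (kernel_joint h))"
    unfolding distr_fst_tilted_joint[symmetric] distr_fst_kernel_joint[symmetric]
    by (rule tv_dist_distr_le) simp_all
  then show ?thesis
    using tv_dist_density_le_hellinger[OF densities] unfolding hellinger_sqdist_eq_affinity[OF densities]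
    by (rule order_trans)
qed

end

lemma gauss_affinity_limit:
  fixes h y :: "'v::euclidean_space"
  assumes a_pos: "0 < a" and weights: "a\<^sup>2 + e\<^sup>2 = 1"
  shows "exp (- ((norm h)\<^sup>2 / 2) / 2) * sqrt (gauss_density 1 (y - h) / gauss_density 1 y)
      * exp (h \<bullet> y / (2 * a) + e\<^sup>2 * (norm h)\<^sup>2 / (8 * a\<^sup>2))
      * gauss_density 1 (y + (e\<^sup>2 / (2 * a)) *\<^sub>R h)
    = exp (- (1 - a) * (norm h)\<^sup>2 / 4) * gauss_density 1 (y - ((1 + a) / 2) *\<^sub>R h)"
proof -
  define q r where "q = h \<bullet> y" and "r = (norm h)\<^sup>2"
  have e_square: "e\<^sup>2 = 1 - a\<^sup>2" using weights by simp
  have shift: "gauss_density 1 (y - t *\<^sub>R h) = gauss_density 1 y * exp (t * q - t\<^sup>2 * r / 2)" for t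
    by (simp add: gauss_density_diff q_def r_def power_mult_distrib inner_commute)
  have "gauss_density 1 (y - h) / gauss_density 1 y = (exp ((q - r / 2) / 2))\<^sup>2"
    using shift[of 1] gauss_density_pos[of 1 y] by (simp add: exp_double[symmetric])
  then have ratio: "sqrt (gauss_density 1 (y - h) / gauss_density 1 y) = exp ((q - r / 2) / 2)" by simp
  have plus: "gauss_density 1 (y + (e\<^sup>2 / (2 * a)) *\<^sub>R h)
      = gauss_density 1 y * exp (- (e\<^sup>2 / (2 * a)) * q - (e\<^sup>2 / (2 * a))\<^sup>2 * r / 2)"
    using shift[of "- (e\<^sup>2 / (2 * a))"] by simp
  have exponents: "- (r / 2) / 2 + (q - r / 2) / 2 + (q / (2 * a) + e\<^sup>2 * r / (8 * a\<^sup>2))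
      + (- (e\<^sup>2 / (2 * a)) * q - (e\<^sup>2 / (2 * a))\<^sup>2 * r / 2)
    = - (1 - a) * r / 4 + ((1 + a) / 2 * q - ((1 + a) / 2)\<^sup>2 * r / 2)"
    unfolding e_square using a_pos by (simp add: field_simps power2_eq_square)
  show ?thesis
    unfolding ratio plus shift q_def[symmetric] r_def[symmetric]
    using arg_cong[OF exponents, of "\<lambda>t. gauss_density 1 y * exp t"] by (simp only: exp_add mult_ac)
qed

context
  fixes M :: "nat \<Rightarrow> 'a measure" and Y :: "nat \<Rightarrow> 'a \<Rightarrow> 'v::euclidean_space" and a e :: real
    and h :: "nat \<Rightarrow> 'v" and h0 :: 'v and \<kappa> :: "nat \<Rightarrow> real"
  assumes smoothed_statistic: "\<And>n. smoothed_statistic (M n) (Y n) a e"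
    and char_tendsto: "\<And>t. (\<lambda>n. \<integral>\<omega>. iexp (t \<bullet> Y n \<omega>) \<partial>M n) \<longlonglongrightarrow> complex_of_real (exp (- (norm t)\<^sup>2 / 2))"
    and h_tendsto: "h \<longlonglongrightarrow> h0" and \<kappa>_tendsto: "\<kappa> \<longlonglongrightarrow> (norm h0)\<^sup>2 / 2"
    and prob_density_tilt: "\<And>n. prob_density (M n) (\<lambda>\<omega>. exp (h n \<bullet> Y n \<omega> - \<kappa> n))"
begin

interpretation smoothed_statistic "M n" "Y n" a e for n by (rule smoothed_statistic)

lemma liminf_lift_kernel_affinity:
  "ennreal (exp (- (1 - a) * (norm h0)\<^sup>2 / 4)) \<le> liminf (\<lambda>n. ennreal
    (hellinger_affinity (M n \<Otimes>\<^sub>M lborel) (tilted_joint n (h n) (\<kappa> n)) (kernel_joint n (h n))))"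
proof -
  let ?L = "\<lambda>y. exp (- (1 - a) * (norm h0)\<^sup>2 / 4) * gauss_density 1 (y - ((1 + a) / 2) *\<^sub>R h0)"
  note [tendsto_intros] = smoothed_density_tendsto[OF prob_space_axioms Y_measurable char_tendsto
      sum_squares e_pos]
  have gauss_tendsto: "(\<lambda>n. gauss_density 1 (y - h n)) \<longlonglongrightarrow> gauss_density 1 (y - h0)" for y
    unfolding gauss_density_def by (intro tendsto_intros h_tendsto) auto
  have "(\<lambda>n. affinity_density n (h n) (\<kappa> n) y) \<longlonglongrightarrow> ?L y" for y
    unfolding affinity_density_def affinity_weight_def
        gauss_affinity_limit[OF a_pos sum_squares, symmetric]
    by (intro tendsto_intros h_tendsto \<kappa>_tendsto gauss_tendsto)
       (use a_pos gauss_density_pos[of 1 y] in auto)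
  then have liminf: "liminf (\<lambda>n. ennreal (affinity_density n (h n) (\<kappa> n) y)) = ennreal (?L y)" for y
    by (intro lim_imp_Liminf tendsto_ennrealI) auto
  have "ennreal (exp (- (1 - a) * (norm h0)\<^sup>2 / 4)) = (\<integral>\<^sup>+y. ennreal (?L y) \<partial>lborel)"
    by (simp add: ennreal_mult nn_integral_cmult nn_integral_gauss_density)
  also have "\<dots> \<le> liminf (\<lambda>n. \<integral>\<^sup>+y. ennreal (affinity_density n (h n) (\<kappa> n) y) \<partial>lborel)"
    unfolding liminf[symmetric] by (rule nn_integral_liminf) measurable
  finally show ?thesis by (simp only: hellinger_affinity_joint[OF prob_density_tilt])
qed

lemma eventually_tv_dist_lift_kernel_less:
  assumes margin: "norm h0 * sqrt (2 * (1 - a)) < c"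
  shows "\<forall>\<^sub>F n in sequentially. tv_dist (real_density (M n) (\<lambda>\<omega>. exp (h n \<bullet> Y n \<omega> - \<kappa> n)))
    (gauss_law (h n) \<bind> lift_kernel a e (M n) (Y n)) < ennreal c"
proof -
  let ?\<rho> = "\<lambda>n. hellinger_affinity (M n \<Otimes>\<^sub>M lborel) (tilted_joint n (h n) (\<kappa> n)) (kernel_joint n (h n))"
  have "a\<^sup>2 < 1" using sum_squares e_pos by (smt (verit) zero_less_power)
  then have a_less_1: "a < 1" using power_less_imp_less_base[of a 2 1] by simp
  have c_pos: "0 < c" using margin by (rule le_less_trans[rotated]) (use a_less_1 in simp)
  have "(norm h0 * sqrt (2 * (1 - a)))\<^sup>2 < c\<^sup>2"
    using margin a_less_1 by (intro power_strict_mono) auto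
  then have "(norm h0)\<^sup>2 * (2 * (1 - a)) < c\<^sup>2" using a_less_1 by (simp add: power_mult_distrib)
  then have "1 - c\<^sup>2 / 8 < 1 + (- (1 - a) * (norm h0)\<^sup>2 / 4)" by (simp add: field_simps)
  also have "\<dots> \<le> exp (- (1 - a) * (norm h0)\<^sup>2 / 4)" by (rule exp_ge_add_one_self)
  finally have "ennreal (1 - c\<^sup>2 / 8) < ennreal (exp (- (1 - a) * (norm h0)\<^sup>2 / 4))"
    by (rule ennreal_lessI[rotated]) simp
  also note liminf_lift_kernel_affinity
  finally have "\<forall>\<^sub>F n in sequentially. ennreal (1 - c\<^sup>2 / 8) < ennreal (?\<rho> n)"
    by (rule less_LiminfD)
  then show ?thesis
  proof eventually_elim
    case (elim n)
    then have "1 - c\<^sup>2 / 8 < ?\<rho> n" by (meson ennreal_leI not_less)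
    then have "sqrt (2 - 2 * ?\<rho> n) < sqrt ((c / 2)\<^sup>2)" by (simp add: power_divide)
    then have "2 * sqrt (2 - 2 * ?\<rho> n) < c" using c_pos by simp
    with tv_dist_lift_kernel_le[OF prob_density_tilt] show ?case
      using c_pos by (auto intro: le_less_trans ennreal_lessI)
  qed
qed

end

subsection \<open>Local parameters\<close>

definition local_shift :: "nat \<Rightarrow> 'v::real_normed_vector \<Rightarrow> 'v" where
  "local_shift n h = (1 / sqrt (real n)) *\<^sub>R h"

lemma inner_local_shift: "local_shift n h \<bullet> x = h \<bullet> local_shift n x"
  by (simp add: local_shift_def)

lemma norm_local_shift_power2: "0 < n \<Longrightarrow> real n * (norm (local_shift n h))\<^sup>2 = (norm h)\<^sup>2"
  by (simp add: local_shift_def power_mult_distrib power_divide)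

lemma tendsto_local_shift_zero:
  fixes h :: "nat \<Rightarrow> 'v::real_normed_vector"
  assumes "h \<longlonglongrightarrow> h0"
  shows "(\<lambda>n. local_shift n (h n)) \<longlonglongrightarrow> 0"
proof -
  have "(\<lambda>n. local_shift n (h n)) \<longlonglongrightarrow> 0 *\<^sub>R h0"
    unfolding local_shift_def
    by (intro tendsto_scaleR assms tendsto_divide_0[OF tendsto_const]
        filterlim_at_top_imp_at_infinity filterlim_compose[OF sqrt_at_top] filterlim_real_sequentially)
  then show ?thesis by simp
qed

lemma smallo_norm_power2_imp_local_shift_tendsto:
  fixes F :: "'v::real_normed_vector \<Rightarrow> real"
  assumes F_smallo: "F \<in> o[nhds 0](\<lambda>u. (norm u)\<^sup>2)" and h_tendsto: "h \<longlonglongrightarrow> h0"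
  shows "(\<lambda>n. real n * F (local_shift n (h n))) \<longlonglongrightarrow> 0"
proof -
  have "(\<lambda>n. F (local_shift n (h n))) \<in> o(\<lambda>n. (norm (local_shift n (h n)))\<^sup>2)"
    by (rule landau_o.small.compose[OF F_smallo tendsto_local_shift_zero[OF h_tendsto]])
  then have "(\<lambda>n. real n * F (local_shift n (h n))) \<in> o(\<lambda>n. real n * (norm (local_shift n (h n)))\<^sup>2)"
    by (rule landau_o.small.mult_left)
  also have "(\<lambda>n. real n * (norm (local_shift n (h n)))\<^sup>2) \<in> O(\<lambda>_. 1)"
  proof (rule bigoI_tendsto)
    have "(\<lambda>n. (norm (h n))\<^sup>2) \<longlonglongrightarrow> (norm h0)\<^sup>2" by (intro tendsto_intros h_tendsto)
    then show "(\<lambda>n. real n * (norm (local_shift n (h n)))\<^sup>2 / 1) \<longlonglongrightarrow> (norm h0)\<^sup>2"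
      by (rule Lim_transform_eventually)
         (use eventually_gt_at_top[of 0] in eventually_elim, simp add: norm_local_shift_power2)
  qed simp
  finally show ?thesis using smalloD_tendsto by fastforce
qed

lemma cubic_bound_imp_smallo_norm_power2:
  fixes F :: "'v::real_normed_vector \<Rightarrow> real"
  assumes bound: "\<And>u. norm u \<le> 1 \<Longrightarrow> \<bar>F u\<bar> \<le> C * norm u ^ 3"
  shows "F \<in> o[nhds 0](\<lambda>u. (norm u)\<^sup>2)"
proof (rule landau_o.smallI)
  fix c :: real assume c_pos: "0 < c"
  have "\<forall>\<^sub>F u in nhds (0::'v). norm u < min 1 (c / (\<bar>C\<bar> + 1))"
    by (rule order_tendstoD(2)[OF tendsto_norm_zero[OF filterlim_ident]]) (use c_pos in simp)
  then show "\<forall>\<^sub>F u in nhds 0. norm (F u) \<le> c * norm ((norm u)\<^sup>2)"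
  proof eventually_elim
    case (elim u)
    have "\<bar>C\<bar> * norm u \<le> (\<bar>C\<bar> + 1) * norm u" by (intro mult_right_mono) auto
    also have "\<dots> \<le> c" using elim c_pos by (simp add: field_simps)
    finally have "\<bar>C\<bar> * norm u * (norm u)\<^sup>2 \<le> c * (norm u)\<^sup>2" by (rule mult_right_mono) simp
    moreover have "C * norm u ^ 3 \<le> \<bar>C\<bar> * norm u ^ 3" by (intro mult_right_mono) auto
    ultimately show ?case using bound[of u] elim by (simp add: power2_eq_square power3_eq_cube)
  qed
qed

subsection \<open>Characteristic functions of normalised sums\<close>

lemma (in product_prob_space) indep_vars_PiM_coordinates:
  "prob_space.indep_vars (PiM I M) M (\<lambda>i \<omega>. \<omega> i) I"
proof (cases "I = {}")
  case True
  then show ?thesis unfolding P.indep_vars_def P.indep_sets_def by auto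
next
  case False
  have "distr (PiM I M) (PiM I M) (\<lambda>\<omega>. \<lambda>i\<in>I. \<omega> i) = distr (PiM I M) (PiM I M) (\<lambda>\<omega>. \<omega>)"
    by (intro distr_cong) (auto simp: space_PiM PiE_def extensional_restrict)
  also have "\<dots> = PiM I M" by simp
  also have "\<dots> = PiM I (\<lambda>i. distr (PiM I M) (M i) (\<lambda>\<omega>. \<omega> i))"
    by (intro PiM_cong) (simp_all add: PiM_component)
  finally show ?thesis
    using False by (subst P.indep_vars_iff_distr_eq_PiM') auto
qed

lemma (in prob_space) char_normalised_sum_tendsto:
  fixes f :: "'a \<Rightarrow> real"
  assumes f_measurable[measurable]: "f \<in> borel_measurable M" and mean: "expectation f = 0"
    and square_integrable: "integrable M (\<lambda>x. (f x)\<^sup>2)"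
    and variance: "expectation (\<lambda>x. (f x)\<^sup>2) = \<sigma>\<^sup>2" and \<sigma>_pos: "0 < \<sigma>"
  shows "(\<lambda>n. \<integral>X. iexp ((\<Sum>i<n. f (X i)) / sqrt (real n)) \<partial>iid n M) \<longlonglongrightarrow> complex_of_real (exp (- \<sigma>\<^sup>2 / 2))"
proof -
  interpret product_prob_space "\<lambda>_::nat. M" UNIV ..
  let ?S = "\<lambda>n \<omega>. \<Sum>i<n. f (\<omega> i)"
  have distr: "distr (PiM UNIV (\<lambda>_. M)) borel (\<lambda>\<omega>. f (\<omega> i)) = distr M borel f" for i :: nat
    using distr_distr[of f M borel "\<lambda>\<omega>. \<omega> i" "PiM UNIV (\<lambda>_. M)"] by (simp add: PiM_component o_def)
  have integral: "(\<integral>\<omega>. \<phi> (f (\<omega> i)) \<partial>PiM UNIV (\<lambda>_. M)) = (\<integral>x. \<phi> (f x) \<partial>M)"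
    if "\<phi> \<in> borel_measurable borel" for \<phi> :: "real \<Rightarrow> real" and i :: nat
    using integral_distr[of "\<lambda>\<omega>. f (\<omega> i)" "PiM UNIV (\<lambda>_. M)" borel \<phi>] integral_distr[of f M borel \<phi>] that
    by (simp add: distr)
  have "P.indep_vars (\<lambda>_. borel) (\<lambda>i \<omega>. f (\<omega> i)) UNIV"
    by (rule P.indep_vars_compose2[OF indep_vars_PiM_coordinates]) simp
  moreover have "integrable (PiM UNIV (\<lambda>_. M)) (\<lambda>\<omega>. (f (\<omega> i))\<^sup>2)" for i :: nat
    using integrable_distr_eq[of "\<lambda>\<omega>. f (\<omega> i)" "PiM UNIV (\<lambda>_. M)" borel "\<lambda>x. x\<^sup>2"]
      integrable_distr_eq[of f M borel "\<lambda>x. x\<^sup>2"] square_integrable by (simp add: distr)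
  ultimately have "weak_conv_m
      (\<lambda>n. distr (PiM UNIV (\<lambda>_. M)) borel (\<lambda>\<omega>. ?S n \<omega> / sqrt (real n * \<sigma>\<^sup>2)))
      std_normal_distribution"
    using integral[of "\<lambda>x. x"] integral[of "\<lambda>x. x\<^sup>2"] mean variance
    by (intro P.central_limit_theorem_zero_mean[OF _ _ \<sigma>_pos _ _ distr]) simp_all
  then have "(\<lambda>n. char (distr (PiM UNIV (\<lambda>_. M)) borel (\<lambda>\<omega>. ?S n \<omega> / sqrt (real n * \<sigma>\<^sup>2))) \<sigma>)
      \<longlonglongrightarrow> char std_normal_distribution \<sigma>"
    by (intro levy_continuity1 real_dist_normal_dist) (auto intro!: P.real_distribution_distr)
  moreover have "char (distr (PiM UNIV (\<lambda>_. M)) borel (\<lambda>\<omega>. ?S n \<omega> / sqrt (real n * \<sigma>\<^sup>2))) \<sigma>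
      = (\<integral>X. iexp (?S n X / sqrt (real n)) \<partial>iid n M)" for n
  proof -
    have "char (distr (PiM UNIV (\<lambda>_. M)) borel (\<lambda>\<omega>. ?S n \<omega> / sqrt (real n * \<sigma>\<^sup>2))) \<sigma>
        = (\<integral>\<omega>. iexp (?S n (restrict \<omega> {..<n}) / sqrt (real n)) \<partial>PiM UNIV (\<lambda>_. M))"
      using \<sigma>_pos by (simp add: char_def integral_distr real_sqrt_mult)
    also have "\<dots> = (\<integral>X. iexp (?S n X / sqrt (real n)) \<partial>distr (PiM UNIV (\<lambda>_. M)) (iid n M)
        (\<lambda>\<omega>. restrict \<omega> {..<n}))"
      by (intro integral_distr[symmetric] measurable_restrict_subset) simp_all
    finally show ?thesis by (simp add: distr_PiM_restrict_finite)
  qed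
  ultimately show ?thesis by (simp add: char_std_normal_distribution)
qed

subsection \<open>Exponential tilting of a standardised score\<close>

lemma square_add_le: "(x + y)\<^sup>2 \<le> 2 * x\<^sup>2 + 2 * (y::real)\<^sup>2"
  using sum_squares_bound[of x y] by (simp add: power2_sum)

lemma linear_minus_sqrt_tilt_bound:
  fixes y c :: real
  assumes "0 \<le> c"
  shows "(1 + y / 2 - exp ((y - c) / 2))\<^sup>2 \<le> 2 * (\<bar>y\<bar> ^ 4 * exp \<bar>y\<bar>) + 2 * (c\<^sup>2 * exp y)"
proof -
  have "\<bar>1 + y / 2 - exp (y / 2)\<bar> \<le> exp (\<bar>y\<bar> / 2) * (\<bar>y\<bar> / 2)\<^sup>2"
    using Taylor_exp_field[of "y / 2" 1] by (simp add: numeral_eq_Suc abs_minus_commute)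
  also have "\<dots> \<le> exp (\<bar>y\<bar> / 2) * \<bar>y\<bar>\<^sup>2"
    by (intro mult_left_mono power_mono) auto
  finally have "(1 + y / 2 - exp (y / 2))\<^sup>2 \<le> (exp (\<bar>y\<bar> / 2) * \<bar>y\<bar>\<^sup>2)\<^sup>2"
    by (intro power2_le_iff_abs_le[THEN iffD2]) auto
  also have "\<dots> = \<bar>y\<bar> ^ 4 * exp \<bar>y\<bar>"
    by (simp add: power_mult_distrib exp_double[symmetric])
  finally have taylor: "(1 + y / 2 - exp (y / 2))\<^sup>2 \<le> \<bar>y\<bar> ^ 4 * exp \<bar>y\<bar>" .
  have "exp (y / 2) - exp ((y - c) / 2) = exp (y / 2) * (1 - exp (- c / 2))"
    by (simp add: right_diff_distrib exp_add[symmetric] diff_divide_distrib)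
  then have "(exp (y / 2) - exp ((y - c) / 2))\<^sup>2 = (1 - exp (- c / 2))\<^sup>2 * exp y"
    by (simp add: power_mult_distrib exp_double[symmetric])
  also have "\<dots> \<le> c\<^sup>2 * exp y"
    using exp_ge_add_one_self[of "- c / 2"] assms by (intro mult_right_mono power_mono) auto
  finally have normalisation: "(exp (y / 2) - exp ((y - c) / 2))\<^sup>2 \<le> c\<^sup>2 * exp y" .
  have "(1 + y / 2 - exp ((y - c) / 2))\<^sup>2
      = ((1 + y / 2 - exp (y / 2)) + (exp (y / 2) - exp ((y - c) / 2)))\<^sup>2"
    by (rule arg_cong[where f=power2]) simp
  also have "\<dots> \<le> 2 * (1 + y / 2 - exp (y / 2))\<^sup>2 + 2 * (exp (y / 2) - exp ((y - c) / 2))\<^sup>2"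
    by (rule square_add_le)
  also have "\<dots> \<le> 2 * (\<bar>y\<bar> ^ 4 * exp \<bar>y\<bar>) + 2 * (c\<^sup>2 * exp y)"
    using taylor normalisation by (intro add_mono mult_left_mono) auto
  finally show ?thesis .
qed

locale std_score = prob_space P for P :: "'a measure" +
  fixes s :: "'a \<Rightarrow> 'v::euclidean_space"
  assumes score_measurable [measurable]: "s \<in> borel_measurable P"
    and integrable_exp_norm: "\<And>c. integrable P (\<lambda>x. exp (c * norm (s x)))"
    and mean_score: "\<And>v. (\<integral>x. v \<bullet> s x \<partial>P) = 0"
    and variance_score: "\<And>v. (\<integral>x. (v \<bullet> s x)\<^sup>2 \<partial>P) = (norm v)\<^sup>2"
begin

definition mgf :: "'v \<Rightarrow> real" where
  "mgf u = (\<integral>x. exp (u \<bullet> s x) \<partial>P)"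

definition cumulant :: "'v \<Rightarrow> real" where
  "cumulant u = ln (mgf u)"

definition tilt_density :: "'v \<Rightarrow> 'a \<Rightarrow> real" where
  "tilt_density u x = exp (u \<bullet> s x - cumulant u)"

definition exp_moment :: "nat \<Rightarrow> real" where
  "exp_moment k = (\<integral>x. norm (s x) ^ k * exp (norm (s x)) \<partial>P)"

definition score_sum :: "nat \<Rightarrow> (nat \<Rightarrow> 'a) \<Rightarrow> 'v" where
  "score_sum n X = local_shift n (\<Sum>i<n. s (X i))"

lemma integrable_norm_power_exp: "integrable P (\<lambda>x. norm (s x) ^ k * exp (c * norm (s x)))"
proof (rule Bochner_Integration.integrable_bound[OF integrable_exp_norm[of "real k + c"]])
  have "norm (s x) ^ k * exp (c * norm (s x)) \<le> exp ((real k + c) * norm (s x))" for x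
  proof -
    have "norm (s x) \<le> exp (norm (s x))" using exp_ge_add_one_self[of "norm (s x)"] by linarith
    then have "norm (s x) ^ k \<le> exp (norm (s x)) ^ k" by (intro power_mono) auto
    also have "\<dots> = exp (real k * norm (s x))" by (simp add: exp_of_nat_mult)
    finally show ?thesis by (simp add: distrib_right exp_add)
  qed
  then show "AE x in P. norm (norm (s x) ^ k * exp (c * norm (s x)))
      \<le> norm (exp ((real k + c) * norm (s x)))"
    by (simp add: abs_mult)
qed measurable

lemma integrable_inner_power: "integrable P (\<lambda>x. (u \<bullet> s x) ^ k)"
proof (rule Bochner_Integration.integrable_bound)
  show "integrable P (\<lambda>x. norm u ^ k * (norm (s x) ^ k * exp (0 * norm (s x))))"
    by (intro integrable_mult_right integrable_norm_power_exp)
  show "AE x in P. norm ((u \<bullet> s x) ^ k) \<le> norm (norm u ^ k * (norm (s x) ^ k * exp (0 * norm (s x))))"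
    using power_mono[OF Cauchy_Schwarz_ineq2[of u], of _ k]
    by (simp add: power_abs abs_mult power_mult_distrib)
qed measurable

lemma integrable_inner: "integrable P (\<lambda>x. u \<bullet> s x)"
  using integrable_inner_power[of u 1] by simp

lemma integrable_exp_inner: "integrable P (\<lambda>x. exp (u \<bullet> s x))"
proof (rule Bochner_Integration.integrable_bound[OF integrable_exp_norm[of "norm u"]])
  show "AE x in P. norm (exp (u \<bullet> s x)) \<le> norm (exp (norm u * norm (s x)))"
    using norm_cauchy_schwarz[of u] by simp
qed measurable

lemma exp_moment_nonneg: "0 \<le> exp_moment k"
  unfolding exp_moment_def by (rule Bochner_Integration.integral_nonneg) simp

lemma integrable_exp_moment: "integrable P (\<lambda>x. norm (s x) ^ k * exp (norm (s x)))"
  using integrable_norm_power_exp[of k 1] by simp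

lemma abs_inner_power_exp_le:
  assumes "norm u \<le> 1"
  shows "\<bar>u \<bullet> s x\<bar> ^ k * exp \<bar>u \<bullet> s x\<bar> \<le> norm u ^ k * (norm (s x) ^ k * exp (norm (s x)))"
proof -
  have inner: "\<bar>u \<bullet> s x\<bar> \<le> norm u * norm (s x)" by (rule Cauchy_Schwarz_ineq2)
  also have "\<dots> \<le> 1 * norm (s x)" using assms by (rule mult_right_mono) simp
  finally have "exp \<bar>u \<bullet> s x\<bar> \<le> exp (norm (s x))" by simp
  with power_mono[OF inner, of k] show ?thesis
    unfolding mult.assoc[symmetric] power_mult_distrib[symmetric] by (intro mult_mono) auto
qed

lemma mgf_ge_1: "1 \<le> mgf u"
proof -
  have "(\<integral>x. 1 + u \<bullet> s x \<partial>P) \<le> mgf u"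
    unfolding mgf_def by (intro integral_mono) (auto simp: integrable_inner integrable_exp_inner)
  then show ?thesis by (simp add: integrable_inner mean_score prob_space)
qed

lemma exp_cumulant: "exp (cumulant u) = mgf u"
  using mgf_ge_1[of u] by (simp add: cumulant_def)

lemma cumulant_nonneg: "0 \<le> cumulant u"
  using mgf_ge_1[of u] by (simp add: cumulant_def)

lemma mgf_expansion:
  assumes u_small: "norm u \<le> 1"
  shows "\<bar>mgf u - 1 - (norm u)\<^sup>2 / 2\<bar> \<le> exp_moment 3 * norm u ^ 3"
proof -
  let ?R = "\<lambda>x. exp (u \<bullet> s x) - (1 + u \<bullet> s x + (u \<bullet> s x)\<^sup>2 / 2)"
  note integrable_facts = integrable_inner integrable_exp_inner integrable_inner_power
  have "mgf u - 1 - (norm u)\<^sup>2 / 2 = (\<integral>x. ?R x \<partial>P)"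
    by (simp add: integrable_facts mean_score variance_score prob_space mgf_def)
  also have "\<bar>\<dots>\<bar> \<le> (\<integral>x. \<bar>?R x\<bar> \<partial>P)"
    by (rule integral_abs_bound)
  also have "\<dots> \<le> (\<integral>x. norm u ^ 3 * (norm (s x) ^ 3 * exp (norm (s x))) \<partial>P)"
  proof (intro integral_mono integrable_mult_right integrable_exp_moment)
    fix x
    have "\<bar>?R x\<bar> \<le> \<bar>u \<bullet> s x\<bar> ^ 3 * exp \<bar>u \<bullet> s x\<bar> / 2"
      using Taylor_exp_field[of "u \<bullet> s x" 2] by (simp add: numeral_eq_Suc mult.commute)
    also have "\<dots> \<le> \<bar>u \<bullet> s x\<bar> ^ 3 * exp \<bar>u \<bullet> s x\<bar>" by simp
    also have "\<dots> \<le> norm u ^ 3 * (norm (s x) ^ 3 * exp (norm (s x)))"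
      by (rule abs_inner_power_exp_le[OF u_small])
    finally show "\<bar>?R x\<bar> \<le> norm u ^ 3 * (norm (s x) ^ 3 * exp (norm (s x)))" .
  qed (simp add: integrable_facts)
  finally show ?thesis by (simp add: exp_moment_def mult.commute)
qed

lemma mgf_le: "norm u \<le> 1 \<Longrightarrow> mgf u \<le> 1 + (1 + exp_moment 3) * (norm u)\<^sup>2"
proof -
  assume u_small: "norm u \<le> 1"
  have "exp_moment 3 * norm u ^ 3 \<le> exp_moment 3 * norm u ^ 2"
    using u_small by (intro mult_left_mono power_decreasing exp_moment_nonneg) auto
  with mgf_expansion[OF u_small] show ?thesis
    using zero_le_power2[of "norm u"] unfolding distrib_right by linarith
qed

lemma cumulant_le_mgf: "cumulant u \<le> mgf u - 1"
  unfolding cumulant_def using mgf_ge_1[of u] by (intro ln_le_minus_one) simp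

lemma cumulant_le: "norm u \<le> 1 \<Longrightarrow> cumulant u \<le> (1 + exp_moment 3) * (norm u)\<^sup>2"
  using cumulant_le_mgf[of u] mgf_le[of u] by simp

lemma cumulant_expansion:
  assumes u_small: "norm u \<le> 1"
  shows "\<bar>cumulant u - (norm u)\<^sup>2 / 2\<bar> \<le> (exp_moment 3 + (1 + exp_moment 3)\<^sup>2) * norm u ^ 3"
proof -
  define b where "b = mgf u - 1"
  have b_bounds: "0 \<le> b" "b \<le> (1 + exp_moment 3) * (norm u)\<^sup>2"
    using mgf_ge_1[of u] mgf_le[OF u_small] by (simp_all add: b_def)
  have "b - b\<^sup>2 \<le> 1 - 1 / (1 + b)" using b_bounds(1) by (simp add: field_simps power2_eq_square)
  also have "\<dots> \<le> ln (1 + b)" using ln_le_minus_one[of "1 / (1 + b)"] b_bounds(1) by (simp add: ln_div)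
  finally have "b - b\<^sup>2 \<le> cumulant u" by (simp add: cumulant_def b_def)
  moreover have "cumulant u \<le> b" using cumulant_le_mgf by (simp add: b_def)
  moreover have "b\<^sup>2 \<le> (1 + exp_moment 3)\<^sup>2 * norm u ^ 3"
  proof -
    have "b\<^sup>2 \<le> (1 + exp_moment 3)\<^sup>2 * norm u ^ 4"
      using power_mono[OF b_bounds(2,1), of 2] by (simp add: power_mult_distrib)
    also have "\<dots> \<le> (1 + exp_moment 3)\<^sup>2 * norm u ^ 3"
      using u_small by (intro mult_left_mono power_decreasing) auto
    finally show ?thesis .
  qed
  moreover have "\<bar>b - (norm u)\<^sup>2 / 2\<bar> \<le> exp_moment 3 * norm u ^ 3"
    using mgf_expansion[OF u_small] by (simp add: b_def)
  moreover have "0 \<le> b\<^sup>2" by simp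
  ultimately show ?thesis unfolding distrib_right by linarith
qed

lemma cumulant_local_shift_tendsto:
  assumes h_tendsto: "h \<longlonglongrightarrow> h0"
  shows "(\<lambda>n. real n * cumulant (local_shift n (h n))) \<longlonglongrightarrow> (norm h0)\<^sup>2 / 2"
proof -
  let ?u = "\<lambda>n. local_shift n (h n)"
  have "(\<lambda>u. cumulant u - (norm u)\<^sup>2 / 2) \<in> o[nhds 0](\<lambda>u. (norm u)\<^sup>2)"
    by (rule cubic_bound_imp_smallo_norm_power2[OF cumulant_expansion])
  then have "(\<lambda>n. real n * (cumulant (?u n) - (norm (?u n))\<^sup>2 / 2)) \<longlonglongrightarrow> 0"
    by (rule smallo_norm_power2_imp_local_shift_tendsto[OF _ h_tendsto])
  moreover have "(\<lambda>n. (norm (h n))\<^sup>2 / 2) \<longlonglongrightarrow> (norm h0)\<^sup>2 / 2" by (intro tendsto_intros h_tendsto) simp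
  ultimately have "(\<lambda>n. real n * (cumulant (?u n) - (norm (?u n))\<^sup>2 / 2) + (norm (h n))\<^sup>2 / 2)
      \<longlonglongrightarrow> 0 + (norm h0)\<^sup>2 / 2"
    by (rule tendsto_add)
  then have "(\<lambda>n. real n * (cumulant (?u n) - (norm (?u n))\<^sup>2 / 2) + (norm (h n))\<^sup>2 / 2)
      \<longlonglongrightarrow> (norm h0)\<^sup>2 / 2"
    by simp
  then show ?thesis
  proof (rule Lim_transform_eventually)
    show "\<forall>\<^sub>F n in sequentially. real n * (cumulant (?u n) - (norm (?u n))\<^sup>2 / 2) + (norm (h n))\<^sup>2 / 2
        = real n * cumulant (?u n)"
      using eventually_gt_at_top[of 0]
      by eventually_elim (simp add: right_diff_distrib norm_local_shift_power2)
  qed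
qed

lemma tilt_density_measurable [measurable]: "tilt_density u \<in> borel_measurable P"
  unfolding tilt_density_def by measurable

lemma tilt_density_nonneg [simp]: "0 \<le> tilt_density u x"
  by (simp add: tilt_density_def)

lemma prob_density_tilt_density: "prob_density P (tilt_density u)"
proof (rule prob_densityI)
  have "(\<integral>x. tilt_density u x \<partial>P) = 1"
    using mgf_ge_1[of u] by (simp add: tilt_density_def exp_diff exp_cumulant mgf_def[symmetric])
  moreover have "integrable P (tilt_density u)"
    unfolding tilt_density_def by (simp add: exp_diff integrable_exp_inner)
  ultimately show "(\<integral>\<^sup>+x. ennreal (tilt_density u x) \<partial>P) = 1"
    by (subst nn_integral_eq_integral) simp_all
qed simp_all

lemma sqrt_tilt_density: "sqrt (tilt_density u x) = exp ((u \<bullet> s x - cumulant u) / 2)"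
  by (rule real_sqrt_unique) (simp_all add: tilt_density_def flip: exp_double)

definition tilt_residual :: "'v \<Rightarrow> 'a \<Rightarrow> real" where
  "tilt_residual u x = 1 + u \<bullet> s x / 2 - sqrt (tilt_density u x)"

lemma tilt_residual_measurable [measurable]: "tilt_residual u \<in> borel_measurable P"
  unfolding tilt_residual_def by measurable

lemma integrable_tilt_residual: "integrable P (\<lambda>x. (tilt_residual u x)\<^sup>2)"
proof -
  have linear: "integrable P (\<lambda>x. (1 + u \<bullet> s x / 2)\<^sup>2)"
    by (simp add: power2_sum power_divide integrable_inner integrable_inner_power)
  note sqrt = integrable_sqrt_prob_density[OF prob_density_tilt_density[of u]]
  have "integrable P (\<lambda>x. (1 + u \<bullet> s x / 2) * sqrt (tilt_density u x))"
    by (intro integrable_mult_of_square_integrable linear sqrt) measurable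
  then show ?thesis
    unfolding tilt_residual_def power2_diff mult.assoc using linear sqrt
    by (intro Bochner_Integration.integrable_add Bochner_Integration.integrable_diff
        integrable_mult_right)
qed

lemma integral_tilt_residual_le:
  assumes u_small: "norm u \<le> 1"
  shows "(\<integral>x. (tilt_residual u x)\<^sup>2 \<partial>P)
      \<le> (2 * exp_moment 4 + 2 * (1 + exp_moment 3)\<^sup>2 * (2 + exp_moment 3)) * norm u ^ 3"
proof -
  let ?K = "1 + exp_moment 3"
  have "(\<integral>x. (tilt_residual u x)\<^sup>2 \<partial>P)
      \<le> (\<integral>x. 2 * (norm u ^ 4 * (norm (s x) ^ 4 * exp (norm (s x))))
          + 2 * ((cumulant u)\<^sup>2 * exp (u \<bullet> s x)) \<partial>P)"
  proof (intro integral_mono)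
    fix x
    show "(tilt_residual u x)\<^sup>2
        \<le> 2 * (norm u ^ 4 * (norm (s x) ^ 4 * exp (norm (s x)))) + 2 * ((cumulant u)\<^sup>2 * exp (u \<bullet> s x))"
      using linear_minus_sqrt_tilt_bound[OF cumulant_nonneg, of "u \<bullet> s x" u]
          abs_inner_power_exp_le[OF u_small, of x 4]
      by (simp only: tilt_residual_def sqrt_tilt_density)
  qed (simp_all add: integrable_tilt_residual integrable_exp_moment integrable_exp_inner)
  also have "\<dots> = 2 * exp_moment 4 * norm u ^ 4 + 2 * ((cumulant u)\<^sup>2 * mgf u)"
    by (simp add: integrable_exp_moment integrable_exp_inner exp_moment_def mgf_def)
  also have "\<dots> \<le> 2 * exp_moment 4 * norm u ^ 4 + 2 * ((?K * (norm u)\<^sup>2)\<^sup>2 * (1 + ?K))"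
  proof -
    have "mgf u \<le> 1 + ?K * (norm u)\<^sup>2" by (rule mgf_le[OF u_small])
    also have "\<dots> \<le> 1 + ?K * 1\<^sup>2" using u_small exp_moment_nonneg
      by (intro add_left_mono mult_left_mono power_mono) auto
    finally have "mgf u \<le> 1 + ?K" by simp
    then show ?thesis
      using cumulant_le[OF u_small] cumulant_nonneg mgf_ge_1[of u]
      by (intro add_left_mono mult_left_mono mult_mono power_mono) auto
  qed
  also have "\<dots> = (2 * exp_moment 4 + 2 * ?K\<^sup>2 * (2 + exp_moment 3)) * norm u ^ 4"
    unfolding power_mult_distrib by (simp add: algebra_simps)
  also have "\<dots> \<le> (2 * exp_moment 4 + 2 * ?K\<^sup>2 * (2 + exp_moment 3)) * norm u ^ 3"
    using u_small exp_moment_nonneg by (intro mult_left_mono power_decreasing) auto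
  finally show ?thesis .
qed

lemma tilt_residual_smallo: "(\<lambda>u. \<integral>x. (tilt_residual u x)\<^sup>2 \<partial>P) \<in> o[nhds 0](\<lambda>u. (norm u)\<^sup>2)"
proof (rule cubic_bound_imp_smallo_norm_power2)
  show "\<bar>\<integral>x. (tilt_residual u x)\<^sup>2 \<partial>P\<bar>
      \<le> (2 * exp_moment 4 + 2 * (1 + exp_moment 3)\<^sup>2 * (2 + exp_moment 3)) * norm u ^ 3"
      if "norm u \<le> 1" for u
    using integral_tilt_residual_le[OF that] by simp
qed

lemma prob_space_iid: "prob_space (iid n P)"
  by (rule prob_space_PiM) (rule prob_space_axioms)

lemma score_sum_measurable [measurable]: "score_sum n \<in> borel_measurable (iid n P)"
  unfolding score_sum_def local_shift_def by measurable

lemma prod_tilt_density: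
  "(\<Prod>i<n. tilt_density (local_shift n h) (X i))
      = exp (h \<bullet> score_sum n X - real n * cumulant (local_shift n h))"
  by (simp add: tilt_density_def exp_sum[symmetric] sum_subtractf score_sum_def
      inner_local_shift[symmetric] inner_sum_right)

lemma PiM_tilt_density:
  "iid n (real_density P (tilt_density (local_shift n h)))
    = real_density (iid n P) (\<lambda>X. exp (h \<bullet> score_sum n X - real n * cumulant (local_shift n h)))"
  unfolding prod_tilt_density[symmetric]
  by (rule PiM_prob_density[OF sigma_finite_measure_axioms prob_density_tilt_density]) simp

lemma prob_density_sample_tilt:
  "prob_density (iid n P) (\<lambda>X. exp (h \<bullet> score_sum n X - real n * cumulant (local_shift n h)))"
  unfolding prod_tilt_density[symmetric]
  by (rule prob_density_PiM[OF sigma_finite_measure_axioms prob_density_tilt_density]) simp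

lemma char_score_sum_tendsto:
  "(\<lambda>n. \<integral>X. iexp (t \<bullet> score_sum n X) \<partial>iid n P) \<longlonglongrightarrow> complex_of_real (exp (- (norm t)\<^sup>2 / 2))"
proof (cases "t = 0")
  case True
  interpret S: prob_space "iid n P" for n by (rule prob_space_iid)
  show ?thesis using True by (simp add: S.prob_space)
next
  case False
  have "t \<bullet> score_sum n X = (\<Sum>i<n. t \<bullet> s (X i)) / sqrt (real n)" for n X
    by (simp add: score_sum_def local_shift_def inner_sum_right)
  then show ?thesis
    using char_normalised_sum_tendsto[of "\<lambda>x. t \<bullet> s x" "norm t"] False
    by (simp add: mean_score variance_score integrable_inner_power)
qed

lemma eventually_tv_dist_sample_tilt_less:
  assumes weights: "0 < a" "0 < e" "a\<^sup>2 + e\<^sup>2 = 1" and h_tendsto: "h \<longlonglongrightarrow> h0"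
    and margin: "norm h0 * sqrt (2 * (1 - a)) < c"
  shows "\<forall>\<^sub>F n in sequentially. tv_dist (iid n (real_density P (tilt_density (local_shift n (h n)))))
    (gauss_law (h n) \<bind> lift_kernel a e (iid n P) (score_sum n)) < ennreal c"
  unfolding PiM_tilt_density
proof (rule eventually_tv_dist_lift_kernel_less[OF _ char_score_sum_tendsto h_tendsto
    cumulant_local_shift_tendsto[OF h_tendsto] _ margin])
  show "smoothed_statistic (iid n P) (score_sum n) a e" for n
    by (intro smoothed_statistic.intro prob_space_iid smoothed_statistic_axioms.intro weights) measurable
qed (rule prob_density_sample_tilt)

end

subsection \<open>Differentiability in quadratic mean\<close>

text \<open>The family \<^term>\<open>q\<close> is parametrised so that the base point is \<^term>\<open>0\<close>.\<close>

definition dqm_residual :: "('v::real_inner \<Rightarrow> 'a \<Rightarrow> real) \<Rightarrow> ('a \<Rightarrow> 'v) \<Rightarrow> 'v \<Rightarrow> 'a \<Rightarrow> real" where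
  "dqm_residual q s u x = sqrt (q u x) - sqrt (q 0 x) - (1/2) * (u \<bullet> s x) * sqrt (q 0 x)"

definition dqm :: "'a measure \<Rightarrow> ('v::real_inner \<Rightarrow> 'a \<Rightarrow> real) \<Rightarrow> ('a \<Rightarrow> 'v) \<Rightarrow> bool" where
  "dqm \<mu> q s \<longleftrightarrow> (\<forall>\<^sub>F u in nhds 0. integrable \<mu> (\<lambda>x. (dqm_residual q s u x)\<^sup>2))
    \<and> (\<lambda>u. \<integral>x. (dqm_residual q s u x)\<^sup>2 \<partial>\<mu>) \<in> o[nhds 0](\<lambda>u. (norm u)\<^sup>2)"

lemma dqmD:
  assumes "dqm \<mu> q s"
  shows eventually_integrable_dqm_residual:
      "\<forall>\<^sub>F u in nhds 0. integrable \<mu> (\<lambda>x. (dqm_residual q s u x)\<^sup>2)"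
    and dqm_residual_smallo: "(\<lambda>u. \<integral>x. (dqm_residual q s u x)\<^sup>2 \<partial>\<mu>) \<in> o[nhds 0](\<lambda>u. (norm u)\<^sup>2)"
  using assms by (simp_all add: dqm_def)

lemma dqm_residual_zero [simp]: "dqm_residual q s 0 x = 0"
  by (simp add: dqm_residual_def)

lemma ennreal_le_mult_of_inverse_mult_less:
  assumes "ennreal (1 / r\<^sup>2) * I < ennreal c" and "r \<noteq> 0" and "0 \<le> c"
  shows "I \<le> ennreal (c * r\<^sup>2)"
proof -
  have "I = ennreal (r\<^sup>2) * (ennreal (1 / r\<^sup>2) * I)"
    using assms(2) by (simp add: mult.assoc[symmetric] ennreal_mult[symmetric])
  also have "\<dots> \<le> ennreal (r\<^sup>2) * ennreal c"
    using assms(1) by (intro mult_left_mono) auto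
  finally show ?thesis using assms(3) by (simp add: ennreal_mult mult.commute)
qed

lemma dqmI_nn_integral:
  assumes scaled_tendsto: "((\<lambda>u. ennreal (1 / (norm u)\<^sup>2)
      * (\<integral>\<^sup>+x. ennreal ((dqm_residual q s u x)\<^sup>2) \<partial>\<mu>)) \<longlongrightarrow> 0) (at 0)"
    and residual_measurable: "\<forall>\<^sub>F u in nhds 0. dqm_residual q s u \<in> borel_measurable \<mu>"
  shows "dqm \<mu> q s"
proof -
  let ?I = "\<lambda>u. \<integral>\<^sup>+x. ennreal ((dqm_residual q s u x)\<^sup>2) \<partial>\<mu>"
  have small: "\<forall>\<^sub>F u in nhds 0. integrable \<mu> (\<lambda>x. (dqm_residual q s u x)\<^sup>2)
      \<and> (\<integral>x. (dqm_residual q s u x)\<^sup>2 \<partial>\<mu>) \<le> c * (norm u)\<^sup>2" if c_pos: "0 < c" for c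
  proof -
    have "\<forall>\<^sub>F u in at 0. ennreal (1 / (norm u)\<^sup>2) * ?I u < ennreal c"
      using scaled_tendsto c_pos by (intro order_tendstoD(2)) auto
    then have "\<forall>\<^sub>F u in nhds 0. u \<noteq> 0 \<longrightarrow> ennreal (1 / (norm u)\<^sup>2) * ?I u < ennreal c"
      by (simp add: eventually_at_filter)
    with residual_measurable show ?thesis
    proof eventually_elim
      case (elim u)
      have bound: "?I u \<le> ennreal (c * (norm u)\<^sup>2)"
        using elim c_pos ennreal_le_mult_of_inverse_mult_less[of "norm u" "?I u" c]
        by (cases "u = 0") simp_all
      then have integrable_residual: "integrable \<mu> (\<lambda>x. (dqm_residual q s u x)\<^sup>2)"
        using elim by (intro integrableI_nonneg) (auto intro: le_less_trans)
      with bound have "ennreal (\<integral>x. (dqm_residual q s u x)\<^sup>2 \<partial>\<mu>) \<le> ennreal (c * (norm u)\<^sup>2)"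
        by (subst nn_integral_eq_integral[symmetric]) auto
      with integrable_residual c_pos show ?case by simp
    qed
  qed
  show ?thesis
    unfolding dqm_def
  proof (intro conjI landau_o.smallI)
    show "\<forall>\<^sub>F u in nhds 0. integrable \<mu> (\<lambda>x. (dqm_residual q s u x)\<^sup>2)"
      using small[OF zero_less_one] by (rule eventually_mono) simp
    show "\<forall>\<^sub>F u in nhds 0. norm (\<integral>x. (dqm_residual q s u x)\<^sup>2 \<partial>\<mu>) \<le> c * norm ((norm u)\<^sup>2)"
        if "0 < c" for c
      using small[OF that] by (rule eventually_mono) simp
  qed
qed

lemma dqm_compose_linear:
  fixes f :: "'u::euclidean_space \<Rightarrow> 'v::euclidean_space"
  assumes linear_f: "linear f" and dqm: "dqm \<mu> q s"
  shows "dqm \<mu> (\<lambda>u. q (f u)) (\<lambda>x. adjoint f (s x))"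
proof -
  have residual: "dqm_residual (\<lambda>u. q (f u)) (\<lambda>x. adjoint f (s x)) u x = dqm_residual q s (f u) x"
      for u x
    by (simp add: dqm_residual_def adjoint_works[OF linear_f] linear_0[OF linear_f])
  interpret bounded_linear f using linear_f by (simp add: linear_conv_bounded_linear)
  have filterlim_f: "filterlim f (nhds 0) (nhds 0)"
    using tendsto[OF filterlim_ident, of 0] by (simp add: zero)
  obtain C where f_bound: "\<And>u. norm (f u) \<le> norm u * C" using bounded by blast
  have "(\<lambda>u. \<integral>x. (dqm_residual q s (f u) x)\<^sup>2 \<partial>\<mu>) \<in> o[nhds 0](\<lambda>u. (norm (f u))\<^sup>2)"
    by (rule landau_o.small.compose[OF dqm_residual_smallo[OF dqm] filterlim_f])
  also have "(\<lambda>u. (norm (f u))\<^sup>2) \<in> O[nhds 0](\<lambda>u. (norm u)\<^sup>2)"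
  proof (intro bigoI[where c="C\<^sup>2"] always_eventually allI)
    show "norm ((norm (f u))\<^sup>2) \<le> C\<^sup>2 * norm ((norm u)\<^sup>2)" for u
      using power_mono[OF f_bound[of u], of 2] by (simp add: power_mult_distrib mult.commute)
  qed
  finally show ?thesis
    using eventually_compose_filterlim[OF eventually_integrable_dqm_residual[OF dqm] filterlim_f]
    by (simp add: dqm_def residual)
qed

lemma dqm_residual_expansion:
  assumes "0 \<le> q 0 x" "0 \<le> q u x"
  shows "(u \<bullet> s x) * q 0 x + 2 * (sqrt (q 0 x) * dqm_residual q s u x) + (q 0 x - q u x)
    = - (dqm_residual q s u x + (u \<bullet> s x) * sqrt (q 0 x) / 2)\<^sup>2"
proof -
  have "y * f\<^sup>2 + 2 * (f * r) + (f\<^sup>2 - (f + (r + y * f / 2))\<^sup>2) = - (r + y * f / 2)\<^sup>2" for y f r :: real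
    by (simp add: power2_eq_square algebra_simps)
  moreover have "q u x = (sqrt (q 0 x) + (dqm_residual q s u x + (u \<bullet> s x) * sqrt (q 0 x) / 2))\<^sup>2"
    using assms by (simp add: dqm_residual_def)
  ultimately show ?thesis using assms(1) by (metis real_sqrt_pow2)
qed

lemma integrable_square_mult_density:
  fixes f :: "'a \<Rightarrow> real"
  assumes density: "prob_density \<mu> u" and [measurable]: "f \<in> borel_measurable \<mu>"
    and integrable: "integrable \<mu> (\<lambda>x. (f x)\<^sup>2 * u x)"
  shows "integrable \<mu> (\<lambda>x. (f x * sqrt (u x))\<^sup>2)"
    and "(\<integral>x. (f x * sqrt (u x))\<^sup>2 \<partial>\<mu>) = (\<integral>x. (f x)\<^sup>2 * u x \<partial>\<mu>)"
    and "integrable \<mu> (\<lambda>x. f x * u x)"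
proof -
  note [measurable] = prob_density_measurable[OF density]
  have sqrt_square: "(sqrt (u x))\<^sup>2 = u x" if "x \<in> space \<mu>" for x
    using prob_density_nonneg[OF density that] by simp
  then show square: "integrable \<mu> (\<lambda>x. (f x * sqrt (u x))\<^sup>2)"
    and "(\<integral>x. (f x * sqrt (u x))\<^sup>2 \<partial>\<mu>) = (\<integral>x. (f x)\<^sup>2 * u x \<partial>\<mu>)"
    using integrable
    by (simp_all add: power_mult_distrib
        cong: Bochner_Integration.integrable_cong Bochner_Integration.integral_cong)
  have "integrable \<mu> (\<lambda>x. (f x * sqrt (u x)) * sqrt (u x))"
    by (intro integrable_mult_of_square_integrable square prob_density_sqrt[OF density]) measurable
  then show "integrable \<mu> (\<lambda>x. f x * u x)"
    using sqrt_square by (simp add: mult.assoc power2_eq_square[symmetric]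
        cong: Bochner_Integration.integrable_cong)
qed

lemma abs_score_mean_le:
  fixes q :: "'v::euclidean_space \<Rightarrow> 'a \<Rightarrow> real"
  assumes base_density: "prob_density \<mu> (q 0)" and shifted_density: "prob_density \<mu> (q u)"
    and [measurable]: "s \<in> borel_measurable \<mu>"
    and residual: "integrable \<mu> (\<lambda>x. (dqm_residual q s u x)\<^sup>2)"
    and score: "integrable \<mu> (\<lambda>x. (u \<bullet> s x)\<^sup>2 * q 0 x)"
  shows "\<bar>\<integral>x. (u \<bullet> s x) * q 0 x \<partial>\<mu>\<bar> \<le> 2 * (\<integral>x. (dqm_residual q s u x)\<^sup>2 \<partial>\<mu>)
    + (\<integral>x. (u \<bullet> s x)\<^sup>2 * q 0 x \<partial>\<mu>) / 2 + 2 * sqrt (\<integral>x. (dqm_residual q s u x)\<^sup>2 \<partial>\<mu>)"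
proof -
  note [measurable] = prob_density_measurable[OF base_density]
      prob_density_measurable[OF shifted_density]
  let ?R = "dqm_residual q s u" and ?f = "\<lambda>x. sqrt (q 0 x)"
  have [measurable]: "?R \<in> borel_measurable \<mu>" unfolding dqm_residual_def by measurable
  note sqrt_q0 = prob_density_sqrt[OF base_density]
  have "(\<lambda>x. u \<bullet> s x) \<in> borel_measurable \<mu>" by measurable
  note score_facts = integrable_square_mult_density[OF base_density this score]
  have cross: "integrable \<mu> (\<lambda>x. ?f x * ?R x)"
    by (intro integrable_mult_of_square_integrable sqrt_q0 residual) measurable
  note integrable_facts = cross residual score_facts prob_density_integral[OF base_density]
      prob_density_integral[OF shifted_density]
  have "\<bar>(u \<bullet> s x) * q 0 x + 2 * (?f x * ?R x) + (q 0 x - q u x)\<bar>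
      \<le> 2 * (?R x)\<^sup>2 + ((u \<bullet> s x) * ?f x)\<^sup>2 / 2"
    if x_in: "x \<in> space \<mu>" for x
    using square_add_le[of "?R x" "(u \<bullet> s x) * ?f x / 2"]
    by (simp add: dqm_residual_expansion prob_density_nonneg[OF base_density x_in]
        prob_density_nonneg[OF shifted_density x_in] power_divide)
  then have "\<bar>\<integral>x. (u \<bullet> s x) * q 0 x + 2 * (?f x * ?R x) + (q 0 x - q u x) \<partial>\<mu>\<bar>
      \<le> (\<integral>x. 2 * (?R x)\<^sup>2 + ((u \<bullet> s x) * ?f x)\<^sup>2 / 2 \<partial>\<mu>)"
    using integrable_facts by (intro order_trans[OF integral_abs_bound] integral_mono) auto
  then have "\<bar>(\<integral>x. (u \<bullet> s x) * q 0 x \<partial>\<mu>) + 2 * (\<integral>x. ?f x * ?R x \<partial>\<mu>)\<bar>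
      \<le> 2 * (\<integral>x. (?R x)\<^sup>2 \<partial>\<mu>) + (\<integral>x. (u \<bullet> s x)\<^sup>2 * q 0 x \<partial>\<mu>) / 2"
    using integrable_facts by simp
  moreover have "\<bar>\<integral>x. ?f x * ?R x \<partial>\<mu>\<bar> \<le> sqrt (\<integral>x. (?R x)\<^sup>2 \<partial>\<mu>)"
    using order_trans[OF integral_abs_bound Cauchy_Schwarz_integral[of ?f \<mu> ?R]] sqrt_q0 residual by simp
  ultimately show ?thesis by linarith
qed

lemma eventually_abs_score_mean_le:
  fixes q :: "'v::euclidean_space \<Rightarrow> 'a \<Rightarrow> real"
  assumes dqm: "dqm \<mu> q s" and eventually_density: "\<forall>\<^sub>F u in nhds 0. prob_density \<mu> (q u)"
    and score_measurable: "s \<in> borel_measurable \<mu>"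
    and score: "integrable \<mu> (\<lambda>x. (v \<bullet> s x)\<^sup>2 * q 0 x)" and c_pos: "0 < c"
  shows "\<forall>\<^sub>F t in at_right 0. \<bar>\<integral>x. (v \<bullet> s x) * q 0 x \<partial>\<mu>\<bar>
    \<le> t * (2 * (c * norm v)\<^sup>2 + (\<integral>x. (v \<bullet> s x)\<^sup>2 * q 0 x \<partial>\<mu>) / 2) + 2 * (c * norm v)"
proof -
  have base_density: "prob_density \<mu> (q 0)" by (rule eventually_nhds_x_imp_x[OF eventually_density])
  have "\<forall>\<^sub>F u in nhds 0. prob_density \<mu> (q u) \<and> integrable \<mu> (\<lambda>x. (dqm_residual q s u x)\<^sup>2)
      \<and> (\<integral>x. (dqm_residual q s u x)\<^sup>2 \<partial>\<mu>) \<le> c\<^sup>2 * (norm u)\<^sup>2"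
    using eventually_density eventually_integrable_dqm_residual[OF dqm]
        landau_o.smallD[OF dqm_residual_smallo[OF dqm], of "c\<^sup>2"] c_pos
    by (simp add: eventually_conj_iff)
  moreover have "filterlim (\<lambda>t. t *\<^sub>R v) (nhds 0) (at_right 0)"
    by (auto intro!: tendsto_eq_intros)
  ultimately have "\<forall>\<^sub>F t in at_right 0. prob_density \<mu> (q (t *\<^sub>R v))
      \<and> integrable \<mu> (\<lambda>x. (dqm_residual q s (t *\<^sub>R v) x)\<^sup>2)
      \<and> (\<integral>x. (dqm_residual q s (t *\<^sub>R v) x)\<^sup>2 \<partial>\<mu>) \<le> c\<^sup>2 * (norm (t *\<^sub>R v))\<^sup>2"
    by (rule eventually_compose_filterlim)
  then show ?thesis
    using eventually_at_right_less[of 0]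
  proof eventually_elim
    case (elim t)
    let ?\<rho> = "\<integral>x. (dqm_residual q s (t *\<^sub>R v) x)\<^sup>2 \<partial>\<mu>"
    have residual_le: "?\<rho> \<le> (t * (c * norm v))\<^sup>2" using elim by (simp add: power_mult_distrib mult_ac)
    then have "sqrt ?\<rho> \<le> t * (c * norm v)" using elim c_pos by (intro real_le_lsqrt) auto
    moreover have "t * \<bar>\<integral>x. (v \<bullet> s x) * q 0 x \<partial>\<mu>\<bar> \<le>
        2 * ?\<rho> + t\<^sup>2 * (\<integral>x. (v \<bullet> s x)\<^sup>2 * q 0 x \<partial>\<mu>) / 2 + 2 * sqrt ?\<rho>"
      using abs_score_mean_le[where \<mu>=\<mu> and q=q and s=s and u="t *\<^sub>R v"] base_density score_measurable score elim
      by (simp add: abs_mult power_mult_distrib mult.assoc)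
    ultimately have "t * \<bar>\<integral>x. (v \<bullet> s x) * q 0 x \<partial>\<mu>\<bar>
        \<le> t * (t * (2 * (c * norm v)\<^sup>2 + (\<integral>x. (v \<bullet> s x)\<^sup>2 * q 0 x \<partial>\<mu>) / 2) + 2 * (c * norm v))"
      using residual_le by (simp add: power2_eq_square algebra_simps)
    then show ?case using elim by simp
  qed
qed

lemma dqm_mean_zero:
  fixes q :: "'v::euclidean_space \<Rightarrow> 'a \<Rightarrow> real"
  assumes "dqm \<mu> q s" and "\<forall>\<^sub>F u in nhds 0. prob_density \<mu> (q u)"
    and "s \<in> borel_measurable \<mu>" and "integrable \<mu> (\<lambda>x. (v \<bullet> s x)\<^sup>2 * q 0 x)"
  shows "(\<integral>x. (v \<bullet> s x) * q 0 x \<partial>\<mu>) = 0"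
proof -
  define m V where "m = (\<integral>x. (v \<bullet> s x) * q 0 x \<partial>\<mu>)" and "V = (\<integral>x. (v \<bullet> s x)\<^sup>2 * q 0 x \<partial>\<mu>)"
  have bound: "\<bar>m\<bar> \<le> 2 * (c * norm v)" if "0 < c" for c
  proof (rule tendsto_lowerbound)
    show "\<forall>\<^sub>F t in at_right 0. \<bar>m\<bar> \<le> t * (2 * (c * norm v)\<^sup>2 + V / 2) + 2 * (c * norm v)"
      unfolding m_def V_def by (rule eventually_abs_score_mean_le[OF assms that])
    have "((\<lambda>t. t * (2 * (c * norm v)\<^sup>2 + V / 2) + 2 * (c * norm v)) \<longlongrightarrow>
        0 * (2 * (c * norm v)\<^sup>2 + V / 2) + 2 * (c * norm v)) (at_right 0)"
      by (intro tendsto_intros)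
    then show "((\<lambda>t. t * (2 * (c * norm v)\<^sup>2 + V / 2) + 2 * (c * norm v)) \<longlongrightarrow> 2 * (c * norm v))
        (at_right 0)" by simp
  qed simp
  have "\<bar>m\<bar> \<le> 2 * (0 * norm v)"
  proof (rule tendsto_lowerbound)
    show "((\<lambda>c. 2 * (c * norm v)) \<longlongrightarrow> 2 * (0 * norm v)) (at_right 0)" by (intro tendsto_intros)
    show "\<forall>\<^sub>F c in at_right 0. \<bar>m\<bar> \<le> 2 * (c * norm v)"
      using eventually_at_right_less[of 0] by eventually_elim (rule bound)
  qed simp
  then show ?thesis by (simp add: m_def)
qed

locale dqm_score = std_score P s for P :: "'a measure" and s :: "'a \<Rightarrow> 'v::euclidean_space" +
  fixes \<mu> :: "'a measure" and q :: "'v \<Rightarrow> 'a \<Rightarrow> real"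
  assumes P_eq: "P = real_density \<mu> (q 0)"
    and eventually_prob_density: "\<forall>\<^sub>F u in nhds 0. prob_density \<mu> (q u)"
    and dqm: "dqm \<mu> q s"
begin

lemma prob_density_base: "prob_density \<mu> (q 0)"
  by (rule eventually_nhds_x_imp_x[OF eventually_prob_density])

lemma borel_measurable_P_eq: "borel_measurable P = borel_measurable \<mu>"
  by (simp add: P_eq cong: measurable_cong_sets)

lemma integral_P:
  fixes f :: "'a \<Rightarrow> real"
  assumes integrable_f: "integrable P f"
  shows "integrable \<mu> (\<lambda>x. q 0 x * f x)" and "(\<integral>x. q 0 x * f x \<partial>\<mu>) = (\<integral>x. f x \<partial>P)"
proof -
  have [measurable]: "f \<in> borel_measurable \<mu>" using integrable_f borel_measurable_P_eq by auto
  note base_density = prob_density_measurable[OF prob_density_base]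
      prob_density_AE_nonneg[OF prob_density_base]
  show "integrable \<mu> (\<lambda>x. q 0 x * f x)"
    using integrable_f unfolding P_eq by (subst (asm) integrable_real_density) (use base_density in auto)
  show "(\<integral>x. q 0 x * f x \<partial>\<mu>) = (\<integral>x. f x \<partial>P)"
    unfolding P_eq by (subst integral_real_density) (use base_density in auto)
qed

lemma density_tilt: "real_density P (tilt_density u) = real_density \<mu> (\<lambda>x. q 0 x * tilt_density u x)"
proof -
  note [measurable] = prob_density_measurable[OF prob_density_base]
      tilt_density_measurable[unfolded borel_measurable_P_eq]
  have "real_density (real_density \<mu> (q 0)) (tilt_density u)
      = real_density \<mu> (\<lambda>x. q 0 x * tilt_density u x)"
    by (subst density_density_eq)
       (auto intro!: density_cong simp: ennreal_mult' prob_density_nonneg[OF prob_density_base])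
  then show ?thesis by (simp only: P_eq[symmetric])
qed

lemma prob_density_tilt: "prob_density \<mu> (\<lambda>x. q 0 x * tilt_density u x)"
  unfolding prob_density_def density_tilt[symmetric]
proof (intro conjI ballI)
  note [measurable] = prob_density_measurable[OF prob_density_base]
      tilt_density_measurable[unfolded borel_measurable_P_eq]
  show "(\<lambda>x. q 0 x * tilt_density u x) \<in> borel_measurable \<mu>" by measurable
  show "prob_space (real_density P (tilt_density u))"
    by (rule prob_space_prob_density[OF prob_density_tilt_density])
qed (simp add: prob_density_nonneg[OF prob_density_base])

lemma hellinger_sqdist_tilt_le:
  assumes shifted_density: "prob_density \<mu> (q u)"
    and residual: "integrable \<mu> (\<lambda>x. (dqm_residual q s u x)\<^sup>2)"
  shows "hellinger_sqdist \<mu> (q u) (\<lambda>x. q 0 x * tilt_density u x)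
    \<le> 2 * (\<integral>x. (dqm_residual q s u x)\<^sup>2 \<partial>\<mu>) + 2 * (\<integral>x. (tilt_residual u x)\<^sup>2 \<partial>P)"
proof -
  note tilt = integral_P[OF integrable_tilt_residual[of u]]
  have "hellinger_sqdist \<mu> (q u) (\<lambda>x. q 0 x * tilt_density u x)
      \<le> (\<integral>x. 2 * (dqm_residual q s u x)\<^sup>2 + 2 * (q 0 x * (tilt_residual u x)\<^sup>2) \<partial>\<mu>)"
    unfolding hellinger_sqdist_def
  proof (rule integral_mono')
    show "integrable \<mu> (\<lambda>x. 2 * (dqm_residual q s u x)\<^sup>2 + 2 * (q 0 x * (tilt_residual u x)\<^sup>2))"
      using residual tilt(1) by simp
    fix x assume x_in: "x \<in> space \<mu>"
    have "sqrt (q u x) - sqrt (q 0 x * tilt_density u x)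
        = dqm_residual q s u x + sqrt (q 0 x) * tilt_residual u x"
      by (simp add: dqm_residual_def tilt_residual_def real_sqrt_mult algebra_simps)
    then show "(sqrt (q u x) - sqrt (q 0 x * tilt_density u x))\<^sup>2
        \<le> 2 * (dqm_residual q s u x)\<^sup>2 + 2 * (q 0 x * (tilt_residual u x)\<^sup>2)"
      using square_add_le[of "dqm_residual q s u x" "sqrt (q 0 x) * tilt_residual u x"]
        prob_density_nonneg[OF prob_density_base x_in] by (simp add: power_mult_distrib)
  qed (simp add: prob_density_nonneg[OF prob_density_base])
  also have "\<dots> = 2 * (\<integral>x. (dqm_residual q s u x)\<^sup>2 \<partial>\<mu>) + 2 * (\<integral>x. (tilt_residual u x)\<^sup>2 \<partial>P)"
    using residual tilt by simp
  finally show ?thesis .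
qed

lemma tv_dist_product_tilt_tendsto:
  assumes h_tendsto: "h \<longlonglongrightarrow> h0"
  shows "(\<lambda>n. tv_dist (iid n (real_density \<mu> (q (local_shift n (h n)))))
    (iid n (real_density P (tilt_density (local_shift n (h n)))))) \<longlonglongrightarrow> 0"
proof -
  let ?u = "\<lambda>n. local_shift n (h n)"
  define F where "F u = 2 * (\<integral>x. (dqm_residual q s u x)\<^sup>2 \<partial>\<mu>) + 2 * (\<integral>x. (tilt_residual u x)\<^sup>2 \<partial>P)" for u
  have "F \<in> o[nhds 0](\<lambda>u. (norm u)\<^sup>2)"
    using dqm_residual_smallo[OF dqm] tilt_residual_smallo unfolding F_def[abs_def]
    by (intro sum_in_smallo) auto
  from smallo_norm_power2_imp_local_shift_tendsto[OF this h_tendsto]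
  have "(\<lambda>n. ennreal (2 * sqrt (real n * F (?u n)))) \<longlonglongrightarrow> ennreal (2 * sqrt 0)"
    by (intro tendsto_intros)
  then have upper: "(\<lambda>n. ennreal (2 * sqrt (real n * F (?u n)))) \<longlonglongrightarrow> 0" by simp
  have "\<forall>\<^sub>F u in nhds 0. prob_density \<mu> (q u) \<and> integrable \<mu> (\<lambda>x. (dqm_residual q s u x)\<^sup>2)"
    using eventually_prob_density eventually_integrable_dqm_residual[OF dqm]
    by (simp add: eventually_conj_iff)
  then have eventually_regular: "\<forall>\<^sub>F n in sequentially. prob_density \<mu> (q (?u n))
      \<and> integrable \<mu> (\<lambda>x. (dqm_residual q s (?u n) x)\<^sup>2)"
    by (rule eventually_compose_filterlim[OF _ tendsto_local_shift_zero[OF h_tendsto]])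
  show ?thesis
  proof (rule tendsto_sandwich[OF _ _ tendsto_const upper])
    show "\<forall>\<^sub>F n in sequentially. tv_dist (iid n (real_density \<mu> (q (?u n))))
        (iid n (real_density P (tilt_density (?u n)))) \<le> ennreal (2 * sqrt (real n * F (?u n)))"
      using eventually_regular
    proof eventually_elim
      case (elim n)
      have "tv_dist (iid n (real_density \<mu> (q (?u n))))
          (iid n (real_density \<mu> (\<lambda>x. q 0 x * tilt_density (?u n) x)))
        \<le> ennreal (2 * sqrt (\<Sum>i<n. hellinger_sqdist \<mu> (q (?u n)) (\<lambda>x. q 0 x * tilt_density (?u n) x)))"
        using elim by (intro tv_dist_PiM_density_le prob_density_tilt) auto
      also have "\<dots> \<le> ennreal (2 * sqrt (real n * F (?u n)))"
        using hellinger_sqdist_tilt_le[of "?u n"] elim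
        by (intro ennreal_leI) (simp add: F_def mult_left_mono)
      finally show ?case by (simp only: density_tilt)
    qed
  qed simp
qed

end

subsection \<open>Whitening\<close>

lemma orthonormal_family_exists:
  fixes J :: "'v::euclidean_space \<Rightarrow> 'v"
  assumes linear_J: "linear J"
    and symmetric_J: "\<And>u v. u \<bullet> J v = v \<bullet> J u" and positive_J: "\<And>v. v \<noteq> 0 \<Longrightarrow> 0 < v \<bullet> J v"
    and size_I: "finite I" "card I \<le> DIM('v)"
  shows "\<exists>f. \<forall>i\<in>I. \<forall>j\<in>I. f i \<bullet> J (f j) = (if i = j then 1 else 0)"
  using size_I
proof (induction I)
  case (insert k I)
  then obtain f where orthonormal: "\<And>i j. i \<in> I \<Longrightarrow> j \<in> I \<Longrightarrow> f i \<bullet> J (f j) = (if i = j then 1 else 0)"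
    by fastforce
  have "dim (span ((\<lambda>i. J (f i)) ` I)) \<le> card ((\<lambda>i. J (f i)) ` I)"
    unfolding dim_span by (rule dim_le_card') (use insert in simp)
  also have "\<dots> \<le> card I" using insert by (intro card_image_le)
  also have "\<dots> < DIM('v)" using insert by simp
  finally obtain w where w_orthogonal: "w \<noteq> 0" "\<And>v. v \<in> span ((\<lambda>i. J (f i)) ` I) \<Longrightarrow> orthogonal w v"
    using orthogonal_to_subspace_exists by (metis dim_span)
  then have w_conjugate: "w \<bullet> J (f i) = 0" "f i \<bullet> J w = 0" if "i \<in> I" for i
    using that symmetric_J[of w "f i"] by (auto simp: orthogonal_def span_base)
  define c where "c = 1 / sqrt (w \<bullet> J w)"
  define g where "g = f(k := c *\<^sub>R w)"
  have "c * (c * (w \<bullet> J w)) = 1" using positive_J[OF w_orthogonal(1)] by (simp add: c_def)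
  then have "g i \<bullet> J (g j) = (if i = j then 1 else 0)" if "i \<in> insert k I" "j \<in> insert k I" for i j
    using that insert(2) by (auto simp: g_def orthonormal w_conjugate linear_scale[OF linear_J])
  then show ?case by blast
qed simp

lemma whitening_matrix_exists:
  fixes J :: "real^'n^'n"
  assumes symmetric_J: "transpose J = J" and positive_J: "\<And>v. v \<noteq> 0 \<Longrightarrow> 0 < v \<bullet> (J *v v)"
  obtains B :: "real^'n^'n" where "transpose B ** J ** B = mat 1"
proof -
  have "u \<bullet> (J *v v) = v \<bullet> (J *v u)" for u v
    by (metis symmetric_J dot_lmul_matrix inner_commute transpose_matrix_vector)
  then obtain f :: "'n \<Rightarrow> real^'n"
      where orthonormal: "f i \<bullet> (J *v f j) = (if i = j then 1 else 0)" for i j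
    using orthonormal_family_exists[of "(*v) J" "UNIV :: 'n set"] positive_J by auto
  define B :: "real^'n^'n" where "B = (\<chi> r c. f c $ r)"
  have "(transpose B ** J ** B) $ i $ j = f i \<bullet> (J *v f j)" for i j
    by (simp add: B_def matrix_matrix_mult_def transpose_def inner_vec_def matrix_vector_mult_def
        sum_distrib_left sum_distrib_right mult_ac) (rule sum.swap)
  then have "transpose B ** J ** B = mat 1" using orthonormal by (simp add: vec_eq_iff mat_def)
  then show thesis by (rule that)
qed

lemma matrix_inv_eqI:
  fixes A B :: "real^'n^'n"
  assumes "A ** B = mat 1"
  shows "matrix_inv A = B"
proof -
  have left_inverse: "B ** A = mat 1" using assms by (simp add: matrix_left_right_inverse)
  have inverse: "A ** matrix_inv A = mat 1 \<and> matrix_inv A ** A = mat 1"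
    unfolding matrix_inv_def by (rule someI[where x=B]) (simp add: assms left_inverse)
  have "matrix_inv A = (B ** A) ** matrix_inv A" by (simp add: left_inverse)
  also have "\<dots> = B ** (A ** matrix_inv A)" by (simp only: matrix_mul_assoc)
  finally show ?thesis using inverse by simp
qed

lemma matrix_vector_mult_inner: "(B *v v) \<bullet> w = v \<bullet> (transpose B *v w)" for B :: "real^'n^'n"
  by (metis dot_lmul_matrix inner_commute transpose_matrix_vector transpose_transpose)

lemma inner_whitening:
  fixes B J :: "real^'n^'n"
  assumes "transpose B ** J ** B = mat 1"
  shows "(B *v v) \<bullet> (J *v (B *v v)) = (norm v)\<^sup>2"
proof -
  have "(B *v v) \<bullet> (J *v (B *v v)) = v \<bullet> ((transpose B ** J ** B) *v v)"
    unfolding matrix_vector_mult_inner by (simp add: matrix_vector_mul_assoc matrix_mul_assoc)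
  then show ?thesis by (simp add: assms power2_norm_eq_inner)
qed

lemma det_whitening:
  fixes B J :: "real^'n^'n"
  assumes whitening: "transpose B ** J ** B = mat 1"
  shows "det B \<noteq> 0" and "matrix_inv (matrix_inv J) = J" and "det (matrix_inv J) = (det B)\<^sup>2"
proof -
  have "det (transpose B ** J ** B) = 1" using whitening by simp
  then have det_product: "(det B)\<^sup>2 * det J = 1" by (simp add: det_mul power2_eq_square mult_ac)
  then show "det B \<noteq> 0" by auto
  have "invertible J" using det_product by (auto simp: invertible_det_nz)
  then have right_inverse: "J ** matrix_inv J = mat 1" using matrix_inv_eqI unfolding invertible_def
    by blast
  then have "matrix_inv J ** J = mat 1" by (simp add: matrix_left_right_inverse)
  then show "matrix_inv (matrix_inv J) = J" by (rule matrix_inv_eqI)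
  have "det J * det (matrix_inv J) = 1" using arg_cong[OF right_inverse, of det] by (simp add: det_mul)
  then show "det (matrix_inv J) = (det B)\<^sup>2" using det_product
    by (metis mult.commute mult.assoc mult.right_neutral)
qed

lemma mvnormal_eq_distr_gauss_law:
  fixes B J :: "real^'n^'n"
  assumes whitening: "transpose B ** J ** B = mat 1"
  shows "mvnormal (B *v k) (matrix_inv J) = distr (gauss_law k) borel ((*v) B)"
proof -
  note B_det = det_whitening[OF whitening]
  let ?f = "mvnormal_density (B *v k) (matrix_inv J)"
  have [measurable]: "(*v) A \<in> borel_measurable borel" for A :: "real^'n^'n"
    by (intro borel_measurable_continuous_onI continuous_intros)
  have [measurable]: "?f \<in> borel_measurable borel"
    unfolding mvnormal_density_def by measurable
  have density: "\<bar>det B\<bar> * ?f (B *v x) = gauss_density 1 (x - k)" for x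
  proof -
    have "(B *v x - B *v k) \<bullet> (J *v (B *v x - B *v k)) = (norm (x - k))\<^sup>2"
      by (simp add: matrix_vector_mult_diff_distrib[symmetric] inner_whitening[OF whitening])
    moreover have "sqrt ((2 * pi) ^ CARD('n) * (det B)\<^sup>2) = sqrt (2 * pi) ^ CARD('n) * \<bar>det B\<bar>"
      unfolding real_sqrt_mult[of "(2 * pi) ^ _"] real_sqrt_power[of "2 * pi"] real_sqrt_abs ..
    ultimately show ?thesis
      using B_det by (simp add: mvnormal_density_def gauss_density_def del: real_sqrt_mult)
  qed
  have lborel: "lborel = density (distr lborel borel ((*v) B)) (\<lambda>_. ennreal \<bar>det B\<bar>)"
    using lborel_linear[of "(*v) B"] B_det(1) by simp
  have "mvnormal (B *v k) (matrix_inv J)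
      = real_density (density (distr lborel borel ((*v) B)) (\<lambda>_. ennreal \<bar>det B\<bar>)) ?f"
    unfolding mvnormal_def by (rule arg_cong2[where f=density, OF lborel refl])
  also have "\<dots> = distr (density lborel (\<lambda>x. ennreal \<bar>det B\<bar> * ennreal (?f (B *v x)))) borel ((*v) B)"
    by (subst density_density_eq, simp, simp, subst density_distr) simp_all
  finally show ?thesis
    by (simp add: gauss_law_def density[symmetric] ennreal_mult')
qed

subsection \<open>Fisher information\<close>

lemma exp_norm_le_sum_exp_inner:
  fixes y :: "'v::euclidean_space" and c :: real
  defines "D \<equiv> \<bar>c\<bar> * real DIM('v)"
  shows "exp (c * norm y) \<le> (\<Sum>b\<in>Basis. exp ((D *\<^sub>R b) \<bullet> y) + exp ((- D *\<^sub>R b) \<bullet> y))"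
proof -
  have "\<exists>b\<in>Basis. norm y \<le> real DIM('v) * \<bar>y \<bullet> b\<bar>"
  proof (rule ccontr)
    assume "\<not> ?thesis"
    then have "\<bar>y \<bullet> b\<bar> < norm y / real DIM('v)" if "b \<in> Basis" for b
      using that by (auto simp: field_simps not_le)
    then have "(\<Sum>b\<in>Basis. \<bar>y \<bullet> b\<bar>) < (\<Sum>b\<in>(Basis::'v set). norm y / real DIM('v))"
      by (intro sum_strict_mono) auto
    then show False using norm_le_l1[of y] by simp
  qed
  then obtain b where b_max: "b \<in> Basis" "norm y \<le> real DIM('v) * \<bar>y \<bullet> b\<bar>" by blast
  have "c * norm y \<le> \<bar>c\<bar> * norm y" by (intro mult_right_mono) auto
  also have "\<dots> \<le> D * \<bar>y \<bullet> b\<bar>" using mult_left_mono[OF b_max(2), of "\<bar>c\<bar>"] by (simp add: D_def mult.assoc)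
  finally have "exp (c * norm y) \<le> exp (D * \<bar>y \<bullet> b\<bar>)" by simp
  also have "\<dots> \<le> exp ((D *\<^sub>R b) \<bullet> y) + exp ((- D *\<^sub>R b) \<bullet> y)"
    by (cases "0 \<le> y \<bullet> b") (auto simp: inner_commute)
  also have "\<dots> \<le> (\<Sum>b\<in>Basis. exp ((D *\<^sub>R b) \<bullet> y) + exp ((- D *\<^sub>R b) \<bullet> y))"
    using b_max(1) by (intro member_le_sum) (auto intro: add_nonneg_nonneg)
  finally show ?thesis .
qed

lemma integrable_exp_norm_of_inner:
  fixes Y :: "'a \<Rightarrow> 'v::euclidean_space"
  assumes [measurable]: "Y \<in> borel_measurable M" and integrable_exp_inner: "\<And>v. integrable M (\<lambda>x. exp (v \<bullet> Y x))"
  shows "integrable M (\<lambda>x. exp (c * norm (Y x)))"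
proof (rule Bochner_Integration.integrable_bound)
  let ?D = "\<bar>c\<bar> * real DIM('v)"
  show "integrable M (\<lambda>x. \<Sum>b\<in>Basis. exp ((?D *\<^sub>R b) \<bullet> Y x) + exp ((- ?D *\<^sub>R b) \<bullet> Y x))"
    by (intro Bochner_Integration.integrable_sum Bochner_Integration.integrable_add integrable_exp_inner)
  show "AE x in M. norm (exp (c * norm (Y x)))
      \<le> norm (\<Sum>b\<in>Basis. exp ((?D *\<^sub>R b) \<bullet> Y x) + exp ((- ?D *\<^sub>R b) \<bullet> Y x))"
    unfolding real_norm_def abs_exp_cancel
    by (intro AE_I2 order_trans[OF exp_norm_le_sum_exp_inner abs_ge_self])
qed measurable

lemma integrable_square_of_integrable_exp:
  fixes f :: "'a \<Rightarrow> real"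
  assumes [measurable]: "f \<in> borel_measurable M"
    and integrable_exp: "integrable M (\<lambda>x. exp (f x))" "integrable M (\<lambda>x. exp (- f x))"
  shows "integrable M (\<lambda>x. (f x)\<^sup>2)"
proof (rule Bochner_Integration.integrable_bound)
  show "integrable M (\<lambda>x. 2 * (exp (f x) + exp (- f x)))" using integrable_exp by simp
  have "y\<^sup>2 \<le> 2 * (exp y + exp (- y))" for y :: real
  proof -
    have "\<bar>y\<bar>\<^sup>2 / 2 \<le> exp \<bar>y\<bar>" using exp_lower_Taylor_quadratic[of "\<bar>y\<bar>"] by simp
    also have "\<dots> \<le> exp y + exp (- y)" by (cases "0 \<le> y") auto
    finally show ?thesis by simp
  qed
  then show "AE x in M. norm ((f x)\<^sup>2) \<le> norm (2 * (exp (f x) + exp (- f x)))"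
    by (intro AE_I2) (auto intro: order_trans[OF _ abs_ge_self])
qed measurable

lemma transpose_fisher_info: "transpose (fisher_info P l t) = fisher_info P l t"
  by (simp add: fisher_info_def transpose_def vec_eq_iff mult.commute)

context
  fixes P :: "real^'m \<Rightarrow> 'a measure" and l :: "real^'m \<Rightarrow> 'a \<Rightarrow> real^'m" and t :: "real^'m"
  assumes score_measurable [measurable]: "l t \<in> borel_measurable (P t)"
    and square_integrable: "\<And>v. integrable (P t) (\<lambda>x. (v \<bullet> l t x)\<^sup>2)"
begin

lemma integrable_score_mult: "integrable (P t) (\<lambda>x. (v \<bullet> l t x) * (w \<bullet> l t x))"
  by (intro integrable_mult_of_square_integrable square_integrable) measurable

lemma inner_fisher_info: "v \<bullet> (fisher_info P l t *v w) = (\<integral>x. (v \<bullet> l t x) * (w \<bullet> l t x) \<partial>P t)"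
proof -
  have component: "integrable (P t) (\<lambda>x. (l t x $ i) * (l t x $ j))" for i j
    using integrable_score_mult[of "axis i 1" "axis j 1"] by (simp add: inner_axis')
  have "(\<lambda>x. (v \<bullet> l t x) * (w \<bullet> l t x))
      = (\<lambda>x. \<Sum>i\<in>UNIV. \<Sum>j\<in>UNIV. v $ i * (w $ j * ((l t x $ i) * (l t x $ j))))"
    by (simp add: inner_vec_def sum_product mult_ac)
  then show ?thesis
    using component by (simp add: fisher_info_def inner_vec_def matrix_vector_mult_def sum_distrib_left
        Bochner_Integration.integral_sum mult_ac)
qed

lemma inner_fisher_info_pos:
  assumes invertible: "invertible (fisher_info P l t)" and v_nonzero: "v \<noteq> 0"
  shows "0 < v \<bullet> (fisher_info P l t *v v)"
proof -
  have "v \<bullet> (fisher_info P l t *v v) \<noteq> 0"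
  proof
    assume "v \<bullet> (fisher_info P l t *v v) = 0"
    then have "AE x in P t. (v \<bullet> l t x) * (v \<bullet> l t x) = 0"
      unfolding inner_fisher_info
      by (subst (asm) integral_nonneg_eq_0_iff_AE[OF integrable_score_mult]) auto
    then have "AE x in P t. (w \<bullet> l t x) * (v \<bullet> l t x) = 0" for w by (auto elim: AE_mp)
    then have "w \<bullet> (fisher_info P l t *v v) = 0" for w
      unfolding inner_fisher_info by (intro integral_eq_zero_AE)
    from this[of "fisher_info P l t *v v"] have "fisher_info P l t *v v = 0" by simp
    then show False
      using v_nonzero invertible
      by (metis invertible_def matrix_vector_mul_assoc matrix_vector_mul_lid
          matrix_vector_mult_0_right)
  qed
  moreover have "0 \<le> v \<bullet> (fisher_info P l t *v v)"
    unfolding inner_fisher_info by (rule Bochner_Integration.integral_nonneg) simp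
  ultimately show ?thesis by simp
qed

end

subsection \<open>Uniformity on compact sets and diagonal sequences\<close>

lemma LIMSEQ_extend_subseq:
  fixes x :: "nat \<Rightarrow> 'b::topological_space"
  assumes strict_mono_r: "strict_mono (r :: nat \<Rightarrow> nat)" and x_tendsto: "x \<longlonglongrightarrow> l"
  obtains h where "h \<longlonglongrightarrow> l" and "\<And>j. h (r j) = x j"
proof -
  have inj_r: "inj r" using strict_mono_r by (rule strict_mono_imp_inj_on)
  define h where "h n = (if n \<in> range r then x (inv r n) else l)" for n
  have "h \<longlonglongrightarrow> l"
  proof (rule topological_tendstoI)
    fix S assume S_open: "open S" "l \<in> S"
    then obtain N where eventually_in_S: "\<And>j. j \<ge> N \<Longrightarrow> x j \<in> S"
      using topological_tendstoD[OF x_tendsto] unfolding eventually_sequentially by blast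
    have "h n \<in> S" if "n \<ge> r N" for n
      using that eventually_in_S S_open(2) strict_mono_less_eq[OF strict_mono_r]
      by (auto simp: h_def inj_r)
    then show "\<forall>\<^sub>F n in sequentially. h n \<in> S" by (rule eventually_sequentiallyI)
  qed
  then show thesis by (rule that) (simp add: h_def inj_r)
qed

lemma eventually_ball_compactI:
  fixes K :: "'b::metric_space set"
  assumes compact_K: "compact K"
    and sequential:
      "\<And>h h0. h0 \<in> K \<Longrightarrow> h \<longlonglongrightarrow> h0 \<Longrightarrow> \<forall>\<^sub>F n in sequentially. Q n (h n)"
  shows "\<forall>\<^sub>F n in sequentially. \<forall>x\<in>K. Q n x"
proof (rule ccontr)
  assume "\<not> ?thesis"
  then have "infinite {n. \<exists>x\<in>K. \<not> Q n x}"
    by (simp add: eventually_sequentially infinite_nat_iff_unbounded_le)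
  from infinite_enumerate[OF this] obtain r :: "nat \<Rightarrow> nat" and x
    where strict_mono_r: "strict_mono r" and bad: "\<And>j. x j \<in> K" "\<And>j. \<not> Q (r j) (x j)" by simp metis
  from compact_K[unfolded compact_def] bad(1) obtain h0 \<sigma>
      where convergent: "h0 \<in> K" "strict_mono \<sigma>" "(x \<circ> \<sigma>) \<longlonglongrightarrow> h0" by blast
  have strict_mono_r\<sigma>: "strict_mono (r \<circ> \<sigma>)" by (rule strict_mono_o[OF strict_mono_r convergent(2)])
  obtain h where h_extends: "h \<longlonglongrightarrow> h0" "\<And>j. h ((r \<circ> \<sigma>) j) = (x \<circ> \<sigma>) j"
    using LIMSEQ_extend_subseq[OF strict_mono_r\<sigma> convergent(3)] by blast
  from eventually_subseq[OF strict_mono_r\<sigma> sequential[OF convergent(1) h_extends(1)]]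
  show False using bad(2) h_extends(2) by (auto simp: eventually_sequentially)
qed

lemma eventually_diagonal:
  assumes "\<And>k. \<forall>\<^sub>F n in sequentially. Q k n"
  obtains \<kappa> :: "nat \<Rightarrow> nat" where "filterlim \<kappa> at_top sequentially" and "\<forall>\<^sub>F n in sequentially. Q (\<kappa> n) n"
proof -
  from assms obtain N where threshold: "\<And>k n. N k \<le> n \<Longrightarrow> Q k n" unfolding eventually_sequentially by metis
  define \<kappa> where "\<kappa> n = Max {k. k \<le> n \<and> N k \<le> n}" for n
  have finite_indices: "finite {k. k \<le> n \<and> N k \<le> n}" for n by (rule finite_subset[of _ "{..n}"]) auto
  have "filterlim \<kappa> at_top sequentially"
    unfolding filterlim_at_top
  proof
    fix k
    show "\<forall>\<^sub>F n in sequentially. k \<le> \<kappa> n"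
      by (rule eventually_sequentiallyI[of "max k (N k)"]) (simp add: \<kappa>_def finite_indices Max_ge)
  qed
  moreover have "Q (\<kappa> n) n" if "N 0 \<le> n" for n
  proof -
    have "\<kappa> n \<in> {k. k \<le> n \<and> N k \<le> n}" unfolding \<kappa>_def
      by (rule Max_in[OF finite_indices]) (use that in blast)
    then show ?thesis by (simp add: threshold)
  qed
  then have "\<forall>\<^sub>F n in sequentially. Q (\<kappa> n) n" by (rule eventually_sequentiallyI)
  ultimately show thesis by (rule that)
qed

subsection \<open>Lifting the Gaussian shift experiment\<close>

definition smoothing_weight :: "nat \<Rightarrow> real" where
  "smoothing_weight k = 1 - 1 / (2 * real (Suc k) ^ 4)"

lemma smoothing_weight_bounds: "0 < smoothing_weight k" "smoothing_weight k < 1"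
proof -
  define N where "N = real (Suc k) ^ 4"
  have "1 \<le> N" unfolding N_def by (rule one_le_power) simp
  then show "0 < smoothing_weight k" "smoothing_weight k < 1"
    unfolding smoothing_weight_def N_def[symmetric] by (simp_all add: field_simps)
qed

lemma smoothing_weight_rate: "real k * sqrt (2 * (1 - smoothing_weight k)) < 1 / real (Suc k)"
proof -
  have "2 * (1 - smoothing_weight k) = (1 / (real (Suc k))\<^sup>2)\<^sup>2"
    by (simp add: smoothing_weight_def power_divide power_mult[symmetric])
  then have "real k * sqrt (2 * (1 - smoothing_weight k)) = real k / (real (Suc k))\<^sup>2"
    by (simp only: real_sqrt_abs) simp
  also have "\<dots> < real (Suc k) / (real (Suc k))\<^sup>2" by (intro divide_strict_right_mono) auto
  also have "\<dots> = 1 / real (Suc k)" by (simp add: power2_eq_square del: of_nat_Suc)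
  finally show ?thesis .
qed

context dqm_score
begin

lemma eventually_tv_dist_product_kernel_le:
  fixes k :: nat
  assumes weights: "0 < a" "0 < e" "a\<^sup>2 + e\<^sup>2 = 1" and margin: "real k * sqrt (2 * (1 - a)) < c"
  shows "\<forall>\<^sub>F n in sequentially. \<forall>h\<in>cball 0 (real k).
    tv_dist (iid n (real_density \<mu> (q (local_shift n h))))
      (gauss_law h \<bind> lift_kernel a e (iid n P) (score_sum n)) \<le> ennreal (2 * c)"
proof (rule eventually_ball_compactI[OF compact_cball])
  fix h and h0 :: 'v assume h0_in: "h0 \<in> cball 0 (real k)" and h_tendsto: "h \<longlonglongrightarrow> h0"
  have "a\<^sup>2 \<le> 1" using weights(3) by (metis add_increasing2 order_refl zero_le_power2)
  then have "0 \<le> sqrt (2 * (1 - a))" using weights(1) by (simp add: power2_le_iff_abs_le abs_square_le_1)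
  then have "norm h0 * sqrt (2 * (1 - a)) \<le> real k * sqrt (2 * (1 - a))" "0 < c"
    using h0_in margin by (auto intro!: mult_right_mono intro: le_less_trans[rotated])
  then have near: "norm h0 * sqrt (2 * (1 - a)) < c" using margin by linarith
  have "\<forall>\<^sub>F n in sequentially. tv_dist (iid n (real_density \<mu> (q (local_shift n (h n)))))
      (iid n (real_density P (tilt_density (local_shift n (h n))))) < ennreal c"
    using \<open>0 < c\<close> by (intro order_tendstoD(2)[OF tv_dist_product_tilt_tendsto[OF h_tendsto]]) simp
  then show "\<forall>\<^sub>F n in sequentially. tv_dist (iid n (real_density \<mu> (q (local_shift n (h n)))))
      (gauss_law (h n) \<bind> lift_kernel a e (iid n P) (score_sum n)) \<le> ennreal (2 * c)"
    using eventually_tv_dist_sample_tilt_less[OF weights h_tendsto near]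
  proof eventually_elim
    case (elim n)
    have "tv_dist (iid n (real_density \<mu> (q (local_shift n (h n)))))
        (gauss_law (h n) \<bind> lift_kernel a e (iid n P) (score_sum n)) \<le> ennreal c + ennreal c"
      by (rule order_trans[OF tv_dist_triangle
          add_mono[OF less_imp_le[OF elim(1)] less_imp_le[OF elim(2)]]])
         (intro sets_PiM_cong, simp_all add: P_eq)
    then show ?case using \<open>0 < c\<close> by (simp add: ennreal_plus[symmetric] del: ennreal_plus)
  qed
qed

theorem lifting_kernels_exist:
  "\<exists>K. (\<forall>n. K n \<in> borel \<rightarrow>\<^sub>M prob_algebra (iid n P)) \<and> (\<forall>C. compact C \<longrightarrow>
    (\<lambda>n. SUP h\<in>C. tv_dist (iid n (real_density \<mu> (q (local_shift n h)))) (gauss_law h \<bind> K n)) \<longlonglongrightarrow> 0)"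
proof -
  define a e where "a = smoothing_weight" and "e k = sqrt (1 - (a k)\<^sup>2)" for k
  have weights: "0 < a k" "0 < e k" "(a k)\<^sup>2 + (e k)\<^sup>2 = 1" for k
    using smoothing_weight_bounds[of k] power_strict_mono[of "a k" 1 2] by (simp_all add: a_def e_def)
  let ?D = "\<lambda>n h K. tv_dist (iid n (real_density \<mu> (q (local_shift n h)))) (gauss_law h \<bind> K)"
  let ?K = "\<lambda>k n. lift_kernel (a k) (e k) (iid n P) (score_sum n)"
  have fixed_weight: "\<forall>\<^sub>F n in sequentially. \<forall>h\<in>cball 0 (real k). ?D n h (?K k n)
      \<le> ennreal (2 * (1 / real (Suc k)))" for k
    by (rule eventually_tv_dist_product_kernel_le[OF weights smoothing_weight_rate[folded a_def]])
  obtain \<kappa> where \<kappa>_at_top: "filterlim \<kappa> at_top sequentially"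
    and kernels_close: "\<forall>\<^sub>F n in sequentially. \<forall>h\<in>cball 0 (real (\<kappa> n)). ?D n h (?K (\<kappa> n) n)
        \<le> ennreal (2 * (1 / real (Suc (\<kappa> n))))"
    by (rule eventually_diagonal[OF fixed_weight])
  show ?thesis
  proof (intro exI[of _ "\<lambda>n. ?K (\<kappa> n) n"] conjI allI impI)
    show "?K (\<kappa> n) n \<in> borel \<rightarrow>\<^sub>M prob_algebra (iid n P)" for n
      by (intro smoothed_statistic.lift_kernel_measurable smoothed_statistic.intro prob_space_iid
          smoothed_statistic_axioms.intro weights) measurable
    fix C :: "'v set" assume "compact C"
    then obtain b where norm_le_b: "\<And>h. h \<in> C \<Longrightarrow> norm h \<le> b"
      using compact_imp_bounded bounded_iff by metis
    have "(\<lambda>n. ennreal (2 * (1 / real (Suc (\<kappa> n))))) \<longlonglongrightarrow> ennreal (2 * 0)"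
      by (intro tendsto_intros filterlim_compose[OF LIMSEQ_Suc[OF lim_1_over_n] \<kappa>_at_top])
    then have upper: "(\<lambda>n. ennreal (2 * (1 / real (Suc (\<kappa> n))))) \<longlonglongrightarrow> 0" by simp
    have "filterlim (\<lambda>n. real (\<kappa> n)) at_top sequentially"
      by (rule filterlim_compose[OF filterlim_real_sequentially \<kappa>_at_top])
    then have "\<forall>\<^sub>F n in sequentially. b \<le> real (\<kappa> n)" by (simp add: filterlim_at_top)
    with kernels_close have "\<forall>\<^sub>F n in sequentially. (SUP h\<in>C. ?D n h (?K (\<kappa> n) n))
        \<le> ennreal (2 * (1 / real (Suc (\<kappa> n))))"
    proof eventually_elim
      case (elim n)
      have "norm h \<le> real (\<kappa> n)" if "h \<in> C" for h
        using norm_le_b[OF that] elim(2) by linarith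
      with elim(1) show ?case by (intro SUP_least) simp
    qed
    then show "(\<lambda>n. SUP h\<in>C. ?D n h (?K (\<kappa> n) n)) \<longlonglongrightarrow> 0"
      by (intro tendsto_sandwich[OF _ _ tendsto_const upper]) simp_all
  qed
qed

end

locale dqm_model =
  fixes \<Theta> :: "(real^'m) set" and \<mu> :: "'a measure" and p :: "real^'m \<Rightarrow> 'a \<Rightarrow> real"
    and sc :: "real^'m \<Rightarrow> 'a \<Rightarrow> real^'m" and P :: "real^'m \<Rightarrow> 'a measure" and \<theta> :: "real^'m"
  assumes open_\<Theta>: "open \<Theta>" and \<theta>_in: "\<theta> \<in> \<Theta>"
    and density_measurable: "\<And>t. t \<in> \<Theta> \<Longrightarrow> p t \<in> borel_measurable \<mu>"
    and density_nonneg: "\<And>t x. t \<in> \<Theta> \<Longrightarrow> x \<in> space \<mu> \<Longrightarrow> 0 \<le> p t x"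
    and P_density: "\<And>t. t \<in> \<Theta> \<Longrightarrow> P t = real_density \<mu> (p t)"
    and prob_space_P: "\<And>t. t \<in> \<Theta> \<Longrightarrow> prob_space (P t)"
    and score_measurable: "sc \<theta> \<in> borel_measurable \<mu>"
    and quadratic_mean: "((\<lambda>h. ennreal (1 / (norm h)\<^sup>2)
        * (\<integral>\<^sup>+x. ennreal ((sqrt (p (\<theta> + h) x) - sqrt (p \<theta> x)
      - (1/2) * (h \<bullet> sc \<theta> x) * sqrt (p \<theta> x))\<^sup>2) \<partial>\<mu>)) \<longlongrightarrow> 0) (at 0)"
    and exp_moment: "\<And>h. (\<integral>\<^sup>+x. ennreal (exp (h \<bullet> sc \<theta> x)) \<partial>P \<theta>) < \<infinity>"
    and nonsingular: "invertible (fisher_info P sc \<theta>)"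
begin

abbreviation J :: "real^'m^'m" where
  "J \<equiv> fisher_info P sc \<theta>"

lemma prob_density_p: "t \<in> \<Theta> \<Longrightarrow> prob_density \<mu> (p t)"
  using density_measurable density_nonneg prob_space_P by (simp add: prob_density_def P_density)

lemma eventually_add_in: "\<forall>\<^sub>F u in nhds 0. \<theta> + u \<in> \<Theta>"
proof -
  have "((\<lambda>u. \<theta> + u) \<longlongrightarrow> \<theta> + 0) (nhds 0)" by (intro tendsto_intros filterlim_ident)
  then show ?thesis using topological_tendstoD[OF _ open_\<Theta>] \<theta>_in by simp
qed

lemma eventually_local_shift_in:
  assumes "compact C"
  shows "\<forall>\<^sub>F n in sequentially. \<forall>h\<in>C. \<theta> + local_shift n h \<in> \<Theta>"
  using assms
  by (rule eventually_ball_compactI)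
     (rule eventually_compose_filterlim[OF eventually_add_in tendsto_local_shift_zero])

lemma dqm_base: "dqm \<mu> (\<lambda>h. p (\<theta> + h)) (sc \<theta>)"
proof (rule dqmI_nn_integral)
  show "((\<lambda>h. ennreal (1 / (norm h)\<^sup>2)
      * (\<integral>\<^sup>+x. ennreal ((dqm_residual (\<lambda>h. p (\<theta> + h)) (sc \<theta>) h x)\<^sup>2) \<partial>\<mu>)) \<longlongrightarrow> 0) (at 0)"
    using quadratic_mean by (simp add: dqm_residual_def)
  show "\<forall>\<^sub>F h in nhds 0. dqm_residual (\<lambda>h. p (\<theta> + h)) (sc \<theta>) h \<in> borel_measurable \<mu>"
    using eventually_add_in
  proof eventually_elim
    case (elim h)
    note [measurable] = prob_density_measurable[OF prob_density_p[OF elim]]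
      prob_density_measurable[OF prob_density_p[OF \<theta>_in]] score_measurable
    show ?case unfolding dqm_residual_def by simp
  qed
qed

lemma score_measurable_P [measurable]: "sc \<theta> \<in> borel_measurable (P \<theta>)"
  using score_measurable by (simp add: P_density[OF \<theta>_in])

lemma integrable_exp_score: "integrable (P \<theta>) (\<lambda>x. exp (v \<bullet> sc \<theta> x))"
  using exp_moment[of v] by (intro integrableI_nonneg) auto

lemma square_integrable_score: "integrable (P \<theta>) (\<lambda>x. (v \<bullet> sc \<theta> x)\<^sup>2)"
  using integrable_exp_score[of v] integrable_exp_score[of "- v"]
  by (intro integrable_square_of_integrable_exp) simp_all

lemma score_mean_zero: "(\<integral>x. v \<bullet> sc \<theta> x \<partial>P \<theta>) = 0"
proof -
  note density_facts = prob_densityD(1,3)[OF prob_density_p[OF \<theta>_in]] score_measurable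
  note [measurable] = density_facts(1,3)
  have "integrable \<mu> (\<lambda>x. p \<theta> x * (v \<bullet> sc \<theta> x)\<^sup>2)"
    using square_integrable_score[of v] unfolding P_density[OF \<theta>_in]
    by (subst (asm) integrable_real_density) (use density_facts(2) in auto)
  moreover have "\<forall>\<^sub>F u in nhds 0. prob_density \<mu> (p (\<theta> + u))"
    using eventually_add_in by (rule eventually_mono) (rule prob_density_p)
  ultimately have "(\<integral>x. (v \<bullet> sc \<theta> x) * p \<theta> x \<partial>\<mu>) = 0"
    using dqm_mean_zero[OF dqm_base _ score_measurable, of v] by (simp add: mult.commute)
  moreover have "(\<integral>x. v \<bullet> sc \<theta> x \<partial>P \<theta>) = (\<integral>x. p \<theta> x * (v \<bullet> sc \<theta> x) \<partial>\<mu>)"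
    unfolding P_density[OF \<theta>_in] by (rule integral_real_density) (use density_facts(2) in auto)
  ultimately show ?thesis by (simp add: mult.commute)
qed

lemma whitening_exists: obtains B :: "real^'m^'m" where "transpose B ** J ** B = mat 1"
  using whitening_matrix_exists[OF transpose_fisher_info
      inner_fisher_info_pos[of sc \<theta> P, OF score_measurable_P square_integrable_score nonsingular]] .

lemma dqm_score_whitened:
  fixes B :: "real^'m^'m"
  assumes whitening: "transpose B ** J ** B = mat 1"
  shows "dqm_score (P \<theta>) (\<lambda>x. sc \<theta> x v* B) \<mu> (\<lambda>u. p (\<theta> + B *v u))"
proof -
  have inner: "v \<bullet> (w v* B) = (B *v v) \<bullet> w" for v w
    by (metis dot_lmul_matrix inner_commute)
  have [measurable]: "(\<lambda>x. sc \<theta> x v* B) \<in> borel_measurable (P \<theta>)"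
    unfolding transpose_matrix_vector[symmetric]
    by (rule measurable_compose[OF score_measurable_P])
       (intro borel_measurable_continuous_onI continuous_intros)
  interpret prob_space "P \<theta>" by (rule prob_space_P[OF \<theta>_in])
  show ?thesis
  proof
    show "integrable (P \<theta>) (\<lambda>x. exp (c * norm (sc \<theta> x v* B)))" for c
      by (rule integrable_exp_norm_of_inner) (simp_all add: inner integrable_exp_score)
    show "(\<integral>x. v \<bullet> (sc \<theta> x v* B) \<partial>P \<theta>) = 0" for v
      by (simp add: inner score_mean_zero)
    show "(\<integral>x. (v \<bullet> (sc \<theta> x v* B))\<^sup>2 \<partial>P \<theta>) = (norm v)\<^sup>2" for v
      using inner_fisher_info[of sc \<theta> P, OF score_measurable_P square_integrable_score,
          of "B *v v" "B *v v"]
      by (simp add: inner inner_whitening[OF whitening] power2_eq_square)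
    show "P \<theta> = real_density \<mu> (p (\<theta> + B *v 0))"
      by (simp add: P_density[OF \<theta>_in])
    have "filterlim ((*v) B) (nhds 0) (nhds 0)"
      using continuous_on_tendsto_compose[of UNIV "(*v) B" "\<lambda>u. u" 0 "nhds 0"]
      by (simp add: continuous_intros filterlim_ident)
    from eventually_compose_filterlim[OF eventually_add_in this]
    show "\<forall>\<^sub>F u in nhds 0. prob_density \<mu> (p (\<theta> + B *v u))"
      by (rule eventually_mono) (rule prob_density_p)
    show "dqm \<mu> (\<lambda>u. p (\<theta> + B *v u)) (\<lambda>x. sc \<theta> x v* B)"
      using dqm_compose_linear[OF matrix_vector_mul_linear[of B] dqm_base] by (simp add: adjoint_matrix)
  qed measurable
qed

theorem gaussian_lifting_kernels_exist:
  "\<exists>K. (\<forall>n. K n \<in> borel \<rightarrow>\<^sub>M prob_algebra (iid n (P \<theta>))) \<and> (\<forall>C. compact C \<longrightarrow>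
    (\<lambda>n. SUP h\<in>C. tv_dist (iid n (P (\<theta> + local_shift n h))) (mvnormal h (matrix_inv J) \<bind> K n)) \<longlonglongrightarrow> 0)"
proof -
  obtain B :: "real^'m^'m" where whitening: "transpose B ** J ** B = mat 1" by (rule whitening_exists)
  interpret dqm_score "P \<theta>" "\<lambda>x. sc \<theta> x v* B" \<mu> "\<lambda>u. p (\<theta> + B *v u)"
    by (rule dqm_score_whitened[OF whitening])
  obtain B' where "B ** B' = mat 1" "B' ** B = mat 1"
    using det_whitening(1)[OF whitening] unfolding invertible_det_nz[symmetric] invertible_def by blast
  then have B_inverse: "B *v (B' *v h) = h" "B' *v (B *v h) = h" for h
    by (simp_all add: matrix_vector_mul_assoc)
  have [measurable]: "(*v) A \<in> borel_measurable borel" for A :: "real^'m^'m"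
    by (intro borel_measurable_continuous_onI continuous_intros)
  obtain K :: "nat \<Rightarrow> real^'m \<Rightarrow> (nat \<Rightarrow> 'a) measure"
    where kernel[measurable]: "\<And>n. K n \<in> borel \<rightarrow>\<^sub>M prob_algebra (iid n (P \<theta>))"
    and lifting: "\<And>C. compact C
        \<Longrightarrow> (\<lambda>n. SUP h\<in>C. tv_dist (iid n (real_density \<mu> (p (\<theta> + B *v local_shift n h))))
      (gauss_law h \<bind> K n)) \<longlonglongrightarrow> 0" using lifting_kernels_exist by blast
  show ?thesis
  proof (intro exI[of _ "\<lambda>n x. K n (B' *v x)"] conjI allI impI)
    show kernel_whitened: "(\<lambda>x. K n (B' *v x)) \<in> borel \<rightarrow>\<^sub>M prob_algebra (iid n (P \<theta>))" for n
      by measurable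
    have bind_kernel: "mvnormal h (matrix_inv J) \<bind> (\<lambda>x. K n (B' *v x)) = gauss_law (B' *v h) \<bind> K n"
        for h n
    proof -
      have "mvnormal h (matrix_inv J) = distr (gauss_law (B' *v h)) borel ((*v) B)"
        using mvnormal_eq_distr_gauss_law[OF whitening, of "B' *v h"] by (simp add: B_inverse)
      then show ?thesis
        using measurable_prob_algebraD[OF kernel_whitened[of n]]
        by (simp add: bind_distr[where K="iid n (P \<theta>)"] B_inverse)
    qed
    fix C :: "(real^'m) set" assume compact_C: "compact C"
    have "compact ((*v) B' ` C)" by (intro compact_continuous_image compact_C continuous_intros)
    from lifting[OF this] have "(\<lambda>n. SUP h\<in>C. tv_dist (iid n (real_density \<mu> (p (\<theta> + local_shift n h))))
      (gauss_law (B' *v h) \<bind> K n)) \<longlonglongrightarrow> 0"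
      by (simp add: image_image local_shift_def matrix_vector_mult_scaleR B_inverse)
    then show "(\<lambda>n. SUP h\<in>C. tv_dist (iid n (P (\<theta> + local_shift n h)))
      (mvnormal h (matrix_inv J) \<bind> (\<lambda>x. K n (B' *v x)))) \<longlonglongrightarrow> 0"
      by (rule Lim_transform_eventually)
         (use eventually_local_shift_in[OF compact_C] in eventually_elim,
          auto intro!: SUP_cong simp: P_density bind_kernel)
  qed
qed

end

subsection \<open>The auxiliary coordinate\<close>

lemma tv_dist_bind_distr_le:
  assumes f_measurable: "f \<in> S \<rightarrow>\<^sub>M T" and sets_M: "sets M = sets S"
    and kernel: "K \<in> N \<rightarrow>\<^sub>M subprob_algebra S" and nonempty: "space N \<noteq> {}"
  shows "tv_dist (distr M T f) (N \<bind> (\<lambda>x. distr (K x) T f)) \<le> tv_dist M (N \<bind> K)"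
proof -
  have "sets (N \<bind> K) = sets S"
    using kernel nonempty by (intro sets_bind) (auto dest: measurable_space simp: space_subprob_algebra)
  then have sets_eq: "sets M = sets (N \<bind> K)" using sets_M by simp
  have "f \<in> M \<rightarrow>\<^sub>M T" using f_measurable sets_M by (simp cong: measurable_cong_sets)
  then show ?thesis
    unfolding distr_bind[OF kernel nonempty f_measurable, symmetric]
    by (rule tv_dist_distr_le[OF _ sets_eq])
qed

definition ext_law :: "nat \<Rightarrow> (nat \<Rightarrow> 'a::topological_space) measure \<Rightarrow>
    ((nat \<Rightarrow> 'a) \<times> ((real^'m) \<times> real)) measure" where
  "ext_law n M = distr M (ext_space n) (\<lambda>X. (X, (0, 0)))"

lemma pair_zero_measurable:
  assumes "sets M = sets (sample_space n)"
  shows "(\<lambda>X. (X, (0, 0))) \<in> M \<rightarrow>\<^sub>M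
      (ext_space n :: ((nat \<Rightarrow> 'a::topological_space) \<times> ((real^'m) \<times> real)) measure)"
  unfolding ext_space_def measurable_cong_sets[OF assms refl]
  by (intro measurable_Pair measurable_ident measurable_const)
     (auto simp: Omega'_def space_restrict_space)

lemma sets_ext_law [simp]: "sets (ext_law n M) = sets (ext_space n)"
  by (simp add: ext_law_def)

lemma prob_space_ext_law:
  assumes "sets M = sets (sample_space n)" "prob_space M"
  shows "prob_space (ext_law n M)"
  unfolding ext_law_def
  by (rule prob_space.prob_space_distr[OF assms(2) pair_zero_measurable[OF assms(1)]])

lemma distr_fst_ext_law:
  assumes sets_M: "sets M = sets (sample_space n)"
  shows "distr (ext_law n M :: (_ \<times> ((real^'m) \<times> real)) measure) (sample_space n) fst = M"
proof -
  let ?\<iota> = "\<lambda>X. (X, (0 :: real^'m, 0 :: real))"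
  have "distr (distr M (ext_space n) ?\<iota>) (sample_space n) fst = distr M (sample_space n) (fst \<circ> ?\<iota>)"
    by (rule distr_distr[OF _ pair_zero_measurable[OF sets_M]]) (simp add: ext_space_def)
  then show ?thesis using sets_M by (simp add: ext_law_def o_def distr_id2)
qed

lemma ext_law_measurable:
  assumes "sets M = sets (sample_space n)" "K \<in> N \<rightarrow>\<^sub>M prob_algebra M"
  shows "(\<lambda>x. ext_law n (K x)) \<in> N \<rightarrow>\<^sub>M prob_algebra (ext_space n)"
  unfolding ext_law_def
  by (rule measurable_compose[OF assms(2)
      measurable_distr_prob_space[OF pair_zero_measurable[OF assms(1)]]])

lemma tv_dist_bind_ext_law_le:
  assumes sets_M: "sets M = sets (sample_space n)" and sets_S: "sets S = sets (sample_space n)"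
    and kernel: "K \<in> N \<rightarrow>\<^sub>M prob_algebra S" and nonempty: "space N \<noteq> {}"
  shows "tv_dist (ext_law n M) (N \<bind> (\<lambda>x. ext_law n (K x))) \<le> tv_dist M (N \<bind> K)"
  unfolding ext_law_def
  by (rule tv_dist_bind_distr_le[OF pair_zero_measurable[OF sets_S] _
        measurable_prob_algebraD[OF kernel] nonempty]) (simp add: sets_M sets_S)

theorem theorem2:
  fixes \<Theta> :: "(real^'m) set"
    and \<mu> :: "'a::polish_space measure"
    and p :: "real^'m \<Rightarrow> 'a \<Rightarrow> real"
    and sc :: "real^'m \<Rightarrow> 'a \<Rightarrow> real^'m"
    and P :: "real^'m \<Rightarrow> 'a measure"
    and \<theta> :: "real^'m"
  assumes open_\<Theta>: "open \<Theta>"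
    and sets_\<mu>: "sets \<mu> = sets borel"
    and p_meas: "\<And>t. t \<in> \<Theta> \<Longrightarrow> p t \<in> borel_measurable \<mu>"
    and p_nonneg: "\<And>t x. t \<in> \<Theta> \<Longrightarrow> x \<in> space \<mu> \<Longrightarrow> 0 \<le> p t x"
    and P_def: "\<And>t. t \<in> \<Theta> \<Longrightarrow> P t = density \<mu> (\<lambda>x. ennreal (p t x))"
    and P_prob: "\<And>t. t \<in> \<Theta> \<Longrightarrow> prob_space (P t)"
    and sc_meas: "\<And>t. t \<in> \<Theta> \<Longrightarrow> sc t \<in> borel_measurable \<mu>"
    and DQM: "\<And>t. t \<in> \<Theta> \<Longrightarrow>
       ((\<lambda>h. ennreal (1 / (norm h)\<^sup>2) *
           (\<integral>\<^sup>+ x. ennreal ((sqrt (p (t + h) x) - sqrt (p t x)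
                 - (1/2) * (h \<bullet> sc t x) * sqrt (p t x))\<^sup>2) \<partial>\<mu>))
        \<longlongrightarrow> 0) (at 0)"
    and exp_moment: "\<And>K h. compact K \<Longrightarrow> K \<subseteq> \<Theta> \<Longrightarrow>
       (SUP t\<in>K. \<integral>\<^sup>+ x. ennreal (exp (h \<bullet> sc t x)) \<partial>P t) < \<infinity>"
    and J_nonsing: "\<And>t. t \<in> \<Theta> \<Longrightarrow> invertible (fisher_info P sc t)"
    and \<theta>_in: "\<theta> \<in> \<Theta>"
  shows "\<exists>(Pt :: nat \<Rightarrow> real^'m \<Rightarrow> ((nat \<Rightarrow> 'a) \<times> ((real^'m) \<times> real)) measure)
           (R :: nat \<Rightarrow> real^'m \<Rightarrow> ((nat \<Rightarrow> 'a) \<times> ((real^'m) \<times> real)) measure).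
     (\<forall>n. \<forall>t\<in>\<Theta>. prob_space (Pt n t) \<and> sets (Pt n t) = sets (ext_space n)
          \<and> distr (Pt n t) (sample_space n) fst = PiM {..<n} (\<lambda>_. P t)) \<and>
     (\<forall>n. R n \<in> borel \<rightarrow>\<^sub>M prob_algebra (ext_space n)) \<and>
     (\<forall>K'. compact K' \<longrightarrow>
        ((\<lambda>n. SUP h\<in>K'. tv_dist (Pt n (\<theta> + (1 / sqrt (real n)) *\<^sub>R h))
                                  (mvnormal h (matrix_inv (fisher_info P sc \<theta>)) \<bind> R n))
         \<longlonglongrightarrow> 0))"
proof -
  interpret dqm_model \<Theta> \<mu> p sc P \<theta>
    by (rule dqm_model.intro[OF open_\<Theta> \<theta>_in p_meas p_nonneg P_def P_prob sc_meas[OF \<theta>_in]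
        DQM[OF \<theta>_in] _ J_nonsing[OF \<theta>_in]])
       (use exp_moment[of "{\<theta>}"] \<theta>_in in simp_all)
  have sets_sample: "sets (iid n (P t)) = sets (sample_space n)" if "t \<in> \<Theta>" for n t
    unfolding sample_space_def by (intro sets_PiM_cong) (simp_all add: P_def[OF that] sets_\<mu>)
  obtain K where kernel: "\<And>n. K n \<in> borel \<rightarrow>\<^sub>M prob_algebra (iid n (P \<theta>))"
    and lifting: "\<And>C. compact C \<Longrightarrow> (\<lambda>n. SUP h\<in>C. tv_dist (iid n (P (\<theta> + local_shift n h)))
      (mvnormal h (matrix_inv J) \<bind> K n)) \<longlonglongrightarrow> 0"
    using gaussian_lifting_kernels_exist by blast
  have ext_le: "\<forall>\<^sub>F n in sequentially.
      (SUP h\<in>C. tv_dist (ext_law n (iid n (P (\<theta> + (1 / sqrt (real n)) *\<^sub>R h))))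
        (mvnormal h (matrix_inv J) \<bind> (\<lambda>x. ext_law n (K n x))))
      \<le> (SUP h\<in>C. tv_dist (iid n (P (\<theta> + local_shift n h))) (mvnormal h (matrix_inv J) \<bind> K n))"
    if "compact C" for C
    using eventually_local_shift_in[OF that] unfolding local_shift_def
    by eventually_elim (intro SUP_subset_mono order_refl
        tv_dist_bind_ext_law_le[OF _ sets_sample[OF \<theta>_in]],
      use kernel in \<open>auto simp: sets_sample mvnormal_def\<close>)
  show ?thesis
    by (intro exI[of _ "\<lambda>n t. ext_law n (iid n (P t))"] exI[of _ "\<lambda>n x. ext_law n (K n x)"] conjI
        allI ballI impI
        prob_space_ext_law sets_ext_law distr_fst_ext_law ext_law_measurable[OF sets_sample[OF \<theta>_in] kernel]
        sets_sample prob_space_PiM P_prob tendsto_sandwich[OF _ ext_le tendsto_const lifting]) simp_all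
qed

end
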